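(* Let $k\ge2$ and let $G$ be a $k$-graph of order $n$. If $\sigma(G)\le\left(1-\frac1k\right)n+k-1$, then $$\mathrm{D}_1(G)\le\Bigl(1-\frac1k\Bigr)n+2k-1.$$ Otherwise, $$\mathrm{D}_1(G)\le\sigma(G)+k,$$ and this bound is at most $k-1$ apart from the precise value of $\mathrm{D}(G)$.
   Context: A $k$-uniform hypergraph ($k$-graph) $G$ on a finite vertex set $V(G)$ is a family $E(G)$ of $k$-element subsets of $V(G)$; its order is $|V(G)|$. It is regarded as a structure with a single $k$-ary relation $E$, where $E(x_1,\ldots,x_k)$ holds iff $x_1,\dots,x_k$ are pairwise distinct and $\{x_1,\ldots,x_k\}\in E(G)$. First order formulas use $E$, $=$ and the connectives $\neg,\wedge,\vee$. A closed formula defines $G$ if it is true on $G$ and false on every finite structure with a single $k$-ary relation that is not isomorphic to $G$ (of any order). Vertices $u,v$ of $G$ are similar, $u\sim v$, if the transposition $(uv)$ is an automorphism of $G$; this is an equivalence relation, $[u]_G$ is the class of $u$, and $\sigma(G)=\max_{u\in V(G)}|[u]_G|$. The set $\mathrm{Nest}(\Phi)$ of sequences of nested quantifiers is defined inductively: $\mathrm{Nest}(\Phi)=\{\epsilon\}$ (the empty word) for atomic $\Phi$; $\mathrm{Nest}(\neg\Phi)$ is obtained from $\mathrm{Nest}(\Phi)$ by exchanging $\exists$ and $\forall$ in all words; $\mathrm{Nest}(\Phi\wedge\Psi)=\mathrm{Nest}(\Phi\vee\Psi)=\mathrm{Nest}(\Phi)\cup\mathrm{Nest}(\Psi)$; $\mathrm{Nest}(\exists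 x\Phi)$ and $\mathrm{Nest}(\forall x\Phi)$ are obtained by prepending $\exists$, respectively $\forall$, to every word of $\mathrm{Nest}(\Phi)$. The quantifier rank of $\Phi$ is the maximum length of a word in $\mathrm{Nest}(\Phi)$; the alternation number of $\Phi$ is the maximum, over words in $\mathrm{Nest}(\Phi)$, of the number of occurrences of $\exists\forall$ and $\forall\exists$ as consecutive letters. $\mathrm{D}(G)$ (respectively $\mathrm{D}_1(G)$) is the minimum quantifier rank of a formula (respectively of a formula with alternation number at most $1$) defining $G$. *)

theory Defs
  imports Complex_Main "HOL-Combinatorics.Transposition"
begin

section \<open>First order formulas over one relation symbol\<close>

text \<open>Variables are natural numbers. The arity is not part of the type of formulas; it is imposed
  by \<open>wf_fm\<close>.\<close>

datatype fm =
    Eq nat nat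
  | Rel "nat list"
  | Neg fm
  | Conj fm fm
  | Disj fm fm
  | Exists nat fm
  | Forall nat fm

primrec wf_fm :: "nat \<Rightarrow> fm \<Rightarrow> bool" where
  "wf_fm k (Eq x y) \<longleftrightarrow> True"
| "wf_fm k (Rel xs) \<longleftrightarrow> length xs = k"
| "wf_fm k (Neg p) \<longleftrightarrow> wf_fm k p"
| "wf_fm k (Conj p q) \<longleftrightarrow> wf_fm k p \<and> wf_fm k q"
| "wf_fm k (Disj p q) \<longleftrightarrow> wf_fm k p \<and> wf_fm k q"
| "wf_fm k (Exists x p) \<longleftrightarrow> wf_fm k p"
| "wf_fm k (Forall x p) \<longleftrightarrow> wf_fm k p"

primrec free_vars :: "fm \<Rightarrow> nat set" where
  "free_vars (Eq x y) = {x, y}"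
| "free_vars (Rel xs) = set xs"
| "free_vars (Neg p) = free_vars p"
| "free_vars (Conj p q) = free_vars p \<union> free_vars q"
| "free_vars (Disj p q) = free_vars p \<union> free_vars q"
| "free_vars (Exists x p) = free_vars p - {x}"
| "free_vars (Forall x p) = free_vars p - {x}"

datatype quant = QEx | QAll

primrec dual :: "quant \<Rightarrow> quant" where
  "dual QEx = QAll"
| "dual QAll = QEx"

primrec Nest :: "fm \<Rightarrow> quant list set" where
  "Nest (Eq x y) = {[]}"
| "Nest (Rel xs) = {[]}"
| "Nest (Neg p) = map dual ` Nest p"
| "Nest (Conj p q) = Nest p \<union> Nest q"
| "Nest (Disj p q) = Nest p \<union> Nest q"
| "Nest (Exists x p) = Cons QEx ` Nest p"
| "Nest (Forall x p) = Cons QAll ` Nest p"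

lemma finite_Nest: "finite (Nest p)"
  by (induction p) auto

lemma Nest_nonempty: "Nest p \<noteq> {}"
  by (induction p) auto

definition quantifier_rank :: "fm \<Rightarrow> nat" where
  "quantifier_rank p = Max (length ` Nest p)"

definition alternations :: "quant list \<Rightarrow> nat" where
  "alternations w = card {i. Suc i < length w \<and> w ! i \<noteq> w ! Suc i}"

definition alternation_number :: "fm \<Rightarrow> nat" where
  "alternation_number p = Max (alternations ` Nest p)"


section \<open>Finite structures\<close>

record 'a rel_struct =
  univ :: "'a set"
  rel :: "'a list set"

text \<open>As usual in first order logic, universes are nonempty.\<close>

definition finite_struct :: "nat \<Rightarrow> 'a rel_struct \<Rightarrow> bool" where
  "finite_struct k M \<longleftrightarrow> finite (univ M) \<and> univ M \<noteq> {} \<and>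
     rel M \<subseteq> {xs. length xs = k \<and> set xs \<subseteq> univ M}"

definition struct_iso :: "nat \<Rightarrow> 'a rel_struct \<Rightarrow> 'b rel_struct \<Rightarrow> bool" where
  "struct_iso k M N \<longleftrightarrow> (\<exists>f. bij_betw f (univ M) (univ N) \<and>
     (\<forall>xs. length xs = k \<and> set xs \<subseteq> univ M \<longrightarrow> (xs \<in> rel M \<longleftrightarrow> map f xs \<in> rel N)))"

primrec sat :: "'a rel_struct \<Rightarrow> (nat \<Rightarrow> 'a) \<Rightarrow> fm \<Rightarrow> bool" where
  "sat M s (Eq x y) \<longleftrightarrow> s x = s y"
| "sat M s (Rel xs) \<longleftrightarrow> map s xs \<in> rel M"
| "sat M s (Neg p) \<longleftrightarrow> \<not> sat M s p"
| "sat M s (Conj p q) \<longleftrightarrow> sat M s p \<and> sat M s q"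
| "sat M s (Disj p q) \<longleftrightarrow> sat M s p \<or> sat M s q"
| "sat M s (Exists x p) \<longleftrightarrow> (\<exists>a\<in>univ M. sat M (s(x := a)) p)"
| "sat M s (Forall x p) \<longleftrightarrow> (\<forall>a\<in>univ M. sat M (s(x := a)) p)"

text \<open>For closed formulas on a nonempty universe, the choice of the assignment is immaterial.\<close>

definition true_on :: "'a rel_struct \<Rightarrow> fm \<Rightarrow> bool" where
  "true_on M p \<longleftrightarrow> (\<forall>s. range s \<subseteq> univ M \<longrightarrow> sat M s p)"


section \<open>Uniform hypergraphs\<close>

definition kgraph :: "nat \<Rightarrow> 'a set \<Rightarrow> 'a set set \<Rightarrow> bool" where
  "kgraph k V E \<longleftrightarrow> finite V \<and> (\<forall>e\<in>E. e \<subseteq> V \<and> card e = k)"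

definition kgraph_struct :: "nat \<Rightarrow> 'a set \<Rightarrow> 'a set set \<Rightarrow> 'a rel_struct" where
  "kgraph_struct k V E =
     \<lparr>univ = V, rel = {xs. length xs = k \<and> distinct xs \<and> set xs \<in> E}\<rparr>"

definition automorphism :: "'a set \<Rightarrow> 'a set set \<Rightarrow> ('a \<Rightarrow> 'a) \<Rightarrow> bool" where
  "automorphism V E f \<longleftrightarrow> bij_betw f V V \<and> (\<forall>e. e \<subseteq> V \<longrightarrow> (e \<in> E \<longleftrightarrow> f ` e \<in> E))"

definition similar :: "'a set \<Rightarrow> 'a set set \<Rightarrow> 'a \<Rightarrow> 'a \<Rightarrow> bool" where
  "similar V E u v \<longleftrightarrow> u \<in> V \<and> v \<in> V \<and> automorphism V E (Transposition.transpose u v)"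

definition sim_class :: "'a set \<Rightarrow> 'a set set \<Rightarrow> 'a \<Rightarrow> 'a set" where
  "sim_class V E u = {v. similar V E u v}"

definition sigma :: "'a set \<Rightarrow> 'a set set \<Rightarrow> nat" where
  "sigma V E = Max ((\<lambda>u. card (sim_class V E u)) ` V)"


section \<open>Definability\<close>

text \<open>The competing structures live on finite sets of natural numbers. As every finite structure is
  isomorphic to one of these, this amounts to quantifying over all finite structures, see
  \<open>defines_kgraph_false_on\<close> below.\<close>

definition defines_kgraph :: "nat \<Rightarrow> 'a set \<Rightarrow> 'a set set \<Rightarrow> fm \<Rightarrow> bool" where
  "defines_kgraph k V E p \<longleftrightarrow>
     wf_fm k p \<and> free_vars p = {} \<and>
     true_on (kgraph_struct k V E) p \<and>
     (\<forall>N :: nat rel_struct.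
        finite_struct k N \<and> \<not> struct_iso k (kgraph_struct k V E) N \<longrightarrow> \<not> true_on N p)"

definition D :: "nat \<Rightarrow> 'a set \<Rightarrow> 'a set set \<Rightarrow> nat" where
  "D k V E = (LEAST d. \<exists>p. defines_kgraph k V E p \<and> quantifier_rank p = d)"

definition D\<^sub>1 :: "nat \<Rightarrow> 'a set \<Rightarrow> 'a set set \<Rightarrow> nat" where
  "D\<^sub>1 k V E = (LEAST d. \<exists>p. defines_kgraph k V E p \<and> alternation_number p \<le> 1 \<and> quantifier_rank p = d)"

lemma sat_iso:
  assumes f: "bij_betw f (univ M) (univ N)"
    and R: "\<And>xs. length xs = k \<Longrightarrow> set xs \<subseteq> univ M \<Longrightarrow> xs \<in> rel M \<longleftrightarrow> map f xs \<in> rel N"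
    and "wf_fm k p" "range s \<subseteq> univ M"
  shows "sat M s p \<longleftrightarrow> sat N (f \<circ> s) p"
  using assms(3,4)
proof (induction p arbitrary: s)
  case (Eq x y)
  then show ?case using bij_betw_imp_inj_on[OF f] by (auto simp: inj_on_eq_iff range_subsetD)
next
  case (Rel xs)
  then have "set (map s xs) \<subseteq> univ M" by auto
  then show ?case using R[of "map s xs"] Rel by (simp add: comp_def)
next
  case (Exists x p)
  have "sat M (s(x := a)) p \<longleftrightarrow> sat N ((f \<circ> s)(x := f a)) p" if "a \<in> univ M" for a
  proof -
    have "wf_fm k p" "range (s(x := a)) \<subseteq> univ M" using Exists.prems that by auto
    moreover have "f \<circ> s(x := a) = (f \<circ> s)(x := f a)" by auto
    ultimately show ?thesis using Exists.IH by metis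
  qed
  then show ?case by (simp add: comp_def bij_betw_imp_surj_on[OF f, symmetric])
next
  case (Forall x p)
  have "sat M (s(x := a)) p \<longleftrightarrow> sat N ((f \<circ> s)(x := f a)) p" if "a \<in> univ M" for a
  proof -
    have "wf_fm k p" "range (s(x := a)) \<subseteq> univ M" using Forall.prems that by auto
    moreover have "f \<circ> s(x := a) = (f \<circ> s)(x := f a)" by auto
    ultimately show ?thesis using Forall.IH by metis
  qed
  then show ?case by (simp add: comp_def bij_betw_imp_surj_on[OF f, symmetric])
next
  case (Neg p)
  show ?case using Neg.IH[of s] Neg.prems by (simp only: sat.simps wf_fm.simps)
next
  case (Conj p q)
  show ?case using Conj.IH(1)[of s] Conj.IH(2)[of s] Conj.prems
    by (simp only: sat.simps wf_fm.simps)
next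
  case (Disj p q)
  show ?case using Disj.IH(1)[of s] Disj.IH(2)[of s] Disj.prems
    by (simp only: sat.simps wf_fm.simps)
qed

lemma sat_cong:
  assumes "\<And>x. x \<in> free_vars p \<Longrightarrow> s x = t x"
  shows "sat M s p \<longleftrightarrow> sat M t p"
  using assms
proof (induction p arbitrary: s t)
  case (Rel xs)
  then have "map s xs = map t xs" by simp
  then show ?case by (simp del: map_eq_conv)
next
  case (Neg p)
  show ?case using Neg.IH[of s t] Neg.prems by simp
next
  case (Conj p q)
  show ?case using Conj.IH(1)[of s t] Conj.IH(2)[of s t] Conj.prems by simp
next
  case (Disj p q)
  show ?case using Disj.IH(1)[of s t] Disj.IH(2)[of s t] Disj.prems by simp
next
  case (Exists x p)
  have "sat M (s(x := a)) p \<longleftrightarrow> sat M (t(x := a)) p" for a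
    by (rule Exists.IH) (use Exists.prems in auto)
  then show ?case by simp
next
  case (Forall x p)
  have "sat M (s(x := a)) p \<longleftrightarrow> sat M (t(x := a)) p" for a
    by (rule Forall.IH) (use Forall.prems in auto)
  then show ?case by simp
qed simp

lemma true_on_iff_sat:
  assumes "free_vars p = {}" "range s \<subseteq> univ M"
  shows "true_on M p \<longleftrightarrow> sat M s p"
proof -
  have "sat M t p \<longleftrightarrow> sat M s p" for t
    by (rule sat_cong) (simp add: assms(1))
  with assms(2) show ?thesis unfolding true_on_def by blast
qed

lemma defines_kgraph_false_on:
  fixes N :: "'b rel_struct"
  assumes p: "defines_kgraph k V E p" and N: "finite_struct k N"
    and ni: "\<not> struct_iso k (kgraph_struct k V E) N"
  shows "\<not> true_on N p"
proof
  assume t: "true_on N p"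
  have "finite (univ N)" using N by (simp add: finite_struct_def)
  then obtain g :: "'b \<Rightarrow> nat" where g: "inj_on g (univ N)"
    using finite_imp_inj_to_nat_seg by metis
  define N' where "N' = \<lparr>univ = g ` univ N, rel = map g ` rel N\<rparr>"
  have bij: "bij_betw g (univ N) (univ N')"
    using g by (simp add: N'_def bij_betw_def)
  have R: "xs \<in> rel N \<longleftrightarrow> map g xs \<in> rel N'" if "set xs \<subseteq> univ N" for xs
  proof
    assume "map g xs \<in> rel N'"
    then obtain ys where ys: "ys \<in> rel N" "map g xs = map g ys" by (auto simp: N'_def)
    with N have "set ys \<subseteq> univ N" by (auto simp: finite_struct_def)
    with ys that g have "xs = ys" by (metis Un_least inj_on_subset map_inj_on)
    with ys show "xs \<in> rel N" by simp
  qed (simp add: N'_def)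
  have "finite_struct k N'"
    using N by (fastforce simp: finite_struct_def N'_def)
  moreover have "\<not> struct_iso k (kgraph_struct k V E) N'"
  proof
    assume "struct_iso k (kgraph_struct k V E) N'"
    then obtain h where h: "bij_betw h (univ (kgraph_struct k V E)) (univ N')"
      and hR: "\<And>xs. length xs = k \<Longrightarrow> set xs \<subseteq> univ (kgraph_struct k V E) \<Longrightarrow>
        xs \<in> rel (kgraph_struct k V E) \<longleftrightarrow> map h xs \<in> rel N'"
      unfolding struct_iso_def by blast
    define g' where "g' = inv_into (univ N) g"
    have g': "bij_betw g' (univ N') (univ N)"
      unfolding g'_def using bij by (rule bij_betw_inv_into)
    have "xs \<in> rel (kgraph_struct k V E) \<longleftrightarrow> map (g' \<circ> h) xs \<in> rel N"
      if xs: "length xs = k" "set xs \<subseteq> univ (kgraph_struct k V E)" for xs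
    proof -
      have h': "h ` set xs \<subseteq> univ N'" using h xs by (auto simp: bij_betw_def)
      have "set (map (g' \<circ> h) xs) \<subseteq> univ N"
        using h' bij_betw_imp_surj_on[OF g'] by auto
      moreover have "map g (map (g' \<circ> h) xs) = map h xs"
        using h' bij_betw_inv_into_right[OF bij] by (auto simp: g'_def)
      ultimately show ?thesis using R hR xs by metis
    qed
    then have "struct_iso k (kgraph_struct k V E) N"
      unfolding struct_iso_def using bij_betw_trans[OF h g'] by blast
    with ni show False ..
  qed
  ultimately have "\<not> true_on N' p" using p by (simp add: defines_kgraph_def)
  moreover obtain s :: "nat \<Rightarrow> 'b" where s: "range s \<subseteq> univ N"
  proof -
    obtain a where "a \<in> univ N" using N by (auto simp: finite_struct_def)
    then show ?thesis by (intro that[of "\<lambda>_. a"]) auto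
  qed
  then have "range (g \<circ> s) \<subseteq> univ N'" by (auto simp: N'_def)
  ultimately have "\<not> sat N' (g \<circ> s) p"
    using true_on_iff_sat[of p "g \<circ> s" N'] p by (simp add: defines_kgraph_def)
  then have "\<not> sat N s p"
    using sat_iso[of g N N' k p s] bij R s p by (simp add: defines_kgraph_def)
  with t s show False by (simp add: true_on_def)
qed

end

theory Submission
  imports Defs
begin

text \<open>The defining formula says that Duplicator wins the \<open>R\<close>-round Ehrenfeucht game in which Spoiler
  switches structures at most once.

  Spoiler's strategy starts with a set \<open>X\<close> chosen in phases \<open>i = 0, ..., k - 1\<close>. Let the \<open>i\<close>-classes consist
  of the vertices outside \<open>X\<close> that Spoiler, having played \<open>X\<close>, cannot tell apart in \<open>i\<close> further moves.
  In phase \<open>i\<close>, suppose that exactly one of \<open>T + u\<close> and \<open>T + v\<close> is an edge, for \<open>u\<close> and \<open>v\<close> in the same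
  \<open>i\<close>-class. If \<open>T\<close> contains at most \<open>i\<close> entire \<open>i\<close>-classes, then adding the rest of \<open>T\<close> to \<open>X\<close> splits a
  class. As each addition costs at most \<open>k - 1\<close> vertices, \<open>|X| \<le> (k - 1) (m - 1)\<close> with \<open>m\<close> classes. For
  \<open>i = k - 1\<close> the set \<open>T\<close> would contain \<open>k\<close> classes, hence the \<open>(k - 1)\<close>-classes are similarity classes
  outside \<open>X\<close>.

  After Spoiler has played \<open>X\<close>, the next rounds force every vertex of the other hypergraph into a
  definite class, and every class but a largest one is small enough to be counted exactly. If only
  the size of this last class differs, let \<open>s\<close> be the size of its smaller version. In the hypergraph
  where it is larger, Spoiler plays one vertex of every similarity class of size larger than \<open>s\<close>. As
  the other hypergraph has fewer of these classes, \<open>s\<close> more moves in one of them expose the difference.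

  For the lower bound, adding a further copy of a vertex in a class of size \<open>\<sigma> \<ge> k\<close> is not noticed
  by formulas of quantifier rank at most \<open>\<sigma>\<close>.\<close>

section \<open>The game with one alternation\<close>

text \<open>The single switch is the obstacle. Once Spoiler moves in the other hypergraph, a
  mismatch at \<open>T\<close> can only be shown by playing there the vertices that answer
  \<open>T\<close>, and Duplicator's replies stay in \<open>T\<close> only as far as the remaining
  rounds can recognise them. Moves come one after another, so the vertices of \<open>T - X\<close>
  get pairwise distinct numbers of remaining rounds, all below i. This is what the phases are for: a
  vertex whose class of phase l lies inside \<open>T\<close> is pinned to \<open>T\<close> when l
  rounds remain, and having more than l such vertices for every l < i is a Hall condition for
  assigning these numbers. The bound on X combines with |X| + m \<le> n to |X| \<le> (1 - 1/k)(n -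
  1). The remaining 2k - 1 rounds are at most k moves that exhibit an edge and k - 1 rounds that
  recognise the classes of the replies. In the final count, one vertex, s twins of it and k - 1
  rounds to refute a false twin make s + k, the origin of \<sigma> + k.\<close>

definition agree :: "nat \<Rightarrow> 'a rel_struct \<Rightarrow> 'b rel_struct \<Rightarrow> 'a list \<Rightarrow> 'b list \<Rightarrow> bool" where
  "agree k G M s t \<longleftrightarrow> length s = length t \<and>
     (\<forall>i<length s. \<forall>j<length s. s ! i = s ! j \<longleftrightarrow> t ! i = t ! j) \<and>
     (\<forall>js. length js = k \<and> set js \<subseteq> {..<length s} \<longrightarrow>
        (map ((!) s) js \<in> rel G \<longleftrightarrow> map ((!) t) js \<in> rel M))"

text \<open>Duplicator wins the remaining \<open>r\<close> rounds if Spoiler plays in \<open>M\<close> only (\<open>simU\<close>), respectively if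
  Spoiler starts in \<open>G\<close> and may switch to \<open>M\<close> once (\<open>simE\<close>).\<close>

primrec simU :: "nat \<Rightarrow> 'a rel_struct \<Rightarrow> 'b rel_struct \<Rightarrow> nat \<Rightarrow> 'a list \<Rightarrow> 'b list \<Rightarrow> bool" where
  "simU k G M 0 s t \<longleftrightarrow> agree k G M s t"
| "simU k G M (Suc r) s t \<longleftrightarrow> (\<forall>b\<in>univ M. \<exists>a\<in>univ G. simU k G M r (s @ [a]) (t @ [b]))"

primrec simE :: "nat \<Rightarrow> 'a rel_struct \<Rightarrow> 'b rel_struct \<Rightarrow> nat \<Rightarrow> 'a list \<Rightarrow> 'b list \<Rightarrow> bool" where
  "simE k G M 0 s t \<longleftrightarrow> agree k G M s t"
| "simE k G M (Suc r) s t \<longleftrightarrow> simU k G M (Suc r) s t \<and>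
     (\<forall>a\<in>univ G. \<exists>b\<in>univ M. simE k G M r (s @ [a]) (t @ [b]))"

lemma agree_length: "agree k G M s t \<Longrightarrow> length s = length t"
  by (simp add: agree_def)

lemma agree_refl: "agree k G G s s"
  by (simp add: agree_def)

lemma agree_sym: "agree k G M s t \<longleftrightarrow> agree k M G t s"
  unfolding agree_def by (auto simp: eq_commute)

lemma agree_select:
  assumes a: "agree k G M s t" and js: "set js \<subseteq> {..<length s}"
  shows "agree k G M (map ((!) s) js) (map ((!) t) js)"
proof -
  have "map ((!) (map ((!) s) js)) is = map ((!) s) (map ((!) js) is)"
    "map ((!) (map ((!) t) js)) is = map ((!) t) (map ((!) js) is)"
    if "set is \<subseteq> {..<length js}" for "is" :: "nat list"
    using that by (auto simp: subset_iff)
  moreover have "length (map ((!) js) is) = k \<and> set (map ((!) js) is) \<subseteq> {..<length s}"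
    if "length is = k" "set is \<subseteq> {..<length js}" for "is" :: "nat list"
    using that js by (auto simp: subset_iff)
  moreover have "js ! i < length s" if "i < length js" for i
    using that js by (meson lessThan_iff nth_mem subsetD)
  ultimately show ?thesis
    using a unfolding agree_def by (simp del: map_map)
qed

lemma simU_refl: "simU k G G r s s"
  by (induction r arbitrary: s) (auto simp: agree_refl)

lemma simE_refl: "simE k G G r s s"
  by (induction r arbitrary: s) (auto simp: agree_refl simU_refl simp del: simU.simps(2))

lemma simU_length: "simU k G M r s t \<Longrightarrow> univ M \<noteq> {} \<Longrightarrow> length s = length t"
proof (induction r arbitrary: s t)
  case (Suc r)
  then obtain b a where "simU k G M r (s @ [a]) (t @ [b])" by fastforce
  with Suc show ?case by fastforce
qed (simp add: agree_length)

text \<open>Duplicator's strategy survives forgetting, reordering or repeating pebbles. In the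
  induction the new move is kept by appending its index \<open>length s\<close> to the
  selection.\<close>

lemma simU_select:
  assumes "simU k G M r s t" "univ M \<noteq> {}" "set js \<subseteq> {..<length s}"
  shows "simU k G M r (map ((!) s) js) (map ((!) t) js)"
  using assms
proof (induction r arbitrary: s t js)
  case 0
  then show ?case by (simp add: agree_select)
next
  case (Suc r)
  have l: "length s = length t" using simU_length Suc.prems by blast
  show ?case unfolding simU.simps
  proof
    fix b assume "b \<in> univ M"
    then obtain a where a: "a \<in> univ G" "simU k G M r (s @ [a]) (t @ [b])"
      using Suc.prems by auto
    have 1: "simU k G M r (map ((!) (s @ [a])) (js @ [length s])) (map ((!) (t @ [b])) (js @ [length s]))"
      by (rule Suc.IH[OF a(2)]) (use Suc.prems in auto)
    have 2: "map ((!) (s @ [a])) (js @ [length s]) = map ((!) s) js @ [a]"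
      using Suc.prems(3) by (auto simp: nth_append)
    have 3: "map ((!) (t @ [b])) (js @ [length s]) = map ((!) t) js @ [b]"
      using Suc.prems(3) l by (auto simp: nth_append)
    show "\<exists>a\<in>univ G. simU k G M r (map ((!) s) js @ [a]) (map ((!) t) js @ [b])"
      using 1[unfolded 2 3] a(1) by blast
  qed
qed

text \<open>A nonempty \<open>univ M\<close> matters here: without a possible move any positive
  number of rounds would be won vacuously.\<close>

lemma simU_agree:
  assumes "simU k G M r s t" "univ M \<noteq> {}"
  shows "agree k G M s t"
  using assms
proof (induction r arbitrary: s t)
  case (Suc r)
  then obtain b a where ba: "simU k G M r (s @ [a]) (t @ [b])" by fastforce
  with Suc have ag: "agree k G M (s @ [a]) (t @ [b])" by auto
  then have l: "length s = length t" by (auto dest: agree_length)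
  have "agree k G M (map ((!) (s @ [a])) [0..<length s]) (map ((!) (t @ [b])) [0..<length s])"
    by (rule agree_select[OF ag]) auto
  moreover have "map ((!) (s @ [a])) [0..<length s] = s" "map ((!) (t @ [b])) [0..<length s] = t"
    using l by (auto intro!: nth_equalityI simp: nth_append)
  ultimately show ?case by simp
qed simp

lemma simU_Suc: "simU k G M (Suc r) s t \<Longrightarrow> univ M \<noteq> {} \<Longrightarrow> simU k G M r s t"
proof (induction r arbitrary: s t)
  case 0
  then show ?case using simU_agree by (metis simU.simps(1))
next
  case (Suc r)
  show ?case unfolding simU.simps(2)[of _ _ _ r]
  proof
    fix b assume "b \<in> univ M"
    then show "\<exists>a\<in>univ G. simU k G M r (s @ [a]) (t @ [b])"
      using Suc by (metis simU.simps(2))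
  qed
qed

lemma simU_mono: "simU k G M r s t \<Longrightarrow> univ M \<noteq> {} \<Longrightarrow> r' \<le> r \<Longrightarrow> simU k G M r' s t"
  by (induction r) (auto simp: le_Suc_eq dest: simU_Suc simp del: simU.simps)

lemma simE_simU: "simE k G M r s t \<Longrightarrow> simU k G M r s t"
  by (cases r) auto

lemma simE_Suc: "simE k G M (Suc r) s t \<Longrightarrow> univ M \<noteq> {} \<Longrightarrow> simE k G M r s t"
proof (induction r arbitrary: s t)
  case 0
  then show ?case using simU_agree simE_simU by (metis simE.simps(1))
next
  case (Suc r)
  have "simU k G M (Suc r) s t" using Suc.prems simE_simU simU_Suc by blast
  moreover have "\<forall>a\<in>univ G. \<exists>b\<in>univ M. simE k G M r (s @ [a]) (t @ [b])"
    using Suc by (metis simE.simps(2))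
  ultimately show ?case unfolding simE.simps(2)[of _ _ _ r] by blast
qed

lemma simE_mono: "simE k G M r s t \<Longrightarrow> univ M \<noteq> {} \<Longrightarrow> r' \<le> r \<Longrightarrow> simE k G M r' s t"
  by (induction r) (auto simp: le_Suc_eq dest: simE_Suc simp del: simE.simps)

lemma simU_moves:
  assumes "simU k G M (length zs + r) s t" "set zs \<subseteq> univ M"
  obtains bs where "length bs = length zs" "set bs \<subseteq> univ G" "simU k G M r (s @ bs) (t @ zs)"
proof -
  have "\<exists>bs. length bs = length zs \<and> set bs \<subseteq> univ G \<and> simU k G M r (s @ bs) (t @ zs)"
    using assms
  proof (induction zs arbitrary: s t)
    case (Cons z zs)
    then obtain a where a: "a \<in> univ G" "simU k G M (length zs + r) (s @ [a]) (t @ [z])"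
      by auto
    with Cons.IH[OF a(2)] Cons.prems obtain bs where
      "length bs = length zs" "set bs \<subseteq> univ G" "simU k G M r ((s @ [a]) @ bs) ((t @ [z]) @ zs)"
      by auto
    then show ?case using a by (intro exI[of _ "a # bs"]) auto
  qed simp
  then show thesis using that by blast
qed

lemma simE_moves:
  assumes "simE k G M (length zs + r) s t" "set zs \<subseteq> univ G"
  obtains bs where "length bs = length zs" "set bs \<subseteq> univ M" "simE k G M r (s @ zs) (t @ bs)"
proof -
  have "\<exists>bs. length bs = length zs \<and> set bs \<subseteq> univ M \<and> simE k G M r (s @ zs) (t @ bs)"
    using assms
  proof (induction zs arbitrary: s t)
    case (Cons z zs)
    then obtain a where a: "a \<in> univ M" "simE k G M (length zs + r) (s @ [z]) (t @ [a])"
      by auto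
    with Cons.IH[OF a(2)] Cons.prems obtain bs where
      "length bs = length zs" "set bs \<subseteq> univ M" "simE k G M r ((s @ [z]) @ zs) ((t @ [a]) @ bs)"
      by auto
    then show ?case using a by (intro exI[of _ "a # bs"]) auto
  qed simp
  then show thesis using that by blast
qed

section \<open>Formulas expressing the game, and their quantifier words\<close>

definition lit :: "bool \<Rightarrow> fm \<Rightarrow> fm" where
  "lit b p = (if b then p else Neg p)"

definition diag :: "nat \<Rightarrow> 'a rel_struct \<Rightarrow> 'a list \<Rightarrow> fm" where
  "diag k G s = foldr Conj
     ([lit (s ! i = s ! j) (Eq i j). i \<leftarrow> [0..<length s], j \<leftarrow> [0..<length s]] @
      [lit (map ((!) s) js \<in> rel G) (Rel js). js \<leftarrow> List.n_lists k [0..<length s]]) (Eq 0 0)"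

text \<open>Here \<open>gs\<close> lists the universe of \<open>G\<close>, and the free variable \<open>i\<close> stands for the \<open>i\<close>-th move.
  The formulas \<open>uform\<close> and \<open>eform\<close> express \<open>simU k G M\<close> and \<open>simE k G M\<close> in \<open>M\<close>, and the dual ones
  \<open>dform\<close> and \<open>aform\<close> express \<open>simU k M G\<close> and \<open>simE k M G\<close>.\<close>

primrec uform :: "nat \<Rightarrow> 'a rel_struct \<Rightarrow> 'a list \<Rightarrow> nat \<Rightarrow> 'a list \<Rightarrow> fm" where
  "uform k G gs 0 s = diag k G s"
| "uform k G gs (Suc r) s = Forall (length s)
     (foldr Disj (map (\<lambda>a. uform k G gs r (s @ [a])) gs) (uform k G gs r (s @ [hd gs])))"

primrec eform :: "nat \<Rightarrow> 'a rel_struct \<Rightarrow> 'a list \<Rightarrow> nat \<Rightarrow> 'a list \<Rightarrow> fm" where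
  "eform k G gs 0 s = diag k G s"
| "eform k G gs (Suc r) s =
     foldr Conj (map (\<lambda>a. Exists (length s) (eform k G gs r (s @ [a]))) gs) (uform k G gs (Suc r) s)"

primrec dform :: "nat \<Rightarrow> 'a rel_struct \<Rightarrow> 'a list \<Rightarrow> nat \<Rightarrow> 'a list \<Rightarrow> fm" where
  "dform k G gs 0 s = diag k G s"
| "dform k G gs (Suc r) s =
     foldr Conj (map (\<lambda>a. Exists (length s) (dform k G gs r (s @ [a]))) gs)
       (Exists (length s) (dform k G gs r (s @ [hd gs])))"

primrec aform :: "nat \<Rightarrow> 'a rel_struct \<Rightarrow> 'a list \<Rightarrow> nat \<Rightarrow> 'a list \<Rightarrow> fm" where
  "aform k G gs 0 s = diag k G s"
| "aform k G gs (Suc r) s = Conj (dform k G gs (Suc r) s) (Forall (length s)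
     (foldr Disj (map (\<lambda>a. aform k G gs r (s @ [a])) gs) (aform k G gs r (s @ [hd gs]))))"

lemma sat_foldr_Conj: "sat M v (foldr Conj ps q) \<longleftrightarrow> sat M v q \<and> (\<forall>p\<in>set ps. sat M v p)"
  by (induction ps) auto

lemma sat_foldr_Disj: "sat M v (foldr Disj ps q) \<longleftrightarrow> sat M v q \<or> (\<exists>p\<in>set ps. sat M v p)"
  by (induction ps) auto

lemma wf_foldr_Conj: "wf_fm k (foldr Conj ps q) \<longleftrightarrow> wf_fm k q \<and> (\<forall>p\<in>set ps. wf_fm k p)"
  by (induction ps) auto

lemma wf_foldr_Disj: "wf_fm k (foldr Disj ps q) \<longleftrightarrow> wf_fm k q \<and> (\<forall>p\<in>set ps. wf_fm k p)"
  by (induction ps) auto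

lemma free_foldr_Conj: "free_vars (foldr Conj ps q) = free_vars q \<union> (\<Union>p\<in>set ps. free_vars p)"
  by (induction ps) auto

lemma free_foldr_Disj: "free_vars (foldr Disj ps q) = free_vars q \<union> (\<Union>p\<in>set ps. free_vars p)"
  by (induction ps) auto

lemma Nest_foldr_Conj: "Nest (foldr Conj ps q) = Nest q \<union> (\<Union>p\<in>set ps. Nest p)"
  by (induction ps) auto

lemma Nest_foldr_Disj: "Nest (foldr Disj ps q) = Nest q \<union> (\<Union>p\<in>set ps. Nest p)"
  by (induction ps) auto

lemma sat_lit: "sat M v (lit b p) \<longleftrightarrow> (sat M v p \<longleftrightarrow> b)"
  by (auto simp: lit_def)

lemma lit_simps [simp]: "wf_fm k (lit b p) = wf_fm k p" "free_vars (lit b p) = free_vars p"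
  by (auto simp: lit_def)

lemma sat_diag: "sat M v (diag k G s) \<longleftrightarrow> agree k G M s (map v [0..<length s])"
proof -
  have "map ((!) (map v [0..<length s])) js = map v js" if "set js \<subseteq> {..<length s}" for js
    using that by (auto simp: subset_iff)
  then have "agree k G M s (map v [0..<length s]) \<longleftrightarrow>
      (\<forall>i<length s. \<forall>j<length s. s ! i = s ! j \<longleftrightarrow> v i = v j) \<and>
      (\<forall>js. length js = k \<and> set js \<subseteq> {..<length s} \<longrightarrow>
        (map ((!) s) js \<in> rel G \<longleftrightarrow> map v js \<in> rel M))"
    by (auto simp: agree_def simp del: map_eq_conv)
  moreover have "sat M v (diag k G s) \<longleftrightarrow>
      (\<forall>i<length s. \<forall>j<length s. s ! i = s ! j \<longleftrightarrow> v i = v j) \<and>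
      (\<forall>js. length js = k \<and> set js \<subseteq> {..<length s} \<longrightarrow>
        (map ((!) s) js \<in> rel G \<longleftrightarrow> map v js \<in> rel M))"
    by (auto simp: diag_def sat_foldr_Conj sat_lit ball_Un set_n_lists lessThan_atLeast0)
  ultimately show ?thesis by blast
qed

lemma map_upd_snoc: "map (v(length s := b)) [0..<length (s @ [a])] = map v [0..<length s] @ [b]"
  by simp

lemma sat_uform:
  assumes "set gs = univ G" "gs \<noteq> []"
  shows "sat M v (uform k G gs r s) \<longleftrightarrow> simU k G M r s (map v [0..<length s])"
proof (induction r arbitrary: s v)
  case 0
  show ?case by (simp add: sat_diag)
next
  case (Suc r)
  have "sat M (v(length s := b)) (uform k G gs r (s @ [a])) \<longleftrightarrow>
      simU k G M r (s @ [a]) (map v [0..<length s] @ [b])" for a b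
    unfolding Suc.IH map_upd_snoc ..
  then show ?case
    using assms hd_in_set[of gs] by (auto simp: sat_foldr_Disj)
qed

lemma sat_dform:
  assumes "set gs = univ G" "gs \<noteq> []"
  shows "sat M v (dform k G gs r s) \<longleftrightarrow> simU k M G r (map v [0..<length s]) s"
proof (induction r arbitrary: s v)
  case 0
  show ?case by (simp add: sat_diag agree_sym[of k G])
next
  case (Suc r)
  have "sat M (v(length s := b)) (dform k G gs r (s @ [a])) \<longleftrightarrow>
      simU k M G r (map v [0..<length s] @ [b]) (s @ [a])" for a b
    unfolding Suc.IH map_upd_snoc ..
  then show ?case
    using assms hd_in_set[of gs] by (auto simp: sat_foldr_Conj)
qed

lemma sat_eform:
  assumes "set gs = univ G" "gs \<noteq> []"
  shows "sat M v (eform k G gs r s) \<longleftrightarrow> simE k G M r s (map v [0..<length s])"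
proof (induction r arbitrary: s v)
  case 0
  show ?case by (simp add: sat_diag)
next
  case (Suc r)
  have "sat M (v(length s := b)) (eform k G gs r (s @ [a])) \<longleftrightarrow>
      simE k G M r (s @ [a]) (map v [0..<length s] @ [b])" for a b
    unfolding Suc.IH map_upd_snoc ..
  then show ?case
    using assms by (simp add: sat_foldr_Conj sat_uform[OF assms] del: uform.simps simU.simps)
qed

lemma sat_aform:
  assumes "set gs = univ G" "gs \<noteq> []"
  shows "sat M v (aform k G gs r s) \<longleftrightarrow> simE k M G r (map v [0..<length s]) s"
proof (induction r arbitrary: s v)
  case 0
  show ?case by (simp add: sat_diag agree_sym[of k G])
next
  case (Suc r)
  have "sat M (v(length s := b)) (aform k G gs r (s @ [a])) \<longleftrightarrow>
      simE k M G r (map v [0..<length s] @ [b]) (s @ [a])" for a b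
    unfolding Suc.IH map_upd_snoc ..
  then show ?case
    using assms hd_in_set[of gs]
    by (auto simp add: sat_foldr_Disj sat_dform[OF assms] simp del: dform.simps simU.simps)
qed

lemma wf_forms:
  "wf_fm k (diag k G s)" "wf_fm k (uform k G gs r s)" "wf_fm k (dform k G gs r s)"
  "wf_fm k (eform k G gs r s)" "wf_fm k (aform k G gs r s)"
proof -
  show d: "wf_fm k (diag k G s)" for s
    by (auto simp: diag_def wf_foldr_Conj set_n_lists)
  show u: "wf_fm k (uform k G gs r s)" for r s
    by (induction r arbitrary: s) (auto simp: wf_foldr_Disj d)
  show e: "wf_fm k (dform k G gs r s)" for r s
    by (induction r arbitrary: s) (auto simp: wf_foldr_Conj d)
  show "wf_fm k (eform k G gs r s)"
    by (induction r arbitrary: s) (auto simp: wf_foldr_Conj d u simp del: uform.simps)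
  show "wf_fm k (aform k G gs r s)"
    by (induction r arbitrary: s) (auto simp: wf_foldr_Disj d e simp del: dform.simps)
qed

text \<open>The fold in \<open>diag\<close> starts from the true formula \<open>Eq 0 0\<close>,
  which mentions variable 0. Hence the nonempty position here and the condition
  \<open>r > 0 \<or> s \<noteq> []\<close> in the lemmas below, where an outer quantifier binds that
  variable.\<close>

lemma free_diag: "s \<noteq> [] \<Longrightarrow> free_vars (diag k G s) \<subseteq> {..<length s}"
  by (auto simp: diag_def free_foldr_Conj set_n_lists)

lemma diff_lessThan_Suc: "A \<subseteq> {..<Suc n} \<Longrightarrow> A - {n} \<subseteq> {..<n}"
  by auto

lemma free_uform: "r > 0 \<or> s \<noteq> [] \<Longrightarrow> free_vars (uform k G gs r s) \<subseteq> {..<length s}"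
proof (induction r arbitrary: s)
  case (Suc r)
  have "free_vars (uform k G gs r (s @ [a])) \<subseteq> {..<Suc (length s)}" for a
    using Suc.IH[of "s @ [a]"] by simp
  then show ?case
    unfolding uform.simps free_vars.simps free_foldr_Disj by (intro diff_lessThan_Suc) auto
qed (use free_diag in auto)

lemma free_dform: "r > 0 \<or> s \<noteq> [] \<Longrightarrow> free_vars (dform k G gs r s) \<subseteq> {..<length s}"
proof (induction r arbitrary: s)
  case (Suc r)
  have "free_vars (Exists (length s) (dform k G gs r (s @ [a]))) \<subseteq> {..<length s}" for a
    unfolding free_vars.simps using Suc.IH[of "s @ [a]"] by (intro diff_lessThan_Suc) simp
  then show ?case
    unfolding dform.simps free_foldr_Conj by auto
qed (use free_diag in auto)

lemma free_eform: "r > 0 \<or> s \<noteq> [] \<Longrightarrow> free_vars (eform k G gs r s) \<subseteq> {..<length s}"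
proof (induction r arbitrary: s)
  case (Suc r)
  have "free_vars (Exists (length s) (eform k G gs r (s @ [a]))) \<subseteq> {..<length s}" for a
    unfolding free_vars.simps using Suc.IH[of "s @ [a]"] by (intro diff_lessThan_Suc) simp
  moreover have "free_vars (uform k G gs (Suc r) s) \<subseteq> {..<length s}"
    by (rule free_uform) simp
  ultimately show ?case
    unfolding eform.simps free_foldr_Conj by auto
qed (use free_diag in auto)

lemma free_aform: "r > 0 \<or> s \<noteq> [] \<Longrightarrow> free_vars (aform k G gs r s) \<subseteq> {..<length s}"
proof (induction r arbitrary: s)
  case (Suc r)
  have "free_vars (aform k G gs r (s @ [a])) \<subseteq> {..<Suc (length s)}" for a
    using Suc.IH[of "s @ [a]"] by simp
  then have "free_vars (Forall (length s) (foldr Disj (map (\<lambda>a. aform k G gs r (s @ [a])) gs)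
      (aform k G gs r (s @ [hd gs])))) \<subseteq> {..<length s}"
    unfolding free_vars.simps free_foldr_Disj by (intro diff_lessThan_Suc) auto
  moreover have "free_vars (dform k G gs (Suc r) s) \<subseteq> {..<length s}"
    by (rule free_dform) simp
  ultimately show ?case
    unfolding aform.simps free_vars.simps(4) by (rule Un_least[rotated])
qed (use free_diag in auto)

lemma Nest_lit: "Nest (lit b p) = (if b then Nest p else map dual ` Nest p)"
  by (simp add: lit_def)

lemma Nest_diag: "Nest (diag k G s) = {[]}"
  by (auto simp: diag_def Nest_foldr_Conj Nest_lit split: if_splits)

text \<open>The fold starts from a repeated disjunct, the one for \<open>hd gs\<close>, instead of
  an atomic formula. So no shorter word enters and all words have length exactly
  \<open>r\<close>.\<close>

lemma Nest_uform: "Nest (uform k G gs r s) = {replicate r QAll}"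
  by (induction r arbitrary: s) (auto simp: Nest_diag Nest_foldr_Disj)

lemma Nest_dform: "Nest (dform k G gs r s) = {replicate r QEx}"
  by (induction r arbitrary: s) (auto simp: Nest_diag Nest_foldr_Conj)

lemma blocks_Cons:
  "A \<subseteq> {replicate i a @ replicate j b | i j. i + j = r} \<Longrightarrow>
   Cons a ` A \<subseteq> {replicate i a @ replicate j b | i j. i + j = Suc r}"
proof
  fix w
  assume "A \<subseteq> {replicate i a @ replicate j b | i j. i + j = r}" "w \<in> Cons a ` A"
  then obtain i j where "i + j = r" "w = a # replicate i a @ replicate j b" by blast
  then show "w \<in> {replicate i a @ replicate j b | i j. i + j = Suc r}"
    by (intro CollectI exI[of _ "Suc i"] exI[of _ j]) simp
qed

lemma blocks_replicate: "replicate r b \<in> {replicate i a @ replicate j b | i j. i + j = r}"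
  by (intro CollectI exI[of _ 0] exI[of _ r]) simp

text \<open>Moves before the switch contribute \<open>QEx\<close> and moves after it
  \<open>QAll\<close>; the summand \<open>uform\<close> is the switch.\<close>

lemma Nest_eform: "Nest (eform k G gs r s) \<subseteq> {replicate i QEx @ replicate j QAll | i j. i + j = r}"
proof (induction r arbitrary: s)
  case (Suc r)
  have "Nest (Exists (length s) (eform k G gs r (s @ [a]))) \<subseteq>
      {replicate i QEx @ replicate j QAll | i j. i + j = Suc r}" for a
    unfolding Nest.simps by (rule blocks_Cons[OF Suc.IH])
  moreover have "Nest (uform k G gs (Suc r) s) \<subseteq>
      {replicate i QEx @ replicate j QAll | i j. i + j = Suc r}"
    unfolding Nest_uform by (rule insert_subsetI[OF blocks_replicate empty_subsetI])
  ultimately show ?case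
    unfolding eform.simps Nest_foldr_Conj set_map image_image UN_simps
    by (intro Un_least UN_least)
qed (simp add: Nest_diag)

lemma Nest_aform: "Nest (aform k G gs r s) \<subseteq> {replicate i QAll @ replicate j QEx | i j. i + j = r}"
proof (induction r arbitrary: s)
  case (Suc r)
  have "Nest (foldr Disj (map (\<lambda>a. aform k G gs r (s @ [a])) gs) (aform k G gs r (s @ [hd gs]))) \<subseteq>
      {replicate i QAll @ replicate j QEx | i j. i + j = r}"
    unfolding Nest_foldr_Disj set_map using Suc.IH by (intro Un_least UN_least) auto
  from blocks_Cons[OF this] have "Nest (Forall (length s) (foldr Disj (map (\<lambda>a. aform k G gs r (s @ [a])) gs)
      (aform k G gs r (s @ [hd gs])))) \<subseteq> {replicate i QAll @ replicate j QEx | i j. i + j = Suc r}"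
    unfolding Nest.simps .
  moreover have "Nest (dform k G gs (Suc r) s) \<subseteq>
      {replicate i QAll @ replicate j QEx | i j. i + j = Suc r}"
    unfolding Nest_dform by (rule insert_subsetI[OF blocks_replicate empty_subsetI])
  ultimately show ?case
    unfolding aform.simps Nest.simps(4) by (rule Un_least[rotated])
qed (simp add: Nest_diag)

lemma alternations_blocks: "alternations (replicate i a @ replicate j b) \<le> 1"
proof -
  have "{h. Suc h < length (replicate i a @ replicate j b) \<and>
      (replicate i a @ replicate j b) ! h \<noteq> (replicate i a @ replicate j b) ! Suc h} \<subseteq> {i - 1}"
    by (auto simp: nth_append split: if_splits)
  from card_mono[OF _ this] show ?thesis by (simp add: alternations_def)
qed

text \<open>Both starting sides are included, because Spoiler will have to open in whichever
  structure has the larger last class. The conjunction costs no alternation: one conjunct has words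
  of the form exists-forall, the other of the form forall-exists.\<close>

theorem game_formula:
  assumes fin: "finite (univ G)" "univ G \<noteq> {}" and r: "r > 0"
  obtains p where "wf_fm k p" "free_vars p = {}" "alternation_number p \<le> 1" "quantifier_rank p = r"
    "true_on G p"
    "\<And>N :: nat rel_struct. univ N \<noteq> {} \<Longrightarrow> true_on N p \<Longrightarrow> simE k G N r [] [] \<and> simE k N G r [] []"
proof -
  obtain gs where gs: "set gs = univ G" "gs \<noteq> []"
    using fin finite_list by (metis set_empty)
  define p where "p = Conj (eform k G gs r []) (aform k G gs r [])"
  have free: "free_vars p = {}"
    using free_eform[of r "[]" k G gs] free_aform[of r "[]" k G gs] r by (simp add: p_def)
  have words: "length w = r \<and> alternations w \<le> 1" if "w \<in> Nest p" for w
  proof -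
    have "w \<in> Nest (eform k G gs r []) \<or> w \<in> Nest (aform k G gs r [])"
      using that by (simp add: p_def)
    then obtain i j a b where "w = replicate i a @ replicate j b" "i + j = r"
      using Nest_eform[of k G gs r "[]"] Nest_aform[of k G gs r "[]"] by blast
    then show ?thesis using alternations_blocks by simp
  qed
  have sat: "sat N v p \<longleftrightarrow> simE k G N r [] [] \<and> simE k N G r [] []" for N :: "nat rel_struct" and v
    by (simp add: p_def sat_eform[OF gs] sat_aform[OF gs])
  show thesis
  proof (rule that)
    show "wf_fm k p" by (simp add: p_def wf_forms)
    show "free_vars p = {}" by (fact free)
    show "alternation_number p \<le> 1"
      unfolding alternation_number_def using words finite_Nest[of p] Nest_nonempty[of p]
      by (intro Max.boundedI) auto
    have "length ` Nest p = {r}" using words Nest_nonempty[of p] by blast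
    then show "quantifier_rank p = r" by (simp add: quantifier_rank_def)
    show "true_on G p" by (simp add: true_on_def p_def sat_eform[OF gs] sat_aform[OF gs] simE_refl)
    fix N :: "nat rel_struct"
    assume "univ N \<noteq> {}" and t: "true_on N p"
    then obtain b where "b \<in> univ N" by blast
    then have "sat N (\<lambda>_. b) p" using t by (auto simp: true_on_def)
    then show "simE k G N r [] [] \<and> simE k N G r [] []"
      by (simp add: p_def sat_eform[OF gs] sat_aform[OF gs])
  qed
qed

section \<open>Similar vertices\<close>

text \<open>Similarity as an exchange property, free of \<open>V\<close> and of the transposition;
  \<open>similar_iff_twins\<close> shows that it is the same relation on \<open>V\<close>.\<close>

definition twins :: "'a set set \<Rightarrow> 'a \<Rightarrow> 'a \<Rightarrow> bool" where
  "twins E u v \<longleftrightarrow> (\<forall>T. u \<notin> T \<and> v \<notin> T \<longrightarrow> (insert u T \<in> E \<longleftrightarrow> insert v T \<in> E))"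

lemma twins_refl [simp]: "twins E u u"
  by (simp add: twins_def)

lemma twins_sym: "twins E u v \<longleftrightarrow> twins E v u"
  by (auto simp: twins_def)

text \<open>The only delicate case has the middle vertex \<open>v\<close> in \<open>T\<close>. Then
  \<open>u\<close> is not exchanged for \<open>w\<close> directly: in \<open>insert u T\<close>
  first \<open>v\<close> becomes \<open>w\<close>, and then \<open>u\<close> becomes
  \<open>v\<close>.\<close>

lemma twins_trans:
  assumes uv: "twins E u v" and vw: "twins E v w"
  shows "twins E u w"
  unfolding twins_def
proof (intro allI impI)
  fix T assume T: "u \<notin> T \<and> w \<notin> T"
  show "insert u T \<in> E \<longleftrightarrow> insert w T \<in> E"
  proof (cases "v \<in> T \<and> u \<noteq> w")
    case True
    define T0 where "T0 = T - {v}"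
    have T0: "T = insert v T0" "v \<notin> T0" "u \<notin> T0" "w \<notin> T0" "u \<noteq> v" "w \<noteq> v"
      using True T by (auto simp: T0_def)
    have e: "insert u T = insert v (insert u T0)" "insert w T = insert v (insert w T0)"
      "insert w (insert u T0) = insert u (insert w T0)"
      using T0(1) by blast+
    have "insert v (insert u T0) \<in> E \<longleftrightarrow> insert w (insert u T0) \<in> E"
      by (rule vw[unfolded twins_def, rule_format]) (use T0 True in simp)
    moreover have "insert u (insert w T0) \<in> E \<longleftrightarrow> insert v (insert w T0) \<in> E"
      by (rule uv[unfolded twins_def, rule_format]) (use T0 True in simp)
    ultimately show ?thesis unfolding e by (rule trans)
  next
    case False
    show ?thesis
    proof (cases "u = w")
      case False
      then have "v \<notin> T" using \<open>\<not> (v \<in> T \<and> u \<noteq> w)\<close> by simp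
      then show ?thesis using uv vw T unfolding twins_def by simp
    qed simp
  qed
qed

lemma kgraph_edge: "kgraph k V E \<Longrightarrow> e \<in> E \<Longrightarrow> e \<subseteq> V \<and> card e = k \<and> finite e"
  unfolding kgraph_def using finite_subset by blast

lemma similar_iff_twins:
  assumes g: "kgraph k V E" and u: "u \<in> V" and v: "v \<in> V"
  shows "similar V E u v \<longleftrightarrow> twins E u v"
proof -
  let ?t = "Transposition.transpose u v"
  have bij: "bij_betw ?t V V"
    using u v by (intro bij_betw_byWitness[where f' = ?t]) (auto simp: Transposition.transpose_def)
  have fixd: "?t ` e = e" if "u \<in> e \<longleftrightarrow> v \<in> e" for e
    using that by (auto simp: Transposition.transpose_def image_iff)
  have swap: "?t ` insert u T = insert v T" "?t ` insert v T = insert u T" if "u \<notin> T" "v \<notin> T" for T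
    using that by (auto simp: Transposition.transpose_def image_iff)
  have "(\<forall>e. e \<subseteq> V \<longrightarrow> (e \<in> E \<longleftrightarrow> ?t ` e \<in> E)) \<longleftrightarrow> twins E u v"
  proof
    assume l: "\<forall>e. e \<subseteq> V \<longrightarrow> (e \<in> E \<longleftrightarrow> ?t ` e \<in> E)"
    show "twins E u v" unfolding twins_def
    proof (intro allI impI)
      fix T assume T: "u \<notin> T \<and> v \<notin> T"
      show "insert u T \<in> E \<longleftrightarrow> insert v T \<in> E"
      proof (cases "T \<subseteq> V")
        case True
        then show ?thesis using l[rule_format, of "insert u T"] swap T u by auto
      next
        case False
        then show ?thesis using kgraph_edge[OF g] by blast
      qed
    qed
  next
    assume r: "twins E u v"
    show "\<forall>e. e \<subseteq> V \<longrightarrow> (e \<in> E \<longleftrightarrow> ?t ` e \<in> E)"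
    proof (intro allI impI)
      fix e assume "e \<subseteq> V"
      consider "u \<in> e \<longleftrightarrow> v \<in> e" | "u \<in> e" "v \<notin> e" | "u \<notin> e" "v \<in> e" by blast
      then show "e \<in> E \<longleftrightarrow> ?t ` e \<in> E"
      proof cases
        case 1
        then show ?thesis using fixd by simp
      next
        case 2
        then have "e = insert u (e - {u})" "u \<notin> e - {u}" "v \<notin> e - {u}" by auto
        then show ?thesis using r swap unfolding twins_def by metis
      next
        case 3
        then have "e = insert v (e - {v})" "u \<notin> e - {v}" "v \<notin> e - {v}" by auto
        then show ?thesis using r swap unfolding twins_def by metis
      qed
    qed
  qed
  then show ?thesis using u v bij by (simp add: similar_def automorphism_def)
qed

text \<open>Vertices are exchanged one at a time. Unless \<open>\<beta>\<close> permutes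
  \<open>e\<close>, some \<open>a\<close> has its image outside \<open>e\<close>; it can be
  exchanged first without collision, and its image is then parked in \<open>B\<close>.\<close>

lemma twins_image:
  assumes "finite e" "inj_on \<beta> e" "\<And>a. a \<in> e \<Longrightarrow> twins E a (\<beta> a)"
    and "B \<inter> e = {}" "B \<inter> \<beta> ` e = {}"
  shows "B \<union> e \<in> E \<longleftrightarrow> B \<union> \<beta> ` e \<in> E"
  using assms
proof (induction "card e" arbitrary: e B)
  case 0
  then show ?case by simp
next
  case (Suc m)
  show ?case
  proof (cases "\<beta> ` e \<subseteq> e")
    case True
    then have "\<beta> ` e = e" by (rule card_subset_eq[OF Suc.prems(1) _ card_image[OF Suc.prems(2)]])
    then show ?thesis by simp
  next
    case False
    then obtain a where a: "a \<in> e" "\<beta> a \<notin> e" by auto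
    define B1 where "B1 = insert (\<beta> a) B"
    define e1 where "e1 = e - {a}"
    have nb: "\<beta> a \<notin> \<beta> ` e1" using Suc.prems(2) a by (auto simp: e1_def inj_on_def)
    have IH: "B1 \<union> e1 \<in> E \<longleftrightarrow> B1 \<union> \<beta> ` e1 \<in> E"
    proof (rule Suc.hyps(1))
      show "m = card e1" using Suc.hyps(2) Suc.prems(1) a(1) by (simp add: e1_def)
      show "finite e1" "inj_on \<beta> e1" using Suc.prems(1,2) by (auto simp: e1_def inj_on_diff)
      show "\<And>a. a \<in> e1 \<Longrightarrow> twins E a (\<beta> a)" using Suc.prems(3) by (simp add: e1_def)
      show "B1 \<inter> e1 = {}" "B1 \<inter> \<beta> ` e1 = {}"
        using Suc.prems(4,5) a nb by (auto simp: e1_def B1_def)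
    qed
    have "a \<notin> B \<union> e1" "\<beta> a \<notin> B \<union> e1"
      using Suc.prems(4,5) a by (auto simp: e1_def)
    then have "insert a (B \<union> e1) \<in> E \<longleftrightarrow> insert (\<beta> a) (B \<union> e1) \<in> E"
      using Suc.prems(3)[OF a(1)] unfolding twins_def by simp
    moreover have "insert a (B \<union> e1) = B \<union> e" "insert (\<beta> a) (B \<union> e1) = B1 \<union> e1"
      "B1 \<union> \<beta> ` e1 = B \<union> \<beta> ` e" using a(1) by (auto simp: e1_def B1_def)
    ultimately show ?thesis using IH by simp
  qed
qed

lemma twins_exchange:
  assumes C: "\<And>u v. u \<in> C \<Longrightarrow> v \<in> C \<Longrightarrow> twins E u v" and "finite C"
    and "A \<inter> C = {}" "B \<subseteq> C" "B' \<subseteq> C" "card B = card B'"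
  shows "A \<union> B \<in> E \<longleftrightarrow> A \<union> B' \<in> E"
proof -
  have "finite B" "finite B'" using assms(2,4,5) finite_subset by blast+
  then obtain \<beta> where b: "bij_betw \<beta> B B'" using assms finite_same_card_bij by blast
  then have "A \<union> B \<in> E \<longleftrightarrow> A \<union> \<beta> ` B \<in> E"
    using assms(3-5) \<open>finite B\<close>
    by (intro twins_image C) (auto simp: bij_betw_def)
  then show ?thesis using b by (simp add: bij_betw_def)
qed

section \<open>Bases\<close>

text \<open>Once \<open>X\<close> has been played, Spoiler can tell \<open>u\<close> from \<open>v\<close> in \<open>i\<close> further moves by playing \<open>T - X\<close>,
  with \<open>l a\<close> rounds left after \<open>a\<close>: a reply that does not permute \<open>T - X\<close> can, recursively, be told
  apart within these rounds, and one that does is exposed by the mismatch of \<open>u\<close> and \<open>v\<close> at \<open>T\<close>.\<close>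

inductive sep :: "'a set \<Rightarrow> 'a set set \<Rightarrow> nat \<Rightarrow> 'a set \<Rightarrow> nat \<Rightarrow> 'a \<Rightarrow> 'a \<Rightarrow> bool"
  for V E k X where
  sepI: "\<lbrakk>u \<in> V - X; v \<in> V - X; T \<subseteq> V; card T = k - 1; u \<notin> T; v \<notin> T;
    (insert u T \<in> E) \<noteq> (insert v T \<in> E); inj_on l (T - X); l ` (T - X) \<subseteq> {..<i};
    \<And>\<beta>. inj_on \<beta> (T - X) \<Longrightarrow> \<beta> ` (T - X) \<subseteq> V - X \<Longrightarrow>
      \<beta> ` (T - X) = T - X \<or> (\<exists>a\<in>T - X. sep V E k X (l a) (\<beta> a) a)\<rbrakk>
    \<Longrightarrow> sep V E k X i u v"

lemma sepE:
  assumes "sep V E k X i u v"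
  obtains T l where "u \<in> V - X" "v \<in> V - X" "T \<subseteq> V" "card T = k - 1" "u \<notin> T" "v \<notin> T"
    "(insert u T \<in> E) \<noteq> (insert v T \<in> E)" "inj_on l (T - X)" "l ` (T - X) \<subseteq> {..<i}"
    "\<And>\<beta>. inj_on \<beta> (T - X) \<Longrightarrow> \<beta> ` (T - X) \<subseteq> V - X \<Longrightarrow>
      \<beta> ` (T - X) = T - X \<or> (\<exists>a\<in>T - X. sep V E k X (l a) (\<beta> a) a)"
  using assms by (rule sep.cases) (hypsubst, rule that, assumption+)

lemma sep_irrefl: "\<not> sep V E k X i u u"
  by (auto elim: sep.cases)

lemma sep_not_twins: "sep V E k X i u v \<Longrightarrow> \<not> twins E u v"
  by (auto elim!: sep.cases simp: twins_def)

lemma sep_sym: "sep V E k X i u v \<Longrightarrow> sep V E k X i v u"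
  by (erule sep.cases) (rule sepI; (assumption | blast))

lemma sep_mono: "sep V E k X i u v \<Longrightarrow> i \<le> j \<Longrightarrow> sep V E k X j u v"
  by (erule sep.cases) (rule sepI; (assumption | force))

text \<open>A reply on \<open>T - Y\<close> extends to \<open>T - X\<close> by the identity on the
  part of \<open>T\<close> in \<open>Y\<close>. No vertex is separated from itself, so the old
  alternative for the extended reply yields the new one.\<close>

lemma sep_superset:
  assumes "sep V E k X i u v" "X \<subseteq> Y" "u \<notin> Y" "v \<notin> Y"
  shows "sep V E k Y i u v"
  using assms
proof (induction rule: sep.induct)
  case (sepI u v T l i)
  show ?case
  proof (rule sep.sepI[where T = T and l = l])
    show "inj_on l (T - Y)" "l ` (T - Y) \<subseteq> {..<i}"
      using sepI.hyps(8,9) sepI.prems(1) unfolding inj_on_def by blast+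
    fix \<beta> assume b: "inj_on \<beta> (T - Y)" "\<beta> ` (T - Y) \<subseteq> V - Y"
    define \<gamma> where "\<gamma> a = (if a \<in> Y then a else \<beta> a)" for a
    have "inj_on \<gamma> (T - X)" using b by (auto simp: inj_on_def \<gamma>_def)
    moreover have "\<gamma> ` (T - X) \<subseteq> V - X"
      using b sepI.hyps(3) sepI.prems(1) by (auto simp: \<gamma>_def)
    ultimately have "\<gamma> ` (T - X) = T - X \<or> (\<exists>a\<in>T - X. sep V E k X (l a) (\<gamma> a) a \<and>
        (X \<subseteq> Y \<longrightarrow> \<gamma> a \<notin> Y \<longrightarrow> a \<notin> Y \<longrightarrow> sep V E k Y (l a) (\<gamma> a) a))"
      by (rule sepI.IH)
    then show "\<beta> ` (T - Y) = T - Y \<or> (\<exists>a\<in>T - Y. sep V E k Y (l a) (\<beta> a) a)"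
    proof (elim disjE bexE conjE)
      assume g: "\<gamma> ` (T - X) = T - X"
      have "\<beta> ` (T - Y) \<subseteq> T - Y"
      proof
        fix b assume "b \<in> \<beta> ` (T - Y)"
        then obtain a where a: "a \<in> T" "a \<notin> Y" "b = \<beta> a" by blast
        then have "\<gamma> a \<in> T - X" using g sepI.prems(1) by blast
        then show "b \<in> T - Y" using a b(2) by (auto simp: \<gamma>_def)
      qed
      moreover have "T - Y \<subseteq> \<beta> ` (T - Y)"
      proof
        fix b assume bT: "b \<in> T - Y"
        then obtain a where a: "a \<in> T - X" "b = \<gamma> a" using g sepI.prems(1) by blast
        then have "a \<notin> Y" using bT by (auto simp: \<gamma>_def)
        then show "b \<in> \<beta> ` (T - Y)" using a by (simp add: \<gamma>_def)
      qed
      ultimately show ?thesis by blast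
    next
      fix a assume a: "a \<in> T - X" "sep V E k X (l a) (\<gamma> a) a"
        "X \<subseteq> Y \<longrightarrow> \<gamma> a \<notin> Y \<longrightarrow> a \<notin> Y \<longrightarrow> sep V E k Y (l a) (\<gamma> a) a"
      have aY: "a \<notin> Y"
      proof
        assume "a \<in> Y"
        then have "sep V E k X (l a) a a" using a(2) by (simp add: \<gamma>_def)
        then show False using sep_irrefl by metis
      qed
      moreover have "\<beta> a \<notin> Y" using a(1) aY b(2) by blast
      ultimately have "sep V E k Y (l a) (\<beta> a) a" using a(3) sepI.prems(1) by (simp add: \<gamma>_def)
      then show ?thesis using a(1) aY by blast
    qed
  qed (use sepI in auto)
qed

text \<open>This is the contrapositive of transitivity for inseparability and makes
  \<open>eqv\<close> an equivalence relation. If \<open>v\<close> is outside \<open>T\<close>, the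
  same \<open>T\<close> and \<open>l\<close> separate \<open>v\<close> from \<open>u\<close> or from
  \<open>w\<close>.\<close>

lemma sep_trans:
  assumes uw: "sep V E k X i u w" and v: "v \<in> V - X"
  shows "sep V E k X i u v \<or> sep V E k X i v w"
proof -
  from uw obtain T l where sepI: "u \<in> V - X" "w \<in> V - X" "T \<subseteq> V" "card T = k - 1" "u \<notin> T"
    "w \<notin> T" "(insert u T \<in> E) \<noteq> (insert w T \<in> E)" "inj_on l (T - X)" "l ` (T - X) \<subseteq> {..<i}"
    "\<And>\<beta>. inj_on \<beta> (T - X) \<Longrightarrow> \<beta> ` (T - X) \<subseteq> V - X \<Longrightarrow>
      \<beta> ` (T - X) = T - X \<or> (\<exists>a\<in>T - X. sep V E k X (l a) (\<beta> a) a)"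
    by (rule sepE) (rule that, assumption+)
  show ?thesis
  proof (cases "v \<in> T")
    case vT: False
    have neq: "(insert u T \<in> E) \<noteq> (insert w T \<in> E)" by (fact sepI(7))
    show ?thesis
    proof (cases "(insert u T \<in> E) = (insert v T \<in> E)")
      case False
      then have "sep V E k X i u v"
        using sepI(1,3-5,8,9) v vT
        by - (rule sep.sepI[where T = T and l = l], assumption+, rule sepI(10))
      then show ?thesis ..
    next
      case True
      then have "(insert v T \<in> E) \<noteq> (insert w T \<in> E)" using neq by simp
      then have "sep V E k X i v w"
        using sepI(2-4,6,8,9) v vT
        by - (rule sep.sepI[where T = T and l = l], assumption+, rule sepI(10))
      then show ?thesis ..
    qed
  next
    case True
    \<comment> \<open>This reply moves only \<open>v\<close>, to \<open>w\<close> outside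
      \<open>T\<close>, so it does not preserve \<open>T - X\<close>. As all other vertices are
      fixed, the vertex that must be separated from its reply is \<open>v\<close>, and this happens
      at the level \<open>l v < i\<close>.\<close>
    define \<beta> where "\<beta> = id(v := w)"
    have inj: "inj_on \<beta> (T - X)" and im: "\<beta> ` (T - X) \<subseteq> V - X"
      using sepI(2,3,6) by (auto simp: \<beta>_def inj_on_def)
    have "w \<in> \<beta> ` (T - X)" using True v by (auto simp: \<beta>_def)
    then have "\<beta> ` (T - X) \<noteq> T - X" using sepI(6) by blast
    then obtain a where a: "a \<in> T - X" "sep V E k X (l a) (\<beta> a) a"
      using sepI(10)[OF inj im] by blast
    have "a = v"
    proof (rule ccontr)
      assume "a \<noteq> v"
      then have "sep V E k X (l a) a a" using a(2) by (simp add: \<beta>_def)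
      then show False using sep_irrefl by metis
    qed
    then have "sep V E k X (l v) w v" "l v < i" using a sepI(9) by (auto simp: \<beta>_def)
    then have "sep V E k X i v w" by (blast intro: sep_sym sep_mono less_imp_le)
    then show ?thesis ..
  qed
qed

section \<open>Classes of inseparable vertices and their refinement\<close>

definition eqv :: "'a set \<Rightarrow> 'a set set \<Rightarrow> nat \<Rightarrow> 'a set \<Rightarrow> nat \<Rightarrow> ('a \<times> 'a) set" where
  "eqv V E k X i = {(u, v). u \<in> V - X \<and> v \<in> V - X \<and> \<not> sep V E k X i u v}"

abbreviation cls :: "'a set \<Rightarrow> 'a set set \<Rightarrow> nat \<Rightarrow> 'a set \<Rightarrow> nat \<Rightarrow> 'a set set" where
  "cls V E k X i \<equiv> (V - X) // eqv V E k X i"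

lemma equiv_eqv: "equiv (V - X) (eqv V E k X i)"
proof (rule equivI)
  show "eqv V E k X i \<subseteq> (V - X) \<times> (V - X)" by (auto simp: eqv_def)
  show "refl_on (V - X) (eqv V E k X i)" by (auto simp: eqv_def refl_on_def sep_irrefl)
  show "sym (eqv V E k X i)" using sep_sym by (fastforce simp: eqv_def sym_def)
  show "trans (eqv V E k X i)" using sep_trans by (fastforce simp: eqv_def trans_def)
qed

lemma eqvD: "(u, v) \<in> eqv V E k X i \<Longrightarrow> u \<in> V - X \<and> v \<in> V - X \<and> \<not> sep V E k X i u v"
  by (auto simp: eqv_def)

lemma eqv_refine:
  assumes "X \<subseteq> Y" "i \<le> j" "(u, v) \<in> eqv V E k Y j"
  shows "(u, v) \<in> eqv V E k X i"
  using assms sep_mono[OF sep_superset[OF _ assms(1)] assms(2)] unfolding eqv_def by blast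

lemma finite_cls: "finite V \<Longrightarrow> finite (cls V E k X i)"
  by (rule finite_quotient) (auto simp: eqv_def)

lemma eqv_refl: "u \<in> V - X \<Longrightarrow> (u, u) \<in> eqv V E k X i"
  by (simp add: eqv_def sep_irrefl)

lemma eqv_trans:
  "(u, v) \<in> eqv V E k X i \<Longrightarrow> (v, w) \<in> eqv V E k X i \<Longrightarrow> (u, w) \<in> eqv V E k X i"
  using equivE[OF equiv_eqv[of V X E k i]] by (meson transD)

lemma class_refine:
  assumes "X \<subseteq> Y" "i \<le> j" "u \<in> V - Y"
  shows "eqv V E k X i `` (eqv V E k Y j `` {u}) = eqv V E k X i `` {u}"
proof (intro equalityI subsetI)
  fix w assume "w \<in> eqv V E k X i `` (eqv V E k Y j `` {u})"
  then obtain v where v: "(u, v) \<in> eqv V E k Y j" "(v, w) \<in> eqv V E k X i" by auto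
  then show "w \<in> eqv V E k X i `` {u}"
    using eqv_trans[OF eqv_refine[OF assms(1,2) v(1)] v(2)] by simp
next
  fix w assume "w \<in> eqv V E k X i `` {u}"
  then show "w \<in> eqv V E k X i `` (eqv V E k Y j `` {u})"
    using eqv_refl[OF assms(3)] by blast
qed

lemma cls_eq:
  assumes "C \<in> cls V E k X i" "u \<in> C"
  shows "C = eqv V E k X i `` {u}" "u \<in> V - X"
proof -
  obtain w where w: "w \<in> V - X" "C = eqv V E k X i `` {w}"
    using assms(1) by (rule quotientE)
  then have wu: "(w, u) \<in> eqv V E k X i" using assms(2) by simp
  show "C = eqv V E k X i `` {u}" unfolding w(2) by (rule equiv_class_eq[OF equiv_eqv wu])
  show "u \<in> V - X" using eqvD[OF wu] by simp
qed

text \<open>Sending a fine class to the coarse class around it is onto because each coarse class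
  keeps a vertex outside \<open>Y\<close>. Growing the base may therefore swallow vertices but never
  a whole class.\<close>

lemma refine_image:
  assumes "X \<subseteq> Y" "i \<le> j" and hit: "\<And>C. C \<in> cls V E k X i \<Longrightarrow> \<not> C \<subseteq> Y"
  shows "(\<lambda>D. eqv V E k X i `` D) ` cls V E k Y j = cls V E k X i"
proof (rule set_eqI, rule iffI)
  fix C assume "C \<in> (\<lambda>D. eqv V E k X i `` D) ` cls V E k Y j"
  then obtain D where D: "C = eqv V E k X i `` D" "D \<in> cls V E k Y j" by (rule imageE)
  from this(2) obtain u where u: "u \<in> V - Y" "D = eqv V E k Y j `` {u}"
    by (rule quotientE)
  then have "C = eqv V E k X i `` {u}" "u \<in> V - X"
    using D(1) class_refine[OF assms(1,2) u(1)] assms(1) by auto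
  then show "C \<in> cls V E k X i" by (simp add: quotientI)
next
  fix C assume C: "C \<in> cls V E k X i"
  then obtain u where u: "u \<in> C" "u \<notin> Y" using hit by (meson subsetI)
  then have V: "u \<in> V - Y" using cls_eq(2)[OF C u(1)] by simp
  have "C = eqv V E k X i `` (eqv V E k Y j `` {u})"
    unfolding class_refine[OF assms(1,2) V] by (rule cls_eq(1)[OF C u(1)])
  then show "C \<in> (\<lambda>D. eqv V E k X i `` D) ` cls V E k Y j"
    by (rule image_eqI) (rule quotientI[OF V])
qed

lemma card_cls_le:
  assumes "finite V" "X \<subseteq> Y" "i \<le> j" "\<And>C. C \<in> cls V E k X i \<Longrightarrow> \<not> C \<subseteq> Y"
  shows "card (cls V E k X i) \<le> card (cls V E k Y j)"
  using refine_image[OF assms(2-4)] card_image_le[OF finite_cls[OF assms(1)]] by metis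

text \<open>With equal counts the surjection of \<open>refine_image\<close> would be injective, but
  the distinct fine classes of \<open>u\<close> and \<open>v\<close> have the same image.\<close>

lemma card_cls_less:
  assumes "finite V" "X \<subseteq> Y" "\<And>C. C \<in> cls V E k X i \<Longrightarrow> \<not> C \<subseteq> Y"
    and uv: "u \<in> V - Y" "v \<in> V - Y" "\<not> sep V E k X i u v" "sep V E k Y i u v"
  shows "card (cls V E k X i) < card (cls V E k Y i)"
proof (rule ccontr)
  let ?h = "\<lambda>D. eqv V E k X i `` D"
  assume "\<not> ?thesis"
  then have "card (?h ` cls V E k Y i) = card (cls V E k Y i)"
    using card_cls_le[of V X Y i i E k, OF assms(1,2) order_refl assms(3)]
      refine_image[of X Y i i V E k, OF assms(2) order_refl assms(3)]
    by (simp add: not_less)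
  then have inj: "inj_on ?h (cls V E k Y i)"
    by (rule eq_card_imp_inj_on[OF finite_cls[OF assms(1)]])
  let ?U = "eqv V E k Y i `` {u}" and ?W = "eqv V E k Y i `` {v}"
  have UW: "?U \<in> cls V E k Y i" "?W \<in> cls V E k Y i" using uv by (auto intro: quotientI)
  have "(u, v) \<in> eqv V E k X i" using uv assms(2) by (auto simp: eqv_def)
  then have "?h ?U = ?h ?W"
    using uv class_refine[OF assms(2) order_refl] equiv_class_eq[OF equiv_eqv] by metis
  then have "?U = ?W" using inj UW by (auto simp: inj_on_def)
  then have "(u, v) \<in> eqv V E k Y i" using uv eq_equiv_class[OF _ equiv_eqv] by metis
  then show False using uv by (simp add: eqv_def)
qed

text \<open>Hall's theorem for nested thresholds. The element with the largest threshold gets the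
  top level, and its removal keeps the condition: below its threshold nothing changes, and from it
  on all remaining elements are counted.\<close>

lemma staircase:
  assumes "finite A" "card A = i" "\<And>l. l < i \<Longrightarrow> l < card {a \<in> A. \<psi> a \<le> l}"
  shows "\<exists>l :: 'a \<Rightarrow> nat. inj_on l A \<and> l ` A \<subseteq> {..<i} \<and> (\<forall>a\<in>A. \<psi> a \<le> l a)"
  using assms
proof (induction i arbitrary: A)
  case 0
  then show ?case by simp
next
  case (Suc i)
  then have "A \<noteq> {}" by auto
  then have "Max (\<psi> ` A) \<in> \<psi> ` A" using Suc.prems(1) by simp
  then obtain a where "a \<in> A" "Max (\<psi> ` A) = \<psi> a" by blast
  then have a: "a \<in> A" "\<And>b. b \<in> A \<Longrightarrow> \<psi> b \<le> \<psi> a"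
    using Suc.prems(1) Max_ge[of "\<psi> ` A"] by auto
  have "{b \<in> A. \<psi> b \<le> i} = A"
  proof (rule card_subset_eq)
    show "card {b \<in> A. \<psi> b \<le> i} = card A"
      using Suc.prems(3)[of i] Suc.prems(2) card_mono[OF Suc.prems(1), of "{b \<in> A. \<psi> b \<le> i}"]
      by simp
  qed (use Suc.prems in auto)
  then have ai: "\<psi> a \<le> i" using a by blast
  have "l < card {b \<in> A - {a}. \<psi> b \<le> l}" if l: "l < i" for l
  proof (cases "\<psi> a \<le> l")
    case True
    then have "{b \<in> A - {a}. \<psi> b \<le> l} = A - {a}" using a(2) le_trans by blast
    then show ?thesis using l a Suc.prems by simp
  next
    case False
    then have "{b \<in> A - {a}. \<psi> b \<le> l} = {b \<in> A. \<psi> b \<le> l}" by auto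
    then show ?thesis using Suc.prems(3)[of l] l by simp
  qed
  then obtain l where l: "inj_on l (A - {a})" "l ` (A - {a}) \<subseteq> {..<i}" "\<forall>b\<in>A - {a}. \<psi> b \<le> l b"
    using Suc.IH[of "A - {a}"] Suc.prems(1,2) a(1) by auto
  have "inj_on (l(a := i)) A" using l(1,2) by (fastforce simp: inj_on_def)
  moreover have "l(a := i) ` A \<subseteq> {..<Suc i}" using l(2) by (auto simp: less_Suc_eq)
  moreover have "\<forall>b\<in>A. \<psi> b \<le> (l(a := i)) b" using l(3) ai by auto
  ultimately show ?case by blast
qed

section \<open>Greedy choice of the base, phase by phase\<close>

definition budget :: "'a set \<Rightarrow> 'a set set \<Rightarrow> nat \<Rightarrow> 'a set \<Rightarrow> nat \<Rightarrow> bool" where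
  "budget V E k X i \<longleftrightarrow> X \<subseteq> V \<and> card X + (k - 1) \<le> (k - 1) * card (cls V E k X i)"

text \<open>Survival of the earlier classes. It forces a class of phase \<open>l\<close> inside
  \<open>T\<close> to contain one of the vertices of \<open>T\<close> that a greedy step leaves out,
  and this supplies the levels for these vertices.\<close>

definition hits :: "'a set \<Rightarrow> 'a set set \<Rightarrow> nat \<Rightarrow> (nat \<Rightarrow> 'a set) \<Rightarrow> nat \<Rightarrow> 'a set \<Rightarrow> bool" where
  "hits V E k X i Y \<longleftrightarrow> (\<forall>l<i. X l \<subseteq> Y \<and> (\<forall>C\<in>cls V E k (X l) l. \<not> C \<subseteq> Y))"

text \<open>The last clause is what maximality of the class number gives: a mismatch that remains
  inseparable covers more than \<open>i\<close> entire classes. Later phases use it as the supply of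
  vertices recognisable at level \<open>i\<close>.\<close>

definition good :: "'a set \<Rightarrow> 'a set set \<Rightarrow> nat \<Rightarrow> (nat \<Rightarrow> 'a set) \<Rightarrow> nat \<Rightarrow> bool" where
  "good V E k X i \<longleftrightarrow> budget V E k (X i) i \<and> hits V E k X i (X i) \<and>
     (\<forall>u v T. u \<in> V - X i \<longrightarrow> v \<in> V - X i \<longrightarrow> \<not> sep V E k (X i) i u v \<longrightarrow>
        T \<subseteq> V \<longrightarrow> card T = k - 1 \<longrightarrow> u \<notin> T \<longrightarrow> v \<notin> T \<longrightarrow>
        (insert u T \<in> E) \<noteq> (insert v T \<in> E) \<longrightarrow>
        i < card {C \<in> cls V E k (X i) i. C \<subseteq> T})"

text \<open>The set of the preceding phase is itself admissible for the next one, since raising the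
  level can only split classes.\<close>

lemma exists_budget_hits:
  assumes fin: "finite V" "V \<noteq> {}" and X: "\<And>l. l < j \<Longrightarrow> good V E k X l"
  shows "\<exists>Y. budget V E k Y j \<and> hits V E k X j Y"
proof (cases j)
  case 0
  have "cls V E k {} 0 \<noteq> {}" using fin(2) by (auto simp: quotient_def)
  then have "card (cls V E k {} 0) \<ge> 1"
    using finite_cls[OF fin(1), of "{}" E k 0] by (simp add: Suc_le_eq card_gt_0_iff)
  then have "budget V E k {} 0" by (simp add: budget_def)
  then show ?thesis using 0 by (auto simp: hits_def)
next
  case (Suc i)
  have g: "budget V E k (X i) i" "hits V E k X i (X i)" using X[of i] Suc by (auto simp: good_def)
  have hit: "\<not> C \<subseteq> X i" if C: "C \<in> cls V E k (X i) i" for C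
  proof -
    obtain u where "u \<in> C" using in_quotient_imp_non_empty[OF equiv_eqv C] by blast
    then show ?thesis using cls_eq(2)[OF C] by blast
  qed
  have "card (cls V E k (X i) i) \<le> card (cls V E k (X i) j)"
    by (rule card_cls_le[OF fin(1) order_refl _ hit]) (use Suc in simp_all)
  then have "(k - 1) * card (cls V E k (X i) i) \<le> (k - 1) * card (cls V E k (X i) j)"
    by (rule mult_le_mono2)
  then have "budget V E k (X i) j" using g(1) unfolding budget_def by linarith
  moreover have "hits V E k X j (X i)"
    using g(2) hit Suc by (auto simp: hits_def less_Suc_eq)
  ultimately show ?thesis by blast
qed

lemma disjoint_cls:
  assumes "C \<in> cls V E k X i" "C' \<in> cls V E k X i" "u \<in> C" "u \<in> C'"
  shows "C = C'"
  using cls_eq(1)[OF assms(1,3)] cls_eq(1)[OF assms(2,4)] by simp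

lemma card_covered_le:
  assumes "finite V" "finite R" and R: "\<And>C. C \<in> \<C> \<Longrightarrow> R \<inter> C \<noteq> {}" and "\<C> \<subseteq> cls V E k X i"
  shows "card \<C> \<le> card (R \<inter> \<Union>\<C>)"
proof -
  define f where "f C = (SOME a. a \<in> R \<inter> C)" for C
  have f: "f C \<in> R \<inter> C" if "C \<in> \<C>" for C
    using R[OF that] unfolding f_def by (metis some_in_eq)
  have "inj_on f \<C>"
  proof (rule inj_onI)
    fix C C' assume "C \<in> \<C>" "C' \<in> \<C>" "f C = f C'"
    then show "C = C'" using f[of C] f[of C'] assms(4) disjoint_cls[of C V X E k i C' "f C"] by auto
  qed
  moreover have "f ` \<C> \<subseteq> R \<inter> \<Union>\<C>" using f by auto
  ultimately show ?thesis using assms(2) card_inj_on_le by blast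
qed

text \<open>A step of the greedy construction: play \<open>T\<close> except for one vertex \<open>r C\<close> of each class
  contained in it.\<close>

lemma greedy_step:
  assumes fin: "finite V" and good: "\<And>l. l < j \<Longrightarrow> good V E k X l"
    and Y: "hits V E k X j Y" "Y \<subseteq> V"
    and uv: "u \<in> V - Y" "v \<in> V - Y" "\<not> sep V E k Y j u v"
    and T: "T \<subseteq> V" "card T = k - 1" "u \<notin> T" "v \<notin> T" "(insert u T \<in> E) \<noteq> (insert v T \<in> E)"
    and few: "card {C \<in> cls V E k Y j. C \<subseteq> T} \<le> j"
  obtains Z where "Y \<subseteq> Z" "Z \<subseteq> Y \<union> T" "u \<notin> Z" "v \<notin> Z" "sep V E k Z j u v"
    "\<And>C. C \<in> cls V E k Y j \<Longrightarrow> \<not> C \<subseteq> Z" "hits V E k X j Z"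
proof -
  define \<C> where "\<C> = {C \<in> cls V E k Y j. C \<subseteq> T}"
  define r where "r C = (SOME a. a \<in> C)" for C :: "'a set"
  have ne: "C \<noteq> {}" if "C \<in> cls V E k Y j" for C
    using in_quotient_imp_non_empty[OF equiv_eqv that] .
  have r: "r C \<in> C" if "C \<in> cls V E k Y j" for C
    using ne[OF that] unfolding r_def by (simp add: some_in_eq)
  define R where "R = r ` \<C>"
  define Z where "Z = Y \<union> (T - R)"
  have clsY: "C \<inter> Y = {}" "C \<subseteq> V" if "C \<in> cls V E k Y j" for C
    using cls_eq(2)[OF that] by auto
  have RT: "R \<subseteq> T" "R \<inter> Y = {}"
    using r clsY unfolding R_def \<C>_def by fastforce+
  have TZ: "T - Z = R" using RT by (auto simp: Z_def)
  have finT: "finite T" using T(1) fin finite_subset by blast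
  have finR: "finite R" using RT(1) finT finite_subset by blast
  have cardR: "card R \<le> j"
    using few card_image_le[of \<C> r] finite_cls[OF fin, of Y E k j] unfolding R_def \<C>_def by simp
  have survive: "\<not> C \<subseteq> Z" if C: "C \<in> cls V E k Y j" for C
  proof (cases "C \<subseteq> T")
    case True
    then have "r C \<in> R" using C by (simp add: R_def \<C>_def)
    then have "r C \<notin> Z" using RT by (auto simp: Z_def)
    then show ?thesis using r[OF C] by blast
  next
    case False
    then show ?thesis using clsY(1)[OF C] by (auto simp: Z_def)
  qed
  have hitsZ: "\<not> C \<subseteq> Z" if l: "l < j" and C: "C \<in> cls V E k (X l) l" for C l
  proof -
    have XY: "X l \<subseteq> Y" "\<not> C \<subseteq> Y" using Y(1) l C by (auto simp: hits_def)
    then obtain b where b: "b \<in> C" "b \<notin> Y" by blast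
    have bV: "b \<in> V - Y" using cls_eq(2)[OF C b(1)] b(2) by simp
    define D where "D = eqv V E k Y j `` {b}"
    have "D \<in> cls V E k Y j" unfolding D_def by (rule quotientI[OF bV])
    moreover have "D \<subseteq> C"
      unfolding cls_eq(1)[OF C b(1)] D_def
      using eqv_refine[OF XY(1) less_imp_le[OF l]] by blast
    ultimately show ?thesis using survive by blast
  qed
  \<comment> \<open>\<open>P a l\<close> says that a reply to \<open>a\<close> still inseparable
    from \<open>a\<close> in phase \<open>l\<close> cannot leave \<open>T\<close>. So
    \<open>\<psi> a\<close> is the least number of rounds known to pin \<open>a\<close>.\<close>
  define P where "P a l \<longleftrightarrow> eqv V E k (X l) l `` {a} \<subseteq> T" for a l
  define \<psi> where "\<psi> a = (LEAST l. P a l)" for a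
  \<comment> \<open>Phase \<open>l\<close> is good although \<open>u\<close> and \<open>v\<close>
    remain together in it, so more than \<open>l\<close> of its classes lie in \<open>T\<close>.
    None of them is swallowed by \<open>Z\<close>, hence each meets
    \<open>T - Z = R\<close>.\<close>
  have many: "l < card {a \<in> R. P a l}" if l: "l < j" for l
  proof -
    have XY: "X l \<subseteq> Y" using Y(1) l by (auto simp: hits_def)
    have "\<not> sep V E k (X l) l u v"
      using uv sep_mono[OF sep_superset[OF _ XY] less_imp_le[OF l]] by blast
    then have "l < card {C \<in> cls V E k (X l) l. C \<subseteq> T}" (is "_ < card ?\<D>")
      using good[OF l] uv XY T unfolding good_def by blast
    also have "\<dots> \<le> card (R \<inter> \<Union>?\<D>)"
    proof (rule card_covered_le[OF fin finR])
      fix C assume "C \<in> ?\<D>"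
      then have C: "C \<in> cls V E k (X l) l" "C \<subseteq> T" by auto
      then obtain b where b: "b \<in> C" "b \<notin> Z" using hitsZ[OF l C(1)] by blast
      then show "R \<inter> C \<noteq> {}" using C(2) TZ by blast
    qed auto
    also have "\<dots> \<le> card {a \<in> R. P a l}"
    proof (rule card_mono)
      show "R \<inter> \<Union>?\<D> \<subseteq> {a \<in> R. P a l}"
      proof
        fix a assume a: "a \<in> R \<inter> \<Union>?\<D>"
        then obtain C where "C \<in> cls V E k (X l) l" "C \<subseteq> T" "a \<in> C" by auto
        then show "a \<in> {a \<in> R. P a l}" using a cls_eq(1) unfolding P_def by fast
      qed
    qed (use finR in simp)
    finally show ?thesis .
  qed
  have "\<exists>l :: 'a \<Rightarrow> nat. inj_on l R \<and> l ` R \<subseteq> {..<j} \<and> (\<forall>a\<in>R. \<psi> a \<le> l a \<and> P a (\<psi> a))"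
  proof (cases j)
    case 0
    then have "R = {}" using cardR finR by simp
    then show ?thesis by simp
  next
    case (Suc i)
    have sub: "{a \<in> R. P a l} \<subseteq> R" for l by auto
    have "{a \<in> R. P a i} = R"
      using many[of i] cardR Suc card_seteq[OF finR sub] by simp
    then have Pi: "P a i" if "a \<in> R" for a using that by blast
    \<comment> \<open>The count at level \<open>i = j - 1\<close> and the assumption
      \<open>few\<close> leave no slack: there are exactly as many vertices as levels.\<close>
    have cR: "card R = j" using many[of i] cardR Suc card_mono[OF finR sub, of i] by simp
    have "\<exists>l :: 'a \<Rightarrow> nat. inj_on l R \<and> l ` R \<subseteq> {..<j} \<and> (\<forall>a\<in>R. \<psi> a \<le> l a)"
    proof (rule staircase[OF finR cR])
      fix l assume l: "l < j"
      have "{a \<in> R. P a l} \<subseteq> {a \<in> R. \<psi> a \<le> l}"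
        unfolding \<psi>_def by (auto intro: Least_le)
      then show "l < card {a \<in> R. \<psi> a \<le> l}"
        using many[OF l] card_mono[of "{a \<in> R. \<psi> a \<le> l}" "{a \<in> R. P a l}"] finR by simp
    qed
    moreover have "P a (\<psi> a)" if "a \<in> R" for a
      unfolding \<psi>_def using Pi[OF that] by (rule LeastI)
    ultimately show ?thesis by blast
  qed
  then obtain l :: "'a \<Rightarrow> nat" where l: "inj_on l R" "l ` R \<subseteq> {..<j}"
    "\<And>a. a \<in> R \<Longrightarrow> \<psi> a \<le> l a \<and> P a (\<psi> a)" by blast
  have uvZ: "u \<notin> Z" "v \<notin> Z" using uv T(3,4) by (auto simp: Z_def)
  have sepZ: "sep V E k Z j u v"
  proof (rule sep.sepI[where T = T and l = l])
    fix \<beta> assume b: "inj_on \<beta> (T - Z)" "\<beta> ` (T - Z) \<subseteq> V - Z"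
    show "\<beta> ` (T - Z) = T - Z \<or> (\<exists>a\<in>T - Z. sep V E k Z (l a) (\<beta> a) a)"
    proof (rule disjCI)
      assume ns: "\<not> (\<exists>a\<in>T - Z. sep V E k Z (l a) (\<beta> a) a)"
      have "\<beta> ` (T - Z) \<subseteq> T - Z"
      proof
        fix c assume "c \<in> \<beta> ` (T - Z)"
        then obtain a where a: "a \<in> T - Z" "c = \<beta> a" by blast
        then have aR: "a \<in> R" using TZ by simp
        have cV: "c \<in> V - Z" using a b(2) by blast
        have "l a < j" using l(2) aR by blast
        then have pj: "\<psi> a < j" using l(3)[OF aR] by simp
        have XZ: "X (\<psi> a) \<subseteq> Z" using Y(1) pj by (auto simp: hits_def Z_def)
        have "\<not> sep V E k Z (l a) c a" using ns a by blast
        then have "\<not> sep V E k (X (\<psi> a)) (\<psi> a) c a"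
          using sep_mono[OF sep_superset[OF _ XZ], of V E k "\<psi> a" c a "l a"] l(3)[OF aR] cV a(1) by blast
        then have "\<not> sep V E k (X (\<psi> a)) (\<psi> a) a c" by (rule contrapos_nn) (rule sep_sym)
        then have "(a, c) \<in> eqv V E k (X (\<psi> a)) (\<psi> a)"
          using a(1) cV XZ T(1) unfolding eqv_def by blast
        then have "c \<in> T" using l(3)[OF aR] unfolding P_def by blast
        then show "c \<in> T - Z" using cV by blast
      qed
      moreover have "card (\<beta> ` (T - Z)) = card (T - Z)" by (rule card_image[OF b(1)])
      ultimately show "\<beta> ` (T - Z) = T - Z"
        using finT by (intro card_subset_eq) auto
    qed
  qed (use uv uvZ T l TZ in simp_all)
  have "hits V E k X j Z"
    unfolding hits_def using hitsZ Y(1) by (auto simp: hits_def Z_def)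
  moreover have "Y \<subseteq> Z" "Z \<subseteq> Y \<union> T" by (auto simp: Z_def)
  ultimately show thesis using that uvZ sepZ survive by blast
qed

text \<open>Take an admissible set with the largest number of classes. If the covering clause
  failed, \<open>greedy_step\<close> would gain a class for at most \<open>k - 1\<close> new
  vertices, which respects the budget and contradicts maximality.\<close>

lemma exists_good_step:
  assumes fin: "finite V" "V \<noteq> {}" and X: "\<And>l. l < j \<Longrightarrow> good V E k X l"
  shows "\<exists>Y. good V E k (X(j := Y)) j"
proof -
  define S where "S = {Y. budget V E k Y j \<and> hits V E k X j Y}"
  have S: "finite S" "S \<noteq> {}"
    using exists_budget_hits[OF fin X] fin(1) finite_subset[of S "Pow V"]
    by (auto simp: S_def budget_def)
  let ?\<kappa> = "\<lambda>Y. card (cls V E k Y j)"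
  have "Max (?\<kappa> ` S) \<in> ?\<kappa> ` S" using S by (intro Max_in) auto
  then obtain Y where Y: "Y \<in> S" "?\<kappa> Y = Max (?\<kappa> ` S)" by fastforce
  then have max: "?\<kappa> Z \<le> ?\<kappa> Y" if "Z \<in> S" for Z using that S(1) by simp
  have Yb: "budget V E k Y j" "hits V E k X j Y" using Y(1) by (auto simp: S_def)
  have cov: "j < card {C \<in> cls V E k Y j. C \<subseteq> T}"
    if uv: "u \<in> V - Y" "v \<in> V - Y" "\<not> sep V E k Y j u v"
      and T: "T \<subseteq> V" "card T = k - 1" "u \<notin> T" "v \<notin> T" "(insert u T \<in> E) \<noteq> (insert v T \<in> E)"
    for u v T
  proof (rule ccontr)
    assume "\<not> ?thesis"
    then have few: "card {C \<in> cls V E k Y j. C \<subseteq> T} \<le> j" by simp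
    have YV: "Y \<subseteq> V" using Yb(1) by (simp add: budget_def)
    obtain Z where Z: "Y \<subseteq> Z" "Z \<subseteq> Y \<union> T" "u \<notin> Z" "v \<notin> Z" "sep V E k Z j u v"
      "\<And>C. C \<in> cls V E k Y j \<Longrightarrow> \<not> C \<subseteq> Z" "hits V E k X j Z"
      using greedy_step[OF fin(1) X Yb(2) YV uv T few] by blast
    have less: "?\<kappa> Y < ?\<kappa> Z"
      using card_cls_less[OF fin(1) Z(1,6) _ _ uv(3) Z(5)] uv(1,2) Z(3,4) by simp
    have "finite T" "finite Y" using T(1) YV fin(1) finite_subset by blast+
    then have "card Z \<le> card Y + (k - 1)"
      using card_mono[OF _ Z(2)] card_Un_le[of Y T] T(2) by simp
    moreover have "(k - 1) * ?\<kappa> Y + (k - 1) \<le> (k - 1) * ?\<kappa> Z"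
      using mult_le_mono2[of "Suc (?\<kappa> Y)" "?\<kappa> Z" "k - 1"] less by simp
    ultimately have "budget V E k Z j"
      using Yb(1) Z(2) T(1) unfolding budget_def by (auto intro: order_trans)
    then have "Z \<in> S" using Z(7) by (simp add: S_def)
    then show False using max less by fastforce
  qed
  have eq: "hits V E k (X(j := Y)) j Y = hits V E k X j Y" by (auto simp: hits_def)
  show ?thesis
    unfolding good_def fun_upd_same eq using Yb cov eq by (intro exI[of _ Y] conjI allI impI) simp_all
qed

lemma exists_good_chain:
  assumes fin: "finite V" "V \<noteq> {}"
  shows "\<exists>X. \<forall>l<j. good V E k X l"
proof (induction j)
  case 0
  show ?case by simp
next
  case (Suc j)
  then obtain X where X: "\<And>l. l < j \<Longrightarrow> good V E k X l" by blast
  obtain Y where Y: "good V E k (X(j := Y)) j" using exists_good_step[OF fin X] by blast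
  have "good V E k (X(j := Y)) l" if "l < j" for l
  proof -
    have "hits V E k (X(j := Y)) l (X l) = hits V E k X l (X l)"
      using that by (auto simp: hits_def)
    then show ?thesis using X[OF that] that by (simp add: good_def)
  qed
  then have "\<forall>l<Suc j. good V E k (X(j := Y)) l" using Y by (auto simp only: less_Suc_eq)
  then show ?case by (rule exI[where x = "X(j := Y)"])
qed

theorem exists_base:
  assumes g: "kgraph k V E" and V: "V \<noteq> {}" and k: "k \<ge> 1"
  obtains X where "X \<subseteq> V" "card X + (k - 1) \<le> (k - 1) * card (cls V E k X (k - 1))"
    "\<And>u v. u \<in> V - X \<Longrightarrow> v \<in> V - X \<Longrightarrow> sep V E k X (k - 1) u v \<longleftrightarrow> \<not> twins E u v"
proof -
  have fin: "finite V" using g by (simp add: kgraph_def)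
  obtain X where "\<forall>l<k. good V E k X l" using exists_good_chain[OF fin V] by blast
  then have gd: "good V E k X (k - 1)" using k by simp
  have "twins E u v" if uv: "u \<in> V - X (k - 1)" "v \<in> V - X (k - 1)"
    "\<not> sep V E k (X (k - 1)) (k - 1) u v" for u v
  proof (rule ccontr)
    assume "\<not> twins E u v"
    then obtain T where T: "u \<notin> T" "v \<notin> T" "(insert u T \<in> E) \<noteq> (insert v T \<in> E)"
      unfolding twins_def by blast
    then have "insert u T \<in> E \<or> insert v T \<in> E" by auto
    then have TV: "T \<subseteq> V" "card T = k - 1" "finite T"
      using kgraph_edge[OF g, of "insert u T"] kgraph_edge[OF g, of "insert v T"] T(1,2) by auto
    let ?\<C> = "{C \<in> cls V E k (X (k - 1)) (k - 1). C \<subseteq> T}"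
    have "k - 1 < card ?\<C>" using gd uv T TV unfolding good_def by blast
    also have "\<dots> \<le> card (T \<inter> \<Union>?\<C>)"
    proof (rule card_covered_le[OF fin TV(3)])
      fix C assume "C \<in> ?\<C>"
      then show "T \<inter> C \<noteq> {}"
        using in_quotient_imp_non_empty[OF equiv_eqv, of C] by blast
    qed auto
    also have "\<dots> \<le> card T" by (rule card_mono[OF TV(3)]) simp
    finally show False using TV(2) by simp
  qed
  then show thesis
    using that[of "X (k - 1)"] gd sep_not_twins unfolding good_def budget_def by metis
qed

section \<open>Positions of the game on hypergraphs\<close>

lemma univ_kgraph_struct [simp]: "univ (kgraph_struct k V E) = V"
  by (simp add: kgraph_struct_def)

lemma rel_kgraph_struct:
  "xs \<in> rel (kgraph_struct k V E) \<longleftrightarrow> length xs = k \<and> distinct xs \<and> set xs \<in> E"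
  by (simp add: kgraph_struct_def)

lemma agree_distinct: "agree k G M s t \<Longrightarrow> distinct s \<longleftrightarrow> distinct t"
  by (auto simp: agree_def distinct_conv_nth)

lemma ex_map_list: "distinct as \<Longrightarrow> length bs = length as \<Longrightarrow> \<exists>g. bs = map g as"
proof -
  assume a: "distinct as" "length bs = length as"
  have "bs = map (\<lambda>x. the (map_of (zip as bs) x)) as"
    using a by (intro nth_equalityI) (auto simp: map_of_zip_nth)
  then show ?thesis by blast
qed

lemma simU_pick:
  assumes "simU k G M r (s @ bs) (t @ zs)" "univ M \<noteq> {}" "length s = length t" "i < length zs"
  shows "simU k G M r (s @ [bs ! i]) (t @ [zs ! i])"
proof -
  have l: "length bs = length zs" using simU_length[OF assms(1,2)] assms(3) by simp
  have "simU k G M r (map ((!) (s @ bs)) ([0..<length s] @ [length s + i]))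
      (map ((!) (t @ zs)) ([0..<length s] @ [length s + i]))"
    by (rule simU_select[OF assms(1,2)]) (use assms(4) l in auto)
  moreover have "map ((!) (s @ bs)) ([0..<length s] @ [length s + i]) = s @ [bs ! i]"
    by (auto intro!: nth_equalityI simp: nth_append)
  moreover have "map ((!) (t @ zs)) ([0..<length s] @ [length s + i]) = t @ [zs ! i]"
    using assms(3) by (auto intro!: nth_equalityI simp: nth_append)
  ultimately show ?thesis by (simp only:)
qed

lemma agree_inj:
  assumes "agree k G M (map p L) (map q L)" "x \<in> set L" "y \<in> set L"
  shows "p x = p y \<longleftrightarrow> q x = q y"
proof -
  obtain i j where "i < length L" "x = L ! i" "j < length L" "y = L ! j"
    using assms(2,3) by (auto simp: in_set_conv_nth)
  then show ?thesis using assms(1) by (auto simp: agree_def)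
qed

text \<open>The labels in \<open>L\<close> name the pebbles on both sides, so that a set of labels
  can be compared instead of a tuple. Sets whose size differs from \<open>k\<close> are edges on
  neither side because \<open>p\<close> and \<open>q\<close> are injective.\<close>

lemma edge_agree:
  assumes g: "kgraph k V E" "kgraph k V' E'"
    and ag: "agree k (kgraph_struct k V E) (kgraph_struct k V' E') (map p L) (map q L)"
    and p: "inj_on p (set L)" and B: "B \<subseteq> set L"
  shows "p ` B \<in> E \<longleftrightarrow> q ` B \<in> E'"
proof -
  have q: "inj_on q (set L)" using agree_inj[OF ag] p by (auto simp: inj_on_def)
  have inj: "inj_on p B" "inj_on q B" using p q B inj_on_subset by blast+
  show ?thesis
  proof (cases "card B = k")
    case False
    then show ?thesis
      using kgraph_edge[OF g(1), of "p ` B"] kgraph_edge[OF g(2), of "q ` B"] card_image[OF inj(1)]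
        card_image[OF inj(2)] by auto
  next
    case True
    have "finite B" using B finite_subset by blast
    then obtain bs where bs: "set bs = B" "distinct bs" using finite_distinct_list by blast
    have "\<exists>i. i < length L \<and> L ! i = b" if "b \<in> set bs" for b
      using that bs B by (auto simp: in_set_conv_nth)
    then obtain h where h: "\<And>b. b \<in> set bs \<Longrightarrow> h b < length L \<and> L ! h b = b" by metis
    have "length (map h bs) = k" using bs True distinct_card by force
    moreover have "set (map h bs) \<subseteq> {..<length (map p L)}" using h by auto
    ultimately have r: "map ((!) (map p L)) (map h bs) \<in> rel (kgraph_struct k V E) \<longleftrightarrow>
        map ((!) (map q L)) (map h bs) \<in> rel (kgraph_struct k V' E')"
      using ag unfolding agree_def by blast
    have e: "map ((!) (map p L)) (map h bs) = map p bs"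
      "map ((!) (map q L)) (map h bs) = map q bs" using h by auto
    have "map p bs \<in> rel (kgraph_struct k V E) \<longleftrightarrow> map q bs \<in> rel (kgraph_struct k V' E')"
      using r unfolding e .
    moreover have "length bs = k" using \<open>length (map h bs) = k\<close> by simp
    ultimately show ?thesis
      using bs inj by (simp add: rel_kgraph_struct distinct_map)
  qed
qed

text \<open>The competing structure is arbitrary and must first be recognised as a hypergraph.
  Spoiler plays a tuple of \<open>rel N\<close>; the reply has distinct entries and spans an edge,
  so all its reorderings are in the relation, and agreement carries this back to
  \<open>N\<close>.\<close>

lemma kgraph_of_simU:
  assumes N: "finite_struct k N" and g: "kgraph k V E"
    and sim: "simU k (kgraph_struct k V E) N k [] []"
  obtains E' where "kgraph k (univ N) E'" "N = kgraph_struct k (univ N) E'"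
proof -
  define E' where "E' = set ` rel N"
  have len: "length xs = k" "set xs \<subseteq> univ N" if "xs \<in> rel N" for xs
    using N that by (auto simp: finite_struct_def)
  have key: "distinct xs \<and> (\<forall>zs. length zs = k \<longrightarrow> distinct zs \<longrightarrow> set zs = set xs \<longrightarrow> zs \<in> rel N)"
    if xs: "xs \<in> rel N" for xs
  proof -
    have "simU k (kgraph_struct k V E) N (length xs + 0) [] []" using sim len[OF xs] by simp
    then obtain ys where ys: "length ys = length xs"
      "simU k (kgraph_struct k V E) N 0 ([] @ ys) ([] @ xs)"
      using simU_moves[of k "kgraph_struct k V E" N xs 0 "[]" "[]"] len[OF xs] by blast
    then have ag: "agree k (kgraph_struct k V E) N ys xs" by simp
    have ids: "map ((!) xs) [0..<k] = xs" "map ((!) ys) [0..<k] = ys"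
      using ys(1) len(1)[OF xs] map_nth[of xs] map_nth[of ys] by simp_all
    have rel: "map ((!) ys) js \<in> rel (kgraph_struct k V E) \<longleftrightarrow> map ((!) xs) js \<in> rel N"
      if "length js = k" "set js \<subseteq> {..<k}" for js
      using ag that ys(1) len(1)[OF xs] by (simp add: agree_def)
    have yE: "distinct ys" "set ys \<in> E"
      using rel[of "[0..<k]"] xs ids by (auto simp: rel_kgraph_struct lessThan_atLeast0)
    have "zs \<in> rel N" if zs: "length zs = k" "distinct zs" "set zs = set xs" for zs
    proof -
      have "\<exists>i. i < k \<and> xs ! i = z" if "z \<in> set zs" for z
        using that zs(3) len(1)[OF xs] by (auto simp: in_set_conv_nth)
      then obtain h where h: "\<And>z. z \<in> set zs \<Longrightarrow> h z < k \<and> xs ! h z = z" by metis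
      have hm: "map ((!) xs) (map h zs) = zs" using h by (auto intro: map_idI)
      have "distinct (map h zs)" using h zs(2) by (auto simp: distinct_map intro: inj_on_inverseI[where g = "(!) xs"])
      have hs: "set (map h zs) \<subseteq> {..<k}" using h by auto
      have "distinct (map ((!) ys) (map h zs))"
        unfolding distinct_map[of "(!) ys"] using \<open>distinct (map h zs)\<close> hs yE(1) ys(1) len(1)[OF xs]
        by (intro conjI inj_on_nth) auto
      moreover from this have "set (map ((!) ys) (map h zs)) = set ys"
      proof (intro card_subset_eq)
        show "set (map ((!) ys) (map h zs)) \<subseteq> set ys"
          using h ys(1) len(1)[OF xs] by auto
        show "card (set (map ((!) ys) (map h zs))) = card (set ys)" if "distinct (map ((!) ys) (map h zs))"
          using distinct_card[OF that] distinct_card[OF yE(1)] zs(1) ys(1) len(1)[OF xs] by simp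
      qed simp
      ultimately have "map ((!) ys) (map h zs) \<in> rel (kgraph_struct k V E)"
        using yE(2) zs(1) by (simp add: rel_kgraph_struct)
      then show ?thesis using rel[of "map h zs"] hs zs(1) hm by simp
    qed
    then show ?thesis using agree_distinct[OF ag] yE(1) by blast
  qed
  show thesis
  proof (rule that)
    show "kgraph k (univ N) E'"
      unfolding kgraph_def
    proof (intro conjI ballI)
      show "finite (univ N)" using N by (simp add: finite_struct_def)
      fix e assume "e \<in> E'"
      then obtain xs where xs: "xs \<in> rel N" "e = set xs" by (auto simp: E'_def)
      then show "e \<subseteq> univ N" "card e = k" using len[OF xs(1)] key[OF xs(1)] distinct_card by auto
    qed
    have "rel N = {xs. length xs = k \<and> distinct xs \<and> set xs \<in> E'}"
    proof (intro equalityI subsetI)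
      fix xs assume "xs \<in> rel N"
      then show "xs \<in> {xs. length xs = k \<and> distinct xs \<and> set xs \<in> E'}"
        using len(1)[of xs] key[of xs] by (simp add: E'_def)
    next
      fix xs assume xs: "xs \<in> {xs. length xs = k \<and> distinct xs \<and> set xs \<in> E'}"
      then obtain ys where ys: "ys \<in> rel N" "set xs = set ys"
        unfolding E'_def by (simp add: image_iff) blast
      then show "xs \<in> rel N" using key[OF ys(1)] xs by simp
    qed
    then show "N = kgraph_struct k (univ N) E'" by (simp add: kgraph_struct_def)
  qed
qed

text \<open>Spoiler plays the vertices in order of decreasing \<open>l\<close>, so that exactly
  \<open>l c\<close> rounds remain after \<open>c\<close>; rounds whose number is no level are
  skipped. Injectivity of \<open>l\<close> prevents two vertices from claiming one round.\<close>

lemma staged_moves: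
  assumes ne: "univ M \<noteq> {}" and "inj_on l A" "l ` A \<subseteq> {..<i}" "\<zeta> ` A \<subseteq> univ M" "simU k G M i s t"
  shows "\<exists>\<beta> as. distinct as \<and> set as = A \<and> \<beta> ` A \<subseteq> univ G \<and>
    simU k G M 0 (s @ map \<beta> as) (t @ map \<zeta> as) \<and>
    (\<forall>c\<in>A. simU k G M (l c) (s @ [\<beta> c]) (t @ [\<zeta> c]))"
  using assms(2-)
proof (induction i arbitrary: A s t)
  case 0
  then show ?case by (intro exI[of _ undefined] exI[of _ "[]"]) simp
next
  case (Suc i)
  show ?case
  proof (cases "i \<in> l ` A")
    case False
    have "l ` A \<subseteq> {..<i}"
    proof
      fix j assume "j \<in> l ` A"
      then show "j \<in> {..<i}" using False Suc.prems(2) by (cases "j = i") auto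
    qed
    then show ?thesis by (rule Suc.IH[OF Suc.prems(1) _ Suc.prems(3) simU_Suc[OF Suc.prems(4) ne]])
  next
    case True
    then obtain c where c: "c \<in> A" "l c = i" by blast
    then obtain a where a: "a \<in> univ G" "simU k G M i (s @ [a]) (t @ [\<zeta> c])"
      using Suc.prems(3,4) by auto
    have len: "length s = length t" using simU_length[OF a(2) ne] by simp
    have lA: "l ` (A - {c}) \<subseteq> {..<i}"
    proof
      fix j assume "j \<in> l ` (A - {c})"
      then obtain d where d: "d \<in> A" "d \<noteq> c" "j = l d" by blast
      then have "l d \<noteq> i" using c Suc.prems(1) by (auto simp: inj_on_def)
      moreover have "l d < Suc i" using d(1) Suc.prems(2) by blast
      ultimately show "j \<in> {..<i}" using d(3) by simp
    qed
    have inj: "inj_on l (A - {c})" and \<zeta>: "\<zeta> ` (A - {c}) \<subseteq> univ M"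
      using Suc.prems(1,3) by (auto intro: inj_on_diff)
    obtain \<beta> as where IH: "distinct as" "set as = A - {c}" "\<beta> ` (A - {c}) \<subseteq> univ G"
      "simU k G M 0 ((s @ [a]) @ map \<beta> as) ((t @ [\<zeta> c]) @ map \<zeta> as)"
      "\<And>d. d \<in> A - {c} \<Longrightarrow> simU k G M (l d) ((s @ [a]) @ [\<beta> d]) ((t @ [\<zeta> c]) @ [\<zeta> d])"
      using Suc.IH[OF inj lA \<zeta> a(2)] by (elim exE conjE) (rule that, assumption+, rule bspec)
    define \<gamma> where "\<gamma> = \<beta>(c := a)"
    have m: "map \<gamma> (c # as) = a # map \<beta> as" using IH(2) by (auto simp: \<gamma>_def)
    have "simU k G M 0 (s @ map \<gamma> (c # as)) (t @ map \<zeta> (c # as))"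
      unfolding m using IH(4) by simp
    moreover have "simU k G M (l d) (s @ [\<gamma> d]) (t @ [\<zeta> d])" if "d \<in> A" for d
    proof (cases "d = c")
      case True
      then show ?thesis using a(2) c(2) by (simp add: \<gamma>_def)
    next
      case False
      then have "simU k G M (l d) (s @ [a, \<beta> d]) (t @ [\<zeta> c, \<zeta> d])" using IH(5)[of d] that by simp
      then show ?thesis using simU_pick[OF _ ne len, of k G "l d" "[a, \<beta> d]" "[\<zeta> c, \<zeta> d]" 1] False
        by (simp add: \<gamma>_def)
    qed
    moreover have "distinct (c # as)" "set (c # as) = A" "\<gamma> ` A \<subseteq> univ G"
      using IH(1-3) a(1) c(1) by (auto simp: \<gamma>_def)
    ultimately show ?thesis by blast
  qed
qed

text \<open>The position after Spoiler has played the base \<open>X\<close> and \<open>f\<close> has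
  recorded the answers. The bound on \<open>r\<close> provides for \<open>k\<close> moves exhibiting
  an edge and \<open>k - 1\<close> rounds recognising the replies.\<close>

locale base_position =
  fixes k :: nat and V :: "'a set" and E :: "'a set set" and V' :: "'b set" and E' :: "'b set set"
    and X :: "'a set" and xs :: "'a list" and f :: "'a \<Rightarrow> 'b" and r :: nat
  assumes k: "k \<ge> 1" and gV: "kgraph k V E" and gV': "kgraph k V' E'" and ne: "V' \<noteq> {}"
    and xs: "distinct xs" "set xs = X" and XV: "X \<subseteq> V" and fX: "f ` X \<subseteq> V'"
    and r: "2 * k - 1 \<le> r"
    and sim: "simE k (kgraph_struct k V E) (kgraph_struct k V' E') r xs (map f xs)"
    and base: "\<And>u v. u \<in> V - X \<Longrightarrow> v \<in> V - X \<Longrightarrow> sep V E k X (k - 1) u v \<longleftrightarrow> \<not> twins E u v"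
begin

abbreviation "G \<equiv> kgraph_struct k V E"
abbreviation "M \<equiv> kgraph_struct k V' E'"

definition resp :: "nat \<Rightarrow> 'a \<Rightarrow> 'b \<Rightarrow> bool" where
  "resp i a z \<longleftrightarrow> simU k G M i (xs @ [a]) (map f xs @ [z])"

lemma ne': "univ M \<noteq> {}"
  using ne by simp

lemma fin: "finite V" "finite V'"
  using gV gV' by (simp_all add: kgraph_def)

lemma resp_mono: "resp i a z \<Longrightarrow> j \<le> i \<Longrightarrow> resp j a z"
  unfolding resp_def using simU_mono ne' by blast

lemma agree_xs: "agree k G M xs (map f xs)"
  using simU_agree[OF simE_simU[OF sim] ne'] .

lemma inj_f: "inj_on f X"
  using agree_distinct[OF agree_xs] xs by (simp add: distinct_map)

lemma pick:
  assumes "simU k G M i (xs @ bs) (map f xs @ zs)" "h < length zs"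
  shows "resp i (bs ! h) (zs ! h)"
  unfolding resp_def by (rule simU_pick[OF assms(1) ne' _ assms(2)]) simp

lemma resp_notin:
  assumes "resp i a z"
  shows "a \<in> X \<longleftrightarrow> z \<in> f ` X"
proof -
  have "agree k G M (xs @ [a]) (map f xs @ [z])"
    using simU_agree[OF _ ne'] assms unfolding resp_def by blast
  from agree_distinct[OF this] show ?thesis
    using xs agree_distinct[OF agree_xs] by auto
qed

text \<open>Spoiler plays \<open>z\<close>, answered by \<open>b\<close>, and then the vertices
  \<open>\<zeta> c\<close> in staged order. By \<open>stable\<close> the replies permute
  \<open>T - X\<close>, so the pebbles on the left fill \<open>insert b T\<close> whatever the
  permutation is. The right-hand side does not mention \<open>b\<close>; this is what makes two
  possible replies comparable.\<close>

lemma sep_resp_edge: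
  fixes T :: "'a set" and l :: "'a \<Rightarrow> nat"
  assumes T: "T \<subseteq> V" "b \<in> V - X" "b \<notin> T" and z: "z \<in> V'" "resp i b z"
    and l: "inj_on l (T - X)" "l ` (T - X) \<subseteq> {..<i}"
    and \<zeta>: "inj_on \<zeta> (T - X)" "\<zeta> ` (T - X) \<subseteq> V' - f ` X"
    and stable: "\<And>\<beta>. inj_on \<beta> (T - X) \<Longrightarrow> \<beta> ` (T - X) \<subseteq> V - X \<Longrightarrow>
      (\<And>c. c \<in> T - X \<Longrightarrow> resp (l c) (\<beta> c) (\<zeta> c)) \<Longrightarrow> \<beta> ` (T - X) = T - X"
  shows "insert b T \<in> E \<longleftrightarrow> insert z (f ` (T \<inter> X) \<union> \<zeta> ` (T - X)) \<in> E'"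
proof -
  define A where "A = T - X"
  have sb: "simU k G M i (xs @ [b]) (map f xs @ [z])" using z(2) by (simp add: resp_def)
  have \<zeta>A: "\<zeta> ` A \<subseteq> univ M" using \<zeta>(2) by (auto simp: A_def)
  have "\<exists>\<beta> as. distinct as \<and> set as = A \<and> \<beta> ` A \<subseteq> univ G \<and>
    simU k G M 0 ((xs @ [b]) @ map \<beta> as) ((map f xs @ [z]) @ map \<zeta> as) \<and>
    (\<forall>c\<in>A. simU k G M (l c) ((xs @ [b]) @ [\<beta> c]) ((map f xs @ [z]) @ [\<zeta> c]))"
    by (rule staged_moves[OF ne' l[folded A_def] \<zeta>A sb])
  then obtain \<beta> as where b0: "distinct as \<and> set as = A \<and> \<beta> ` A \<subseteq> univ G \<and>
    simU k G M 0 ((xs @ [b]) @ map \<beta> as) ((map f xs @ [z]) @ map \<zeta> as) \<and>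
    (\<forall>c\<in>A. simU k G M (l c) ((xs @ [b]) @ [\<beta> c]) ((map f xs @ [z]) @ [\<zeta> c]))"
    by (elim exE)
  then have b: "distinct as" "set as = A" "\<beta> ` A \<subseteq> V"
    "agree k G M (xs @ b # map \<beta> as) (map f xs @ z # map \<zeta> as)"
    by simp_all
  have b5: "simU k G M (l c) (xs @ [b, \<beta> c]) (map f xs @ [z, \<zeta> c])" if "c \<in> A" for c
    using b0 that by simp
  have res: "resp (l c) (\<beta> c) (\<zeta> c)" if "c \<in> A" for c
    using pick[OF b5[OF that], of 1] by simp
  define p where "p y = (if y \<in> A then \<beta> y else y)" for y
  define q where "q y = (if y \<in> A then \<zeta> y else if y = b then z else f y)" for y
  have bA: "b \<notin> A" "b \<notin> X" using T by (auto simp: A_def)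
  have XA: "y \<notin> A \<and> y \<noteq> b" if "y \<in> set xs" for y
    using that xs(2) bA(2) unfolding A_def by blast
  have "map p xs = xs" by (rule map_idI) (use XA in \<open>simp add: p_def\<close>)
  moreover have "map p as = map \<beta> as" by (rule map_cong) (use b(2) in \<open>simp_all add: p_def\<close>)
  moreover have "map q xs = map f xs" by (rule map_cong) (use XA in \<open>simp_all add: q_def\<close>)
  moreover have "map q as = map \<zeta> as" by (rule map_cong) (use b(2) in \<open>simp_all add: q_def\<close>)
  moreover have pqb: "p b = b" "q b = z" using bA by (simp_all add: p_def q_def)
  ultimately have "map p (xs @ b # as) = xs @ b # map \<beta> as"
    "map q (xs @ b # as) = map f xs @ z # map \<zeta> as"
    by simp_all
  then have ag: "agree k G M (map p (xs @ b # as)) (map q (xs @ b # as))"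
    using b(4) by (simp only:)
  have "inj_on \<beta> A"
  proof (rule inj_onI)
    fix c d assume cd: "c \<in> A" "d \<in> A" "\<beta> c = \<beta> d"
    then have "q c = q d" using agree_inj[OF ag, of c d] b(2) by (simp add: p_def)
    then show "c = d" using cd \<zeta>(1) by (auto simp: q_def A_def inj_on_def)
  qed
  moreover have "\<beta> ` A \<subseteq> V - X"
    using b(3) resp_notin[OF res] \<zeta>(2) unfolding A_def by blast
  ultimately have im: "\<beta> ` A = A" using stable res unfolding A_def by blast
  have inj: "inj_on p (set (xs @ b # as))"
  proof (rule inj_onI)
    fix c d assume "c \<in> set (xs @ b # as)" "d \<in> set (xs @ b # as)" "p c = p d"
    then have cd: "p c = p d" by simp
    have "p e \<in> A \<longleftrightarrow> e \<in> A" for e using im by (auto simp: p_def)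
    then have "c \<in> A \<longleftrightarrow> d \<in> A" using cd by metis
    then show "c = d" using cd \<open>inj_on \<beta> A\<close> by (auto simp: p_def inj_on_def split: if_splits)
  qed
  have sub: "insert b T \<subseteq> set (xs @ b # as)" using xs(2) b(2) by (auto simp: A_def)
  have "p ` insert b T \<in> E \<longleftrightarrow> q ` insert b T \<in> E'"
    by (rule edge_agree[OF gV gV' ag inj sub])
  moreover have "T = (T \<inter> X) \<union> A" by (auto simp: A_def)
  then have pq: "p ` T = p ` (T \<inter> X) \<union> p ` A" "q ` T = q ` (T \<inter> X) \<union> q ` A"
    by (metis image_Un)+
  have "p ` (T \<inter> X) = T \<inter> X" "p ` A = A" using im by (auto simp: p_def A_def)
  then have "p ` T = T" using pq(1) \<open>T = (T \<inter> X) \<union> A\<close> by simp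
  moreover note pqb
  moreover have "q ` (T \<inter> X) = f ` (T \<inter> X)" "q ` A = \<zeta> ` A"
    using bA by (auto simp: q_def A_def image_iff)
  then have "q ` T = f ` (T \<inter> X) \<union> \<zeta> ` A" using pq(2) by simp
  ultimately show ?thesis unfolding A_def image_insert by simp
qed

text \<open>Three continuations of one position are compared. One stays in \<open>G\<close>, plays
  \<open>T - X\<close> and yields \<open>\<zeta>\<close>. The other two play \<open>z\<close> in
  \<open>M\<close>, answered by \<open>u\<close> and by \<open>v\<close>, followed by the same
  \<open>\<zeta>\<close>. A reply to \<open>\<zeta> c\<close> competes with \<open>c\<close> itself,
  so the induction hypothesis, applied with \<open>\<zeta> c\<close> for \<open>z\<close>, confines
  the replies to \<open>T - X\<close>. Both edge tests then have the same outcome, against the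
  mismatch.\<close>

lemma sep_resp:
  assumes "sep V E k X i a a'"
  shows "\<forall>z\<in>V'. i \<le> k - 1 \<longrightarrow> resp i a z \<longrightarrow> \<not> resp i a' z"
  using assms
proof (induction rule: sep.induct)
  case (sepI u v T l i)
  show ?case
  proof (intro ballI impI notI)
    fix z assume z: "z \<in> V'" and ik: "i \<le> k - 1" and uz: "resp i u z" and vz: "resp i v z"
    have finA: "finite (T - X)" using sepI.hyps(3) fin finite_subset by blast
    then obtain cs where cs: "distinct cs" "set cs = T - X" using finite_distinct_list by blast
    have "card (T - X) \<le> i"
      using card_inj_on_le[OF sepI.hyps(8,9)] by simp
    then have lk: "length cs + k \<le> r" using cs distinct_card[OF cs(1)] ik r k by simp
    then have "simE k G M (length cs + (r - length cs)) xs (map f xs)" using sim by simp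
    moreover have "set cs \<subseteq> univ G" using cs(2) sepI.hyps(3) by auto
    ultimately obtain bs where bs: "length bs = length cs" "set bs \<subseteq> univ M"
      "simE k G M (r - length cs) (xs @ cs) (map f xs @ bs)"
      using simE_moves by blast
    obtain \<zeta> where \<zeta>: "bs = map \<zeta> cs" using ex_map_list[OF cs(1) bs(1)] by blast
    have simz: "simU k G M (k - 1) (xs @ cs) (map f xs @ bs)"
      using simU_mono[OF simE_simU[OF bs(3)] ne'] lk by simp
    have resz: "resp (k - 1) c (\<zeta> c)" if "c \<in> T - X" for c
    proof -
      have "c \<in> set cs" using that cs(2) by simp
      then obtain h where "h < length cs" "cs ! h = c" unfolding in_set_conv_nth by (elim exE conjE)
      then show ?thesis using pick[OF simz, of h] bs(1) by (simp add: \<zeta>)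
    qed
    have "set xs \<inter> set cs = {}" unfolding xs(2) cs(2) by blast
    then have "distinct (xs @ cs)" using cs(1) xs(1) by simp
    then have "distinct (map f xs @ bs)"
      using agree_distinct[OF simU_agree[OF simz ne']] by simp
    then have "distinct (map \<zeta> cs)" "f ` set xs \<inter> \<zeta> ` set cs = {}" unfolding \<zeta> by simp_all
    moreover have "\<zeta> ` set cs \<subseteq> V'" using bs(2) unfolding \<zeta> by simp
    ultimately have z1: "inj_on \<zeta> (T - X)" "\<zeta> ` (T - X) \<subseteq> V' - f ` X"
      unfolding distinct_map cs(2) xs(2) by blast+
    have stable: "\<beta> ` (T - X) = T - X"
      if b: "inj_on \<beta> (T - X)" "\<beta> ` (T - X) \<subseteq> V - X"
        "\<And>c. c \<in> T - X \<Longrightarrow> resp (l c) (\<beta> c) (\<zeta> c)" for \<beta>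
    proof (rule ccontr)
      assume "\<beta> ` (T - X) \<noteq> T - X"
      then obtain c where c: "c \<in> T - X"
        "\<forall>z\<in>V'. l c \<le> k - 1 \<longrightarrow> resp (l c) (\<beta> c) z \<longrightarrow> \<not> resp (l c) c z"
        using sepI.IH[OF b(1,2)] by blast
      have "l c < i" using sepI.hyps(9) c(1) by blast
      then have lc: "l c \<le> k - 1" using ik by simp
      have "\<zeta> c \<in> V'" using z1(2) c(1) by blast
      then show False using c lc b(3)[OF c(1)] resp_mono[OF resz[OF c(1)] lc] by blast
    qed
    have "insert u T \<in> E \<longleftrightarrow> insert z (f ` (T \<inter> X) \<union> \<zeta> ` (T - X)) \<in> E'"
      by (rule sep_resp_edge[OF sepI.hyps(3,1,5) z uz sepI.hyps(8,9) z1 stable])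
    moreover have "insert v T \<in> E \<longleftrightarrow> insert z (f ` (T \<inter> X) \<union> \<zeta> ` (T - X)) \<in> E'"
      by (rule sep_resp_edge[OF sepI.hyps(3,2,6) z vz sepI.hyps(8,9) z1 stable])
    ultimately show False using sepI.hyps(7) by simp
  qed
qed

lemma resp_twins:
  assumes "resp (k - 1) a z" "resp (k - 1) a' z" "a \<in> V - X" "a' \<in> V - X" "z \<in> V'"
  shows "twins E a a'"
proof -
  have "\<not> sep V E k X (k - 1) a a'" using sep_resp[of "k - 1" a a'] assms(1,2,5) by auto
  then show ?thesis using base[OF assms(3,4)] by simp
qed

text \<open>This assigns to \<open>z\<close> a class rather than a vertex: Duplicator may have
  answered with any twin of \<open>a\<close>. By \<open>twin_resp_unique\<close> the class is
  determined by \<open>z\<close>.\<close>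

definition twin_resp :: "'a \<Rightarrow> 'b \<Rightarrow> bool" where
  "twin_resp a z \<longleftrightarrow> a \<in> V - X \<and> z \<in> V' - f ` X \<and> (\<exists>a'\<in>V - X. twins E a a' \<and> resp (k - 1) a' z)"

lemma twin_resp_unique: "twin_resp a z \<Longrightarrow> twin_resp b z \<Longrightarrow> twins E a b"
proof -
  assume "twin_resp a z" "twin_resp b z"
  then obtain a' b' where "a' \<in> V - X" "twins E a a'" "resp (k - 1) a' z"
    "b' \<in> V - X" "twins E b b'" "resp (k - 1) b' z" "z \<in> V'"
    unfolding twin_resp_def by blast
  note * = this
  have "twins E a' b'" by (rule resp_twins[OF *(3,6,1,4,7)])
  moreover have "twins E b' b" using *(5) twins_sym[of E b b'] by simp
  ultimately have "twins E a' b" by (rule twins_trans)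
  with *(2) show "twins E a b" by (rule twins_trans)
qed

lemma twin_resp_twins: "twin_resp a z \<Longrightarrow> twins E a b \<Longrightarrow> b \<in> V - X \<Longrightarrow> twin_resp b z"
proof -
  assume a: "twin_resp a z" "twins E a b" "b \<in> V - X"
  obtain a' where a': "a' \<in> V - X" "twins E a a'" "resp (k - 1) a' z"
    using a(1) unfolding twin_resp_def by blast
  have "twins E b a" using a(2) twins_sym[of E a b] by simp
  then have "twins E b a'" using a'(2) by (rule twins_trans)
  then have "\<exists>a'\<in>V - X. twins E b a' \<and> resp (k - 1) a' z" using a'(1,3) by blast
  then show "twin_resp b z" using a(1,3) unfolding twin_resp_def by simp
qed

lemma twin_resp_moves:
  assumes zs: "set zs \<subseteq> V' - f ` X" "distinct zs" "length zs + (k - 1) \<le> r"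
  obtains bs where "length bs = length zs" "set bs \<subseteq> V - X" "distinct bs"
    "agree k G M (xs @ bs) (map f xs @ zs)"
    "\<And>h. h < length zs \<Longrightarrow> twin_resp (bs ! h) (zs ! h)"
proof -
  have "simU k G M (length zs + (r - length zs)) xs (map f xs)"
    using simE_simU[OF sim] zs(3) by simp
  moreover have "set zs \<subseteq> univ M" using zs(1) by auto
  ultimately obtain bs where bs: "length bs = length zs" "set bs \<subseteq> univ G"
    "simU k G M (r - length zs) (xs @ bs) (map f xs @ zs)"
    using simU_moves by blast
  have sU: "simU k G M (k - 1) (xs @ bs) (map f xs @ zs)"
    using simU_mono[OF bs(3) ne'] zs(3) by simp
  have ag: "agree k G M (xs @ bs) (map f xs @ zs)" by (rule simU_agree[OF sU ne'])
  have "distinct (map f xs)" using xs inj_f by (simp add: distinct_map)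
  then have "distinct (map f xs @ zs)" using zs xs by auto
  then have d: "distinct (xs @ bs)" using agree_distinct[OF ag] by blast
  then have bX: "set bs \<subseteq> V - X" using bs(2) xs(2) by auto
  have "twin_resp (bs ! h) (zs ! h)" if h: "h < length zs" for h
  proof -
    have "bs ! h \<in> V - X" "zs ! h \<in> V' - f ` X"
      by (rule subsetD[OF bX nth_mem], use h bs(1) in simp, rule subsetD[OF zs(1) nth_mem[OF h]])
    then show ?thesis unfolding twin_resp_def using pick[OF sU h] twins_refl[of E "bs ! h"] by blast
  qed
  then show thesis using that[OF bs(1) bX _ ag] d by simp
qed

lemma twin_resp_ex:
  assumes "z \<in> V' - f ` X"
  shows "\<exists>a. twin_resp a z"
proof -
  have 1: "length [z] + (k - 1) \<le> r" using r k by simp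
  have 2: "set [z] \<subseteq> V' - f ` X" "distinct [z]" using assms by simp_all
  show ?thesis
  proof (rule twin_resp_moves[OF 2 1])
    fix bs assume "\<And>h. h < length [z] \<Longrightarrow> twin_resp (bs ! h) ([z] ! h)"
    from this[of 0] show ?thesis by auto
  qed
qed

text \<open>The bound \<open>2 * k - 1 \<le> r\<close> is used in full: at most \<open>k\<close>
  moves at the images of \<open>B - X\<close>, and \<open>k - 1\<close> rounds to recognise the
  replies. The replies are twins of the vertices of \<open>B\<close>, so \<open>twins_image\<close>
  transports the edge test back to \<open>B\<close>.\<close>

lemma twin_resp_edge:
  assumes B: "B \<subseteq> V" and gf: "\<And>b. b \<in> B \<inter> X \<Longrightarrow> g b = f b"
    and gr: "\<And>b. b \<in> B - X \<Longrightarrow> twin_resp b (g b)" and inj: "inj_on g (B - X)"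
  shows "B \<in> E \<longleftrightarrow> g ` B \<in> E'"
proof -
  have gX: "g b \<in> V' - f ` X" if "b \<in> B - X" for b using gr[OF that] by (simp add: twin_resp_def)
  have injB: "inj_on g B"
  proof (rule inj_onI)
    fix b c assume bc: "b \<in> B" "c \<in> B" "g b = g c"
    have 1: "g y \<in> f ` X \<longleftrightarrow> y \<in> X" if "y \<in> B" for y
    proof (cases "y \<in> X")
      case True
      then show ?thesis using gf[of y] that by auto
    next
      case False
      then show ?thesis using gX[of y] that by auto
    qed
    have "b \<in> X \<longleftrightarrow> c \<in> X" using 1 bc by metis
    then show "b = c"
      using bc inj inj_f gf[of b] gf[of c] by (cases "b \<in> X") (auto simp: inj_on_def)
  qed
  show ?thesis
  proof (cases "card B = k")
    case False
    then show ?thesis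
      using kgraph_edge[OF gV, of B] kgraph_edge[OF gV', of "g ` B"] card_image[OF injB] by auto
  next
    case True
    have finB: "finite B" using B fin finite_subset by blast
    obtain cs where cs: "distinct cs" "set cs = B - X"
      using finB finite_distinct_list[of "B - X"] by blast
    have "length cs \<le> k"
      using True distinct_card[OF cs(1)] cs(2) card_mono[OF finB, of "B - X"] by simp
    then have len: "length (map g cs) + (k - 1) \<le> r" using r k by simp
    have gcs: "set (map g cs) \<subseteq> V' - f ` X" "distinct (map g cs)"
      using gX cs inj by (auto simp: distinct_map)
    obtain bs where bs: "length bs = length (map g cs)" "set bs \<subseteq> V - X" "distinct bs"
      "agree k G M (xs @ bs) (map f xs @ map g cs)"
      "\<And>h. h < length (map g cs) \<Longrightarrow> twin_resp (bs ! h) (map g cs ! h)"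
      by (rule twin_resp_moves[OF gcs len]) (rule that, assumption+)
    obtain \<beta> where \<beta>: "bs = map \<beta> cs" using ex_map_list[OF cs(1)] bs(1) by auto
    have tw: "twins E c (\<beta> c)" if c: "c \<in> B - X" for c
    proof -
      have "c \<in> set cs" using c cs(2) by simp
      then obtain h where "h < length cs" "cs ! h = c" unfolding in_set_conv_nth by (elim exE conjE)
      then have "twin_resp (\<beta> c) (g c)" using bs(5)[of h] by (simp add: \<beta>)
      then show ?thesis using twin_resp_unique[OF gr[OF c]] by blast
    qed
    define p where "p y = (if y \<in> X then y else \<beta> y)" for y
    define q where "q y = (if y \<in> X then f y else g y)" for y
    have "map p (xs @ cs) = xs @ bs" "map q (xs @ cs) = map f xs @ map g cs"
      using xs(2) cs(2) by (auto simp: p_def q_def \<beta> intro: map_idI)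
    then have ag: "agree k G M (map p (xs @ cs)) (map q (xs @ cs))" using bs(4) by (simp only:)
    have \<beta>i: "inj_on \<beta> (B - X)" "\<beta> ` (B - X) \<subseteq> V - X"
      using bs(2,3) cs by (auto simp: \<beta> distinct_map)
    have "inj_on p (set (xs @ cs))"
    proof (rule inj_onI)
      fix c d assume cd: "c \<in> set (xs @ cs)" "d \<in> set (xs @ cs)" "p c = p d"
      have 1: "p y \<in> X \<longleftrightarrow> y \<in> X" if "y \<in> set (xs @ cs)" for y
        using that xs(2) cs(2) \<beta>i(2) by (auto simp: p_def)
      have "c \<in> X \<longleftrightarrow> d \<in> X" using 1 cd by metis
      then show "c = d" using cd xs(2) cs(2) \<beta>i(1) by (auto simp: p_def inj_on_def)
    qed
    moreover have "B \<subseteq> set (xs @ cs)" using xs(2) cs(2) by auto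
    ultimately have "p ` B \<in> E \<longleftrightarrow> q ` B \<in> E'" by (rule edge_agree[OF gV gV' ag])
    moreover have "q ` B = g ` B" by (intro image_cong) (auto simp: q_def gf)
    moreover have "p ` B = (B \<inter> X) \<union> \<beta> ` (B - X)" by (auto simp: p_def)
    moreover have "(B \<inter> X) \<union> (B - X) \<in> E \<longleftrightarrow> (B \<inter> X) \<union> \<beta> ` (B - X) \<in> E"
      using finB \<beta>i tw by (intro twins_image) auto
    moreover have "(B \<inter> X) \<union> (B - X) = B" by auto
    ultimately show ?thesis by (simp only:)
  qed
qed

definition base_class :: "'a \<Rightarrow> 'a set" where
  "base_class a = {b \<in> V - X. twins E a b}"

definition image_class :: "'a \<Rightarrow> 'b set" where
  "image_class a = {z. twin_resp a z}"

lemma finite_base_class: "finite (base_class a)" "finite (image_class a)"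
  using fin by (auto simp: base_class_def image_class_def twin_resp_def)

text \<open>Spoiler plays one vertex too many in the image class. These
  \<open>card (base_class a) + 1\<close> moves and the \<open>k - 1\<close> recognising rounds are
  the \<open>k\<close> in the hypothesis.\<close>

lemma base_class_upper:
  assumes a: "a \<in> V - X" and c: "card (base_class a) + k \<le> r"
  shows "card (image_class a) \<le> card (base_class a)"
proof (rule ccontr)
  assume "\<not> ?thesis"
  then have "Suc (card (base_class a)) \<le> card (image_class a)" by simp
  then obtain Q where Q: "Q \<subseteq> image_class a" "card Q = Suc (card (base_class a))"
    by (rule obtain_subset_with_card_n)
  then have "finite Q" using finite_base_class finite_subset by blast
  then obtain zs where zs: "set zs = Q" "distinct zs" using finite_distinct_list by blast
  have len: "length zs + (k - 1) \<le> r" using zs Q(2) distinct_card[OF zs(2)] c k by simp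
  have "set zs \<subseteq> V' - f ` X" using zs Q by (auto simp: image_class_def twin_resp_def)
  then obtain bs where bs: "length bs = length zs" "set bs \<subseteq> V - X" "distinct bs"
    "agree k G M (xs @ bs) (map f xs @ zs)"
    "\<And>h. h < length zs \<Longrightarrow> twin_resp (bs ! h) (zs ! h)"
    by (rule twin_resp_moves[OF _ zs(2) len]) (rule that, assumption+)
  have "set bs \<subseteq> base_class a"
  proof
    fix b assume b: "b \<in> set bs"
    then obtain h where h: "h < length bs" "bs ! h = b" by (auto simp: in_set_conv_nth)
    then have "zs ! h \<in> image_class a" using zs(1) Q(1) bs(1) nth_mem[of h zs] by auto
    then have "twin_resp a (zs ! h)" by (simp add: image_class_def)
    moreover have "twin_resp b (zs ! h)" using bs(5)[of h] h bs(1) by simp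
    ultimately show "b \<in> base_class a" using twin_resp_unique b bs(2) by (auto simp: base_class_def)
  qed
  then have "card (set bs) \<le> card (base_class a)" using card_mono finite_base_class by blast
  then show False using distinct_card[OF bs(3)] bs(1) distinct_card[OF zs(2)] zs(1) Q(2) by simp
qed

text \<open>Here Spoiler still moves in \<open>G\<close> and plays \<open>A\<close> itself. A subset
  suffices, so a large class can be shown to have at least \<open>k\<close> counterparts without
  being exhausted.\<close>

lemma base_class_lower:
  assumes A: "A \<subseteq> base_class a" and a: "a \<in> V - X" and c: "card A + (k - 1) \<le> r"
  shows "card A \<le> card (image_class a)"
proof -
  have "finite A" using A finite_base_class finite_subset by blast
  then obtain cs where cs: "set cs = A" "distinct cs" using finite_distinct_list by blast
  have lc: "length cs + (k - 1) \<le> r" using cs c distinct_card[OF cs(2)] by simp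
  then have "simE k G M (length cs + (r - length cs)) xs (map f xs)" using sim by simp
  moreover have csV: "set cs \<subseteq> V - X" using cs A by (auto simp: base_class_def)
  then have "set cs \<subseteq> univ G" by auto
  ultimately obtain bs where bs: "length bs = length cs" "set bs \<subseteq> univ M"
    "simE k G M (r - length cs) (xs @ cs) (map f xs @ bs)"
    using simE_moves by blast
  have sU: "simU k G M (k - 1) (xs @ cs) (map f xs @ bs)"
    using simU_mono[OF simE_simU[OF bs(3)] ne'] lc by simp
  have "distinct (xs @ cs)" using xs cs(2) csV by auto
  then have d: "distinct (map f xs @ bs)"
    using agree_distinct[OF simU_agree[OF sU ne']] by blast
  have "set bs \<subseteq> image_class a"
  proof
    fix z assume z: "z \<in> set bs"
    then obtain h where h: "h < length bs" "bs ! h = z" by (auto simp: in_set_conv_nth)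
    then have "cs ! h \<in> base_class a" using cs(1) A bs(1) nth_mem[of h cs] by auto
    moreover have "resp (k - 1) (cs ! h) z" using pick[OF sU h(1)] h by simp
    ultimately show "z \<in> image_class a"
      using a z bs(2) d xs(2) by (auto simp: image_class_def twin_resp_def base_class_def)
  qed
  then have "card (set bs) \<le> card (image_class a)" using card_mono finite_base_class by blast
  then show ?thesis using d distinct_card[of bs] bs(1) distinct_card[OF cs(2)] cs(1) by simp
qed

end

section \<open>Hypergraphs that differ in the size of one similarity class\<close>

text \<open>Outside \<open>C\<close> and \<open>C'\<close> the map \<open>F\<close> is a matching,
  and inside only the number of vertices matters; \<open>C\<close> and \<open>C'\<close> may differ
  in size. The upper bound uses it for the one class not counted exactly, the lower bound for the
  enlarged class.\<close>

definition resized :: "'a set \<Rightarrow> 'a set set \<Rightarrow> 'a set \<Rightarrow> 'b set \<Rightarrow> 'b set set \<Rightarrow> 'b set \<Rightarrow> ('a \<Rightarrow> 'b) \<Rightarrow> bool" where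
  "resized V E C V' E' C' F \<longleftrightarrow> C \<subseteq> V \<and> C' \<subseteq> V' \<and> bij_betw F (V - C) (V' - C') \<and>
     (\<forall>A B B'. A \<subseteq> V - C \<longrightarrow> B \<subseteq> C \<longrightarrow> B' \<subseteq> C' \<longrightarrow> card B = card B' \<longrightarrow>
        (A \<union> B \<in> E \<longleftrightarrow> F ` A \<union> B' \<in> E'))"

lemma resizedD:
  assumes "resized V E C V' E' C' F" "A \<subseteq> V - C" "B \<subseteq> C" "B' \<subseteq> C'" "card B = card B'"
  shows "A \<union> B \<in> E \<longleftrightarrow> F ` A \<union> B' \<in> E'"
  using assms unfolding resized_def by blast

lemma resized_sym:
  assumes r: "resized V E C V' E' C' F"
  shows "resized V' E' C' V E C (inv_into (V - C) F)"
proof -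
  let ?F = "inv_into (V - C) F"
  have bij: "bij_betw F (V - C) (V' - C')" using r by (simp add: resized_def)
  have "A' \<union> B' \<in> E' \<longleftrightarrow> ?F ` A' \<union> B \<in> E"
    if h: "A' \<subseteq> V' - C'" "B' \<subseteq> C'" "B \<subseteq> C" "card B' = card B" for A' B' B
  proof -
    have A': "A' \<subseteq> F ` (V - C)" using h(1) bij by (simp add: bij_betw_def)
    have "?F ` A' \<subseteq> V - C" using A' inv_into_into[of _ F "V - C"] by blast
    moreover have "F ` (?F ` A') = A'" by (rule image_inv_into_cancel[OF refl A'])
    ultimately show ?thesis using resizedD[OF r _ h(3,2) h(4)[symmetric], of "?F ` A'"] by simp
  qed
  then show ?thesis
    using r bij_betw_inv_into[OF bij] unfolding resized_def by simp
qed

lemma kgraph_insert: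
  assumes "kgraph k V E" "k \<ge> 1" "u \<notin> T" "insert u T \<in> E"
  shows "T \<subseteq> V \<and> finite T \<and> card T = k - 1"
  using kgraph_edge[OF assms(1,4)] assms(3) by auto

lemma resized_split:
  assumes r: "resized V E C V' E' C' F" and fin: "finite C'" and T: "T' \<subseteq> V'" "card (T' \<inter> C') < card C"
  obtains A B c where "A \<subseteq> V - C" "B \<subseteq> C" "c \<in> C - B" "card B = card (T' \<inter> C')"
    "T' = F ` A \<union> (T' \<inter> C')"
proof -
  have bij: "bij_betw F (V - C) (V' - C')" using r by (simp add: resized_def)
  define A where "A = {a \<in> V - C. F a \<in> T'}"
  obtain B where B: "B \<subseteq> C" "card B = card (T' \<inter> C')"
    by (rule obtain_subset_with_card_n[OF less_imp_le[OF T(2)]])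
  have "B \<noteq> C" using B T(2) by auto
  then obtain c where c: "c \<in> C - B" using B(1) by blast
  have "T' = F ` A \<union> (T' \<inter> C')"
  proof (intro equalityI subsetI)
    fix x assume x: "x \<in> T'"
    show "x \<in> F ` A \<union> (T' \<inter> C')"
    proof (cases "x \<in> C'")
      case False
      then have "x \<in> F ` (V - C)" using x T(1) bij_betw_imp_surj_on[OF bij] by blast
      then show ?thesis using x unfolding A_def by blast
    qed (use x in simp)
  next
    fix x assume "x \<in> F ` A \<union> (T' \<inter> C')"
    then show "x \<in> T'" unfolding A_def by blast
  qed
  moreover have "A \<subseteq> V - C" by (auto simp: A_def)
  ultimately show thesis using B c by (intro that)
qed

context
  fixes k :: nat and V :: "'a set" and E C and V' :: "'b set" and E' C' F
  assumes k: "k \<ge> 1" and g: "kgraph k V E" "kgraph k V' E'"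
    and r: "resized V E C V' E' C' F" and C: "k \<le> card C"
begin

text \<open>A relevant \<open>T'\<close> has \<open>k - 1\<close> vertices, so its part in
  \<open>C'\<close> can be mirrored in \<open>C\<close> with a vertex \<open>c\<close> to spare, as
  \<open>k \<le> card C\<close>. The spare vertex stands for a vertex of \<open>C'\<close> that is
  to be exchanged.\<close>

lemma resized_twinsI:
  assumes "\<And>A B c B'. A \<subseteq> V - C \<Longrightarrow> B \<subseteq> C \<Longrightarrow> c \<in> C - B \<Longrightarrow> B' \<subseteq> C' \<Longrightarrow> card B = card B' \<Longrightarrow>
      finite B \<Longrightarrow> finite B' \<Longrightarrow> u' \<notin> F ` A \<union> B' \<Longrightarrow> v' \<notin> F ` A \<union> B' \<Longrightarrow>
      insert u' (F ` A \<union> B') \<in> E' \<longleftrightarrow> insert v' (F ` A \<union> B') \<in> E'"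
  shows "twins E' u' v'"
  unfolding twins_def
proof (intro allI impI)
  fix T' assume T: "u' \<notin> T' \<and> v' \<notin> T'"
  show "insert u' T' \<in> E' \<longleftrightarrow> insert v' T' \<in> E'"
  proof (cases "T' \<subseteq> V' \<and> finite T' \<and> card T' = k - 1")
    case False
    then have "insert u' T' \<notin> E'" "insert v' T' \<notin> E'"
      using kgraph_insert[OF g(2) k] T by blast+
    then show ?thesis by simp
  next
    case True
    have "C' \<subseteq> V'" "C \<subseteq> V" "finite V" "finite V'" using r g by (simp_all add: resized_def kgraph_def)
    then have finC: "finite C'" "finite C" using finite_subset by auto
    have "card (T' \<inter> C') \<le> card T'" using True by (intro card_mono) auto
    then have lt: "card (T' \<inter> C') < card C" using True C k by simp
    have TV: "T' \<subseteq> V'" using True by simp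
    obtain A B c where A: "A \<subseteq> V - C" "B \<subseteq> C" "c \<in> C - B" "card B = card (T' \<inter> C')"
      "T' = F ` A \<union> (T' \<inter> C')"
      by (rule resized_split[OF r finC(1) TV lt])
    have "finite B" using A(2) finC(2) by (rule finite_subset)
    moreover have "u' \<notin> F ` A \<union> (T' \<inter> C')" "v' \<notin> F ` A \<union> (T' \<inter> C')"
      using T by (simp_all only: A(5)[symmetric]) simp_all
    ultimately have "insert u' (F ` A \<union> (T' \<inter> C')) \<in> E' \<longleftrightarrow> insert v' (F ` A \<union> (T' \<inter> C')) \<in> E'"
      using finC(1) by (intro assms[OF A(1-3) _ A(4)]) simp_all
    then show ?thesis by (simp only: A(5)[symmetric])
  qed
qed

lemma resized_twins:
  assumes uv: "u \<in> V - C" "v \<in> V - C" "twins E u v"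
  shows "twins E' (F u) (F v)"
proof (rule resized_twinsI)
  fix A B c B'
  assume h: "A \<subseteq> V - C" "B \<subseteq> C" "c \<in> C - B" "B' \<subseteq> C'" "card B = card B'"
    "F u \<notin> F ` A \<union> B'" "F v \<notin> F ` A \<union> B'"
  have "u \<notin> A \<union> B" "v \<notin> A \<union> B" using h(2,6,7) uv(1,2) by blast+
  then have "insert u (A \<union> B) \<in> E \<longleftrightarrow> insert v (A \<union> B) \<in> E"
    using uv(3) by (simp add: twins_def)
  moreover have "insert w A \<union> B \<in> E \<longleftrightarrow> F ` insert w A \<union> B' \<in> E'" if "w \<in> V - C" for w
    by (rule resizedD[OF r _ h(2,4,5)]) (use h(1) that in simp)
  ultimately show "insert (F u) (F ` A \<union> B') \<in> E' \<longleftrightarrow> insert (F v) (F ` A \<union> B') \<in> E'"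
    using uv(1,2) by simp
qed

lemma resized_twins_class:
  assumes "u \<in> V - C" "\<And>c. c \<in> C \<Longrightarrow> twins E u c" "c' \<in> C'"
  shows "twins E' (F u) c'"
proof (rule resized_twinsI)
  fix A B c B'
  assume h: "A \<subseteq> V - C" "B \<subseteq> C" "c \<in> C - B" "B' \<subseteq> C'" "card B = card B'" "finite B" "finite B'"
    "F u \<notin> F ` A \<union> B'" "c' \<notin> F ` A \<union> B'"
  have "u \<notin> A \<union> B" "c \<notin> A \<union> B" using h(1-3,8) assms(1) by blast+
  then have "insert u (A \<union> B) \<in> E \<longleftrightarrow> insert c (A \<union> B) \<in> E"
    using assms(2)[of c] h(3) by (simp add: twins_def)
  moreover have "insert u A \<union> B \<in> E \<longleftrightarrow> F ` insert u A \<union> B' \<in> E'"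
    by (rule resizedD[OF r _ h(2,4,5)]) (use h(1) assms(1) in simp)
  moreover have "A \<union> insert c B \<in> E \<longleftrightarrow> F ` A \<union> insert c' B' \<in> E'"
  proof (rule resizedD[OF r h(1)])
    show "insert c B \<subseteq> C" "insert c' B' \<subseteq> C'" using h(2-4) assms(3) by auto
    show "card (insert c B) = card (insert c' B')" using h(3,5-7,9) by simp
  qed
  ultimately show "insert (F u) (F ` A \<union> B') \<in> E' \<longleftrightarrow> insert c' (F ` A \<union> B') \<in> E'"
    by simp
qed

lemma resized_class_twins:
  assumes "c1 \<in> C'" "c2 \<in> C'"
  shows "twins E' c1 c2"
proof (rule resized_twinsI)
  fix A B c B'
  assume h: "A \<subseteq> V - C" "B \<subseteq> C" "c \<in> C - B" "B' \<subseteq> C'" "card B = card B'" "finite B" "finite B'"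
    "c1 \<notin> F ` A \<union> B'" "c2 \<notin> F ` A \<union> B'"
  have "A \<union> insert c B \<in> E \<longleftrightarrow> F ` A \<union> insert c1 B' \<in> E'"
  proof (rule resizedD[OF r h(1)])
    show "insert c B \<subseteq> C" "insert c1 B' \<subseteq> C'" using h(2-4) assms by auto
    show "card (insert c B) = card (insert c1 B')" using h(3,5-9) by simp
  qed
  moreover have "A \<union> insert c B \<in> E \<longleftrightarrow> F ` A \<union> insert c2 B' \<in> E'"
  proof (rule resizedD[OF r h(1)])
    show "insert c B \<subseteq> C" "insert c2 B' \<subseteq> C'" using h(2-4) assms by auto
    show "card (insert c B) = card (insert c2 B')" using h(3,5-9) by simp
  qed
  ultimately show "insert c1 (F ` A \<union> B') \<in> E' \<longleftrightarrow> insert c2 (F ` A \<union> B') \<in> E'"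
    by simp
qed

end

section \<open>Recognising twins in the game, and counting large similarity classes\<close>

lemma edge_agree_list:
  assumes "kgraph k V E" "kgraph k V' E'"
    and "agree k (kgraph_struct k V E) (kgraph_struct k V' E') s t" "distinct s"
  shows "set s \<in> E \<longleftrightarrow> set t \<in> E'"
proof -
  have len: "length s = length t" using agree_length assms(3) .
  have m: "map ((!) s) [0..<length s] = s" "map ((!) t) [0..<length s] = t"
    using len map_nth by metis+
  have "(!) s ` set [0..<length s] \<in> E \<longleftrightarrow> (!) t ` set [0..<length s] \<in> E'"
    using assms m by (intro edge_agree[OF assms(1,2), where L = "[0..<length s]"])
      (auto intro: inj_on_nth)
  then show ?thesis using m by (metis set_map)
qed

lemma agree_pick2:
  assumes "agree k G M (s @ as) (t @ bs)" "length s = length t" "h < length s"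
  shows "agree k G M ((s ! h) # as) ((t ! h) # bs)"
proof -
  have l: "length as = length bs" using agree_length[OF assms(1)] assms(2) by simp
  have "agree k G M (map ((!) (s @ as)) (h # [length s..<length s + length as]))
      (map ((!) (t @ bs)) (h # [length s..<length s + length as]))"
    by (rule agree_select[OF assms(1)]) (use assms(3) in auto)
  moreover have "map ((!) (s @ as)) (h # [length s..<length s + length as]) = (s ! h) # as"
    using assms(3) by (auto intro!: nth_equalityI simp: nth_append nth_Cons split: nat.splits)
  moreover have "map ((!) (t @ bs)) (h # [length s..<length s + length as]) = (t ! h) # bs"
    using assms(2,3) l by (auto intro!: nth_equalityI simp: nth_append nth_Cons split: nat.splits)
  ultimately show ?thesis by (simp only:)
qed

lemma not_twinsE:
  assumes "\<not> twins E u v" "kgraph k V E" "k \<ge> 1"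
  obtains ts where "distinct ts" "set ts \<subseteq> V" "length ts = k - 1" "u \<notin> set ts" "v \<notin> set ts"
    "(insert u (set ts) \<in> E) \<noteq> (insert v (set ts) \<in> E)"
proof -
  obtain T where T: "u \<notin> T" "v \<notin> T" "(insert u T \<in> E) \<noteq> (insert v T \<in> E)"
    using assms(1) unfolding twins_def by blast
  then have "insert u T \<in> E \<or> insert v T \<in> E" by auto
  then have "T \<subseteq> V \<and> finite T \<and> card T = k - 1"
    using kgraph_insert[OF assms(2,3), of u T] kgraph_insert[OF assms(2,3), of v T] T(1,2) by blast
  moreover from this obtain ts where "set ts = T" "distinct ts" using finite_distinct_list by blast
  ultimately show thesis using that[of ts] T distinct_card[of ts] by simp
qed

text \<open>If the pebbled vertices in \<open>M\<close> were not twins, Spoiler would play the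
  \<open>k - 1\<close> vertices of a witness in \<open>M\<close>, and the replies would be a witness
  in \<open>G\<close>.\<close>

lemma simU_twins:
  assumes g: "kgraph k V E" "kgraph k V' E'" and k: "k \<ge> 1" and ne: "V' \<noteq> {}"
    and sim: "simU k (kgraph_struct k V E) (kgraph_struct k V' E') r s t" "k - 1 \<le> r"
    and pq: "p < length s" "q < length s" and tw: "twins E (s ! p) (s ! q)"
  shows "twins E' (t ! p) (t ! q)"
proof (rule ccontr)
  let ?G = "kgraph_struct k V E" and ?M = "kgraph_struct k V' E'"
  have ne': "univ ?M \<noteq> {}" using ne by simp
  assume "\<not> ?thesis"
  then obtain ts where ts: "distinct ts" "set ts \<subseteq> V'" "length ts = k - 1"
    "t ! p \<notin> set ts" "t ! q \<notin> set ts" "(insert (t ! p) (set ts) \<in> E') \<noteq> (insert (t ! q) (set ts) \<in> E')"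
    by (rule not_twinsE[OF _ g(2) k])
  have "simU k ?G ?M (length ts + 0) s t" using simU_mono[OF sim(1) ne' sim(2)] ts(3) by simp
  moreover have "set ts \<subseteq> univ ?M" using ts(2) by simp
  ultimately obtain as where as: "length as = length ts" "simU k ?G ?M 0 (s @ as) (t @ ts)"
    using simU_moves by blast
  then have ag: "agree k ?G ?M (s @ as) (t @ ts)" by simp
  have len: "length s = length t" using agree_length[OF ag] as(1) by simp
  have key: "s ! h \<notin> set as \<and> (insert (s ! h) (set as) \<in> E \<longleftrightarrow> insert (t ! h) (set ts) \<in> E')"
    if h: "h < length s" "t ! h \<notin> set ts" for h
  proof -
    have a: "agree k ?G ?M ((s ! h) # as) ((t ! h) # ts)" by (rule agree_pick2[OF ag len h(1)])
    have d: "distinct ((s ! h) # as)" using agree_distinct[OF a] ts(1) h(2) by simp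
    then show ?thesis using edge_agree_list[OF g a d] by simp
  qed
  then show False using key[OF pq(1) ts(4)] key[OF pq(2) ts(5)] tw ts(6) unfolding twins_def by blast
qed

text \<open>The converse transfer plays the witness in \<open>G\<close>, which is possible only
  before the switch; hence \<open>simE\<close> instead of \<open>simU\<close>.\<close>

lemma simE_twins:
  assumes g: "kgraph k V E" "kgraph k V' E'" and k: "k \<ge> 1" and ne: "V' \<noteq> {}"
    and sim: "simE k (kgraph_struct k V E) (kgraph_struct k V' E') r s t" "k - 1 \<le> r"
    and pq: "p < length s" "q < length s" and tw: "twins E' (t ! p) (t ! q)"
  shows "twins E (s ! p) (s ! q)"
proof (rule ccontr)
  let ?G = "kgraph_struct k V E" and ?M = "kgraph_struct k V' E'"
  have ne': "univ ?M \<noteq> {}" using ne by simp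
  assume "\<not> ?thesis"
  then obtain ts where ts: "distinct ts" "set ts \<subseteq> V" "length ts = k - 1"
    "s ! p \<notin> set ts" "s ! q \<notin> set ts" "(insert (s ! p) (set ts) \<in> E) \<noteq> (insert (s ! q) (set ts) \<in> E)"
    by (rule not_twinsE[OF _ g(1) k])
  have "simE k ?G ?M (length ts + 0) s t" using simE_mono[OF sim(1) ne' sim(2)] ts(3) by simp
  moreover have "set ts \<subseteq> univ ?G" using ts(2) by simp
  ultimately obtain as where as: "length as = length ts" "simE k ?G ?M 0 (s @ ts) (t @ as)"
    using simE_moves by blast
  then have ag: "agree k ?G ?M (s @ ts) (t @ as)" by simp
  have len: "length s = length t" using agree_length[OF ag] as(1) by simp
  have key: "t ! h \<notin> set as \<and> (insert (s ! h) (set ts) \<in> E \<longleftrightarrow> insert (t ! h) (set as) \<in> E')"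
    if h: "h < length s" "s ! h \<notin> set ts" for h
  proof -
    have a: "agree k ?G ?M ((s ! h) # ts) ((t ! h) # as)" by (rule agree_pick2[OF ag len h(1)])
    have d: "distinct ((s ! h) # ts)" using ts(1) h(2) by simp
    then show ?thesis using edge_agree_list[OF g a d] agree_distinct[OF a] by simp
  qed
  then show False using key[OF pq(1) ts(4)] key[OF pq(2) ts(5)] tw ts(6) unfolding twins_def by blast
qed

definition twin_class :: "'a set \<Rightarrow> 'a set set \<Rightarrow> 'a \<Rightarrow> 'a set" where
  "twin_class V E u = {v \<in> V. twins E u v}"

lemma twin_class_eq: "twins E u v \<Longrightarrow> twin_class V E u = twin_class V E v"
proof -
  assume t: "twins E u v"
  then have "twins E v u" by (simp add: twins_sym[of E v u])
  then have "twins E u w \<longleftrightarrow> twins E v w" for w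
    using t twins_trans[of E u v w] twins_trans[of E v u w] by blast
  then show ?thesis by (simp add: twin_class_def)
qed

lemma twin_class_self: "u \<in> V \<Longrightarrow> u \<in> twin_class V E u"
  by (simp add: twin_class_def)

text \<open>The rounds are spent as follows: \<open>card J + 1\<close> vertices from different large
  classes of \<open>V2\<close>, then \<open>s\<close> twins of one of them, then
  \<open>k - 1\<close> to refute a reply that is no twin. The number \<open>s\<close> is the size of
  the whole similarity class of \<open>c1\<close>, which may be larger than
  \<open>C1\<close>.\<close>

lemma resize_false:
  fixes V1 :: "'a set" and V2 :: "'b set"
  assumes k: "k \<ge> 1" and g1: "kgraph k V1 E1" and g2: "kgraph k V2 E2"
    and r: "resized V1 E1 C1 V2 E2 C2 F" and C: "k \<le> card C1" "card C1 < card C2"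
    and tw: "\<And>u v. u \<in> C1 \<Longrightarrow> v \<in> C1 \<Longrightarrow> twins E1 u v" and c1: "c1 \<in> C1"
    and sim: "simE k (kgraph_struct k V2 E2) (kgraph_struct k V1 E1) R [] []"
    and s: "s = card (twin_class V1 E1 c1)"
    and J: "J = {Q \<in> twin_class V1 E1 ` V1. s < card Q}" and le: "card J + s + k \<le> R"
  shows False
proof -
  let ?G = "kgraph_struct k V2 E2" and ?M = "kgraph_struct k V1 E1"
  have CV: "C1 \<subseteq> V1" "C2 \<subseteq> V2" and bij: "bij_betw F (V1 - C1) (V2 - C2)"
    using r by (simp_all add: resized_def)
  have c1V: "c1 \<in> V1" using c1 CV by blast
  then have ne: "V1 \<noteq> {}" by blast
  have ne': "univ ?M \<noteq> {}" using ne by simp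
  have fin: "finite V1" "finite V2" using g1 g2 by (simp_all add: kgraph_def)
  have finJ: "finite J" using fin by (simp add: J)
  have kC2: "k \<le> card C2" using C by simp
  have injF: "inj_on F (V1 - C1)" using bij by (simp add: bij_betw_def)
  note rs = resized_sym[OF r]
  have FV: "F u \<in> V2 - C2" if "u \<in> V1 - C1" for u
    using bij_betwE[OF bij] that by blast
  have GF: "inv_into (V1 - C1) F (F u) = u" if "u \<in> V1 - C1" for u
    by (rule bij_betw_inv_into_left[OF bij that])
  obtain c2 where c2: "c2 \<in> C2" using C by fastforce
  have back1: "twins E1 u v" if "u \<in> V1 - C1" "v \<in> V1 - C1" "twins E2 (F u) (F v)" for u v
    using resized_twins[OF k g2 g1 rs kC2 FV[OF that(1)] FV[OF that(2)] that(3)]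
    by (simp only: GF[OF that(1)] GF[OF that(2)])
  have tw2: "twins E2 c2 c" if "c \<in> C2" for c
    by (rule resized_class_twins[OF k g1 g2 r C(1) c2 that])
  have back2: "twins E1 u c1" if u: "u \<in> V1 - C1" "twins E2 (F u) c2" for u
    using resized_twins_class[OF k g2 g1 rs kC2 FV[OF u(1)] twins_trans[OF u(2) tw2] c1]
    by (simp only: GF[OF u(1)])
  have forth2: "twins E2 c2 (F u)" if u: "u \<in> V1 - C1" "twins E1 c1 u" for u
  proof -
    have "twins E1 u c" if "c \<in> C1" for c
      using twins_trans[of E1 u c1 c] tw[OF c1 that] u(2) twins_sym[of E1 u c1] by simp
    from resized_twins_class[OF k g1 g2 r C(1) u(1) this c2] show ?thesis
      by (simp add: twins_sym[of E2 c2])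
  qed
  define d where "d Q = (SOME u. u \<in> V1 \<and> twin_class V1 E1 u = Q)" for Q
  have d: "d Q \<in> V1" "twin_class V1 E1 (d Q) = Q" if "Q \<in> J" for Q
  proof -
    have "\<exists>u. u \<in> V1 \<and> twin_class V1 E1 u = Q" using that by (auto simp: J)
    from someI_ex[OF this] show "d Q \<in> V1" "twin_class V1 E1 (d Q) = Q" by (simp_all add: d_def)
  qed
  have notC: "u \<notin> C1" if Q: "Q \<in> J" and u: "u \<in> Q" for Q u
  proof
    assume "u \<in> C1"
    then have "twins E1 u c1" using tw c1 by blast
    moreover have "u \<in> twin_class V1 E1 (d Q)" using u d(2)[OF Q] by simp
    then have "twins E1 (d Q) u" by (simp add: twin_class_def)
    ultimately have "twins E1 (d Q) c1" by (blast intro: twins_trans)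
    then have "Q = twin_class V1 E1 c1" using twin_class_eq d(2)[OF Q] by metis
    then show False using Q s by (simp add: J)
  qed
  have QV: "Q \<subseteq> V1 - C1" if "Q \<in> J" for Q
    using notC[OF that] d(2)[OF that] unfolding twin_class_def by blast
  have dQ: "d Q \<in> Q" if "Q \<in> J" for Q
    using twin_class_self[OF d(1)[OF that], of E1] d(2)[OF that] by simp
  have dC: "d Q \<in> V1 - C1" if "Q \<in> J" for Q using dQ[OF that] QV[OF that] by blast
  define P where "P = insert c2 ((\<lambda>Q. F (d Q)) ` J)"
  have inj: "Q = Q'" if "Q \<in> J" "Q' \<in> J" "twins E2 (F (d Q)) (F (d Q'))" for Q Q'
    using twin_class_eq[OF back1[OF dC[OF that(1)] dC[OF that(2)] that(3)], of V1]
      d(2)[OF that(1)] d(2)[OF that(2)] by simp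
  have nc2: "\<not> twins E2 (F (d Q)) c2" if Q: "Q \<in> J" for Q
  proof
    assume "twins E2 (F (d Q)) c2"
    then have "twins E1 (d Q) c1" by (rule back2[OF dC[OF Q]])
    then have "Q = twin_class V1 E1 c1" using twin_class_eq[of E1 "d Q" c1 V1] d(2)[OF Q] by simp
    then show False using Q s by (simp add: J)
  qed
  have PV: "P \<subseteq> V2" using FV dC c2 CV(2) by (auto simp: P_def)
  have Ptw: "x = y" if xy: "x \<in> P" "y \<in> P" "twins E2 x y" for x y
  proof (cases "x = c2"; cases "y = c2")
    assume "x = c2" "y \<noteq> c2"
    then obtain Q where "Q \<in> J" "y = F (d Q)" using xy(2) by (auto simp: P_def)
    then show ?thesis using nc2[of Q] xy(3) \<open>x = c2\<close> twins_sym[of E2 x y] by simp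
  next
    assume "x \<noteq> c2" "y = c2"
    then obtain Q where "Q \<in> J" "x = F (d Q)" using xy(1) by (auto simp: P_def)
    then show ?thesis using nc2[of Q] xy(3) \<open>y = c2\<close> by simp
  next
    assume "x \<noteq> c2" "y \<noteq> c2"
    then obtain Q Q' where "Q \<in> J" "x = F (d Q)" "Q' \<in> J" "y = F (d Q')"
      using xy(1,2) by (auto simp: P_def)
    then show ?thesis using inj[of Q Q'] xy(3) by simp
  qed simp
  have cardP: "card P = Suc (card J)"
  proof -
    have "inj_on (\<lambda>Q. F (d Q)) J" by (rule inj_onI) (use inj in auto)
    then have "card ((\<lambda>Q. F (d Q)) ` J) = card J" by (rule card_image)
    moreover have "c2 \<notin> (\<lambda>Q. F (d Q)) ` J"
    proof
      assume "c2 \<in> (\<lambda>Q. F (d Q)) ` J"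
      then obtain Q where "Q \<in> J" "c2 = F (d Q)" by blast
      then show False using nc2[of Q] by simp
    qed
    then have "card P = Suc (card ((\<lambda>Q. F (d Q)) ` J))"
      unfolding P_def by (rule card_insert_disjoint[OF finite_imageI[OF finJ]])
    ultimately show ?thesis by simp
  qed
  have size: "s < card (twin_class V2 E2 x)" if x: "x \<in> P" for x
  proof (cases "x = c2")
    case False
    then obtain Q where Q: "Q \<in> J" "x = F (d Q)" using x by (auto simp: P_def)
    have "F ` Q \<subseteq> twin_class V2 E2 x"
    proof
      fix y assume "y \<in> F ` Q"
      then obtain u where u: "u \<in> Q" "y = F u" by blast
      have "u \<in> twin_class V1 E1 (d Q)" using u(1) d(2)[OF Q(1)] by simp
      then have "twins E1 (d Q) u" by (simp add: twin_class_def)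
      moreover have "u \<in> V1 - C1" using u(1) QV[OF Q(1)] by blast
      ultimately have "twins E2 (F (d Q)) (F u)" "F u \<in> V2 - C2"
        using resized_twins[OF k g1 g2 r C(1) dC[OF Q(1)]] FV by simp_all
      then show "y \<in> twin_class V2 E2 x" using u(2) Q(2) by (simp add: twin_class_def)
    qed
    then have "card (F ` Q) \<le> card (twin_class V2 E2 x)"
      using fin(2) by (intro card_mono) (auto simp: twin_class_def)
    moreover have "inj_on F Q" by (rule inj_on_subset[OF injF QV[OF Q(1)]])
    then have "card (F ` Q) = card Q" by (rule card_image)
    moreover have "s < card Q" using Q(1) by (simp add: J)
    ultimately show ?thesis by simp
  next
    case True
    \<comment> \<open>The twins of \<open>c1\<close> outside \<open>C1\<close> are carried along by
      \<open>F\<close>, so the class of \<open>c2\<close> exceeds that of \<open>c1\<close> by at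
      least \<open>card C2 - card C1\<close>.\<close>
    define U where "U = twin_class V1 E1 c1 - C1"
    have CU: "twin_class V1 E1 c1 = C1 \<union> U"
      using tw[OF c1] CV(1) by (auto simp: U_def twin_class_def)
    have UV: "U \<subseteq> V1 - C1" by (auto simp: U_def twin_class_def)
    have fins: "finite C1" "finite C2" "finite U"
      using finite_subset[OF CV(1) fin(1)] finite_subset[OF CV(2) fin(2)] finite_subset[OF UV] fin by auto
    have "C2 \<union> F ` U \<subseteq> twin_class V2 E2 x"
    proof
      fix y assume "y \<in> C2 \<union> F ` U"
      then show "y \<in> twin_class V2 E2 x"
      proof
        assume "y \<in> C2"
        then show ?thesis using tw2 CV(2) True by (auto simp: twin_class_def)
      next
        assume "y \<in> F ` U"
        then obtain u where u: "u \<in> U" "y = F u" by blast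
        then have "u \<in> V1 - C1" "twins E1 c1 u" by (auto simp: U_def twin_class_def)
        then show ?thesis using forth2[of u] FV[of u] u(2) True by (simp add: twin_class_def)
      qed
    qed
    then have "card (C2 \<union> F ` U) \<le> card (twin_class V2 E2 x)"
      using fin(2) by (intro card_mono) (auto simp: twin_class_def)
    moreover have "inj_on F U" by (rule inj_on_subset[OF injF UV])
    then have "card (F ` U) = card U" by (rule card_image)
    moreover have "C2 \<inter> F ` U = {}" using FV UV by blast
    then have "card (C2 \<union> F ` U) = card C2 + card (F ` U)" using fins by (intro card_Un_disjoint) auto
    moreover have "C1 \<inter> U = {}" by (auto simp: U_def)
    then have "s = card C1 + card U" unfolding s CU using fins by (intro card_Un_disjoint) auto
    ultimately show ?thesis using C(2) by simp
  qed
  have "finite P" by (rule finite_subset[OF PV fin(2)])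
  then obtain ps where ps: "set ps = P" "distinct ps" using finite_distinct_list by blast
  have lp: "length ps = Suc (card J)" using distinct_card[OF ps(2)] ps(1) cardP by simp
  have "simE k ?G ?M (length ps + (R - length ps)) [] []" using sim lp le k by simp
  moreover have "set ps \<subseteq> univ ?G" using ps PV by simp
  ultimately obtain bs where bs: "length bs = length ps" "set bs \<subseteq> univ ?M"
    "simE k ?G ?M (R - length ps) ([] @ ps) ([] @ bs)"
    using simE_moves by blast
  have sim1: "simE k ?G ?M (R - length ps) ps bs" using bs(3) by simp
  have k1: "k - 1 \<le> R - length ps" using lp le k s by simp
  have bV: "bs ! p \<in> V1" if "p < length ps" for p
    using bs(1,2) that nth_mem[of p bs] by auto
  have injb: "p = q" if pq: "p < length ps" "q < length ps"
    "twin_class V1 E1 (bs ! p) = twin_class V1 E1 (bs ! q)" for p q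
  proof -
    have "bs ! q \<in> twin_class V1 E1 (bs ! p)" using twin_class_self[OF bV[OF pq(2)], of E1] pq(3) by simp
    then have "twins E1 (bs ! p) (bs ! q)" by (simp add: twin_class_def)
    then have "twins E2 (ps ! p) (ps ! q)"
      by (rule simE_twins[OF g2 g1 k ne sim1 k1 pq(1,2)])
    then have "ps ! p = ps ! q" using Ptw ps(1) pq(1,2) nth_mem by blast
    then show ?thesis using nth_eq_iff_index_eq[OF ps(2) pq(1,2)] by simp
  qed
  \<comment> \<open>Pigeonhole: the replies lie in \<open>card J + 1\<close> different classes of
    \<open>V1\<close>, so one of these classes has at most \<open>s\<close> vertices.\<close>
  have "\<exists>i<length ps. twin_class V1 E1 (bs ! i) \<notin> J"
  proof (rule ccontr)
    assume "\<not> ?thesis"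
    then have "(\<lambda>i. twin_class V1 E1 (bs ! i)) ` {..<length ps} \<subseteq> J" by auto
    moreover have "inj_on (\<lambda>i. twin_class V1 E1 (bs ! i)) {..<length ps}"
      by (rule inj_onI) (use injb in simp)
    ultimately have "card {..<length ps} \<le> card J" using finJ by (metis card_inj_on_le)
    then show False using lp by simp
  qed
  then obtain i where i: "i < length ps" "twin_class V1 E1 (bs ! i) \<notin> J" by blast
  then have small: "card (twin_class V1 E1 (bs ! i)) \<le> s" using bV[OF i(1)] by (auto simp: J)
  have pP: "ps ! i \<in> P" using i(1) ps(1) nth_mem by blast
  have pV: "ps ! i \<in> V2" using pP PV by blast
  \<comment> \<open>The pebble \<open>ps ! i\<close> already counts, so \<open>s\<close> further
    moves show \<open>s + 1\<close> distinct twins.\<close>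
  have "card (twin_class V2 E2 (ps ! i) - {ps ! i}) = card (twin_class V2 E2 (ps ! i)) - 1"
    using twin_class_self[OF pV] by (simp add: card_Diff_singleton)
  then have "s \<le> card (twin_class V2 E2 (ps ! i) - {ps ! i})" using size[OF pP] by simp
  then obtain Q where Q: "Q \<subseteq> twin_class V2 E2 (ps ! i) - {ps ! i}" "card Q = s" "finite Q"
    by (rule obtain_subset_with_card_n)
  obtain qs where qs: "set qs = Q" "distinct qs" using Q(3) finite_distinct_list by blast
  have lq: "length qs = s" using distinct_card[OF qs(2)] qs(1) Q(2) by simp
  have "length qs + (R - length ps - s) = R - length ps" using lq lp le k by simp
  then have sim2: "simE k ?G ?M (length qs + (R - length ps - s)) ps bs"
    using sim1 by simp
  have qV: "set qs \<subseteq> univ ?G" using qs(1) Q(1) by (auto simp: twin_class_def)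
  obtain ws where ws: "length ws = length qs" "set ws \<subseteq> univ ?M"
    "simE k ?G ?M (R - length ps - s) (ps @ qs) (bs @ ws)"
    by (rule simE_moves[OF sim2 qV])
  have k2: "k - 1 \<le> R - length ps - s" using lp le k by simp
  have sU: "simU k ?G ?M (R - length ps - s) (ps @ qs) (bs @ ws)" using simE_simU[OF ws(3)] .
  have ag: "agree k ?G ?M (ps @ qs) (bs @ ws)" by (rule simU_agree[OF sU ne'])
  have "agree k ?G ?M ((ps ! i) # qs) ((bs ! i) # ws)"
    using agree_pick2[OF ag] bs(1) i(1) by simp
  then have "distinct ((ps ! i) # qs) \<longleftrightarrow> distinct ((bs ! i) # ws)" by (rule agree_distinct)
  moreover have "ps ! i \<notin> set qs" unfolding qs(1) using Q(1) by blast
  ultimately have dw: "distinct ((bs ! i) # ws)" using qs(2) by simp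
  have "set ((bs ! i) # ws) \<subseteq> twin_class V1 E1 (bs ! i)"
  proof
    fix w assume "w \<in> set ((bs ! i) # ws)"
    then consider "w = bs ! i" | "w \<in> set ws" by auto
    then show "w \<in> twin_class V1 E1 (bs ! i)"
    proof cases
      case 1
      then show ?thesis using twin_class_self[OF bV[OF i(1)]] by simp
    next
      case 2
      then obtain h where h: "h < length ws" "w = ws ! h" unfolding in_set_conv_nth by blast
      have "qs ! h \<in> Q" using h(1) ws(1) qs(1) nth_mem[of h qs] by simp
      then have "twins E2 (ps ! i) (qs ! h)" using Q(1) by (auto simp: twin_class_def)
      then have "twins E2 ((ps @ qs) ! i) ((ps @ qs) ! (length ps + h))"
        using i(1) by (simp add: nth_append)
      then have "twins E1 ((bs @ ws) ! i) ((bs @ ws) ! (length ps + h))"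
        by (rule simU_twins[OF g2 g1 k ne sU k2, rotated 2]) (use i(1) h(1) ws(1) in simp_all)
      then have "twins E1 (bs ! i) w" using i(1) bs(1) h(2) by (simp add: nth_append)
      moreover have "w \<in> V1" using 2 ws(2) by auto
      ultimately show ?thesis by (simp add: twin_class_def)
    qed
  qed
  then have "card (set ((bs ! i) # ws)) \<le> card (twin_class V1 E1 (bs ! i))"
    using fin(1) by (intro card_mono) (auto simp: twin_class_def)
  then show False using distinct_card[OF dw] small ws(1) lq by simp
qed

text \<open>Here \<open>x\<close> is the size of the base, \<open>m\<close> the number of classes
  and \<open>c\<close> the size of a class other than a chosen largest one. Both classes have at
  least \<open>c\<close> vertices and the other \<open>m - 2\<close> are nonempty, which gives the
  third hypothesis. Eliminating \<open>m\<close> leaves k x + 2 (k - 1) c \<le> (k - 1)(n + 1), and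
  k \<le> 2 (k - 1). The last hypothesis is (1 - 1/k) n + 2k - 1 < R + 1 cleared of
  denominators.\<close>

lemma class_size_arith:
  fixes k x c m n R :: nat
  assumes "k \<ge> 2" "x + (k - 1) \<le> (k - 1) * m" "x + 2 * c + m \<le> n + 2"
    "(k - 1) * n + k * (2 * k - 1) < k * (R + 1)"
  shows "x + c + k \<le> R"
proof -
  define j where "j = k - 1"
  then have j: "k = j + 1" "j \<ge> 1" using assms(1) by simp_all
  have "j * (x + 2 * c + m) \<le> j * (n + 2)" using assms(3) by (rule mult_le_mono2)
  then have 1: "j * x + 2 * (j * c) + j * m \<le> j * n + 2 * j" by (simp add: algebra_simps)
  have 2: "x + j \<le> j * m" using assms(2) j by simp
  have 3: "j * n + (j + 1) * (2 * j + 1) < (j + 1) * (R + 1)" using assms(4) j by simp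
  have "j * c \<ge> c" using j by simp
  moreover have "(j + 1) * (2 * j + 1) = 2 * (j * j) + 3 * j + 1" by (simp add: algebra_simps)
  moreover have "(j + 1) * (x + c + j + 1) = j * x + j * c + x + c + j * j + 2 * j + 1"
    by (simp add: algebra_simps)
  moreover have "j * j \<ge> j" using j by simp
  ultimately have "(j + 1) * (x + c + j + 1) < (j + 1) * (R + 1) " using 1 2 3 by linarith
  then have "x + c + j + 1 < R + 1" using mult_less_cancel1 by blast
  then show ?thesis using j by simp
qed

lemma base_size_arith:
  fixes k x m n R :: nat
  assumes "k \<ge> 2" "x + (k - 1) \<le> (k - 1) * m" "x + m \<le> n"
    "(k - 1) * n + k * (2 * k - 1) < k * (R + 1)"
  shows "x + (2 * k - 1) \<le> R"
proof -
  define j where "j = k - 1"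
  then have j: "k = j + 1" "j \<ge> 1" using assms(1) by simp_all
  have "j * (x + m) \<le> j * n" using assms(3) by (rule mult_le_mono2)
  then have 1: "j * x + j * m \<le> j * n" by (simp add: algebra_simps)
  have 2: "x + j \<le> j * m" using assms(2) j by simp
  have 3: "j * n + (j + 1) * (2 * j + 1) < (j + 1) * (R + 1)" using assms(4) j by simp
  have "(j + 1) * (x + (2 * j + 1)) = j * x + x + (j + 1) * (2 * j + 1)" by (simp add: algebra_simps)
  then have "(j + 1) * (x + (2 * j + 1)) < (j + 1) * (R + 1)" using 1 2 3 by linarith
  then have "x + (2 * j + 1) < R + 1" using mult_less_cancel1 by blast
  then show ?thesis using j by simp
qed

text \<open>Many large classes need many vertices: \<open>j\<close> classes of size at least
  \<open>s + 1\<close> and one of size \<open>s\<close> fit into \<open>n\<close>, and the product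
  pays for the sum through j s \<ge> j + s - 1.\<close>

lemma count_arith:
  fixes k j s n R :: nat
  assumes "k \<ge> 2" "k \<le> s" "j \<ge> 1" "j * (s + 1) + s \<le> n"
    "(k - 1) * n + k * (2 * k - 1) < k * (R + 1)"
  shows "j + s + k \<le> R"
proof -
  define i where "i = k - 1"
  then have i: "k = i + 1" "i \<ge> 1" using assms(1) by simp_all
  have "i * (j * (s + 1) + s) \<le> i * n" using assms(4) by (rule mult_le_mono2)
  then have 1: "i * (j * s) + i * j + i * s \<le> i * n" by (simp add: algebra_simps)
  have 3: "i * n + (i + 1) * (2 * i + 1) < (i + 1) * (R + 1)" using assms(5) i by simp
  define a b where "a = j - 1" and "b = s - 1"
  then have ab: "j = a + 1" "s = b + 1" using assms(1-3) by simp_all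
  have "j * s = a * b + a + b + 1" using ab by (simp add: algebra_simps)
  then have "j * s \<ge> j + s - 1" using ab by simp
  moreover have "j * s \<le> i * (j * s)" using i by simp
  moreover have "(i + 1) * (2 * i + 1) = 2 * (i * i) + 3 * i + 1" by (simp add: algebra_simps)
  moreover have "(i + 1) * (j + s + i + 1) = i * j + i * s + j + s + i * i + 2 * i + 1"
    by (simp add: algebra_simps)
  moreover have "i * i \<ge> i" using i by simp
  ultimately have "(i + 1) * (j + s + i + 1) < (i + 1) * (R + 1)" using 1 3 i ab by linarith
  then have "j + s + i + 1 < R + 1" using mult_less_cancel1 by blast
  then show ?thesis using i by simp
qed

lemma count_classes:
  assumes fin: "finite V" and c: "c \<in> V" and s: "s = card (twin_class V E c)"
    and J: "J = {Q \<in> twin_class V E ` V. s < card Q}"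
  shows "card J * (s + 1) + s \<le> card V"
proof -
  let ?K = "insert (twin_class V E c) J"
  have finJ: "finite J" using fin by (simp add: J)
  have K: "?K \<subseteq> twin_class V E ` V" using c by (auto simp: J)
  have "pairwise disjnt ?K"
  proof (rule pairwiseI)
    fix A B assume AB: "A \<in> ?K" "B \<in> ?K" "A \<noteq> B"
    obtain u where u: "A = twin_class V E u" using subsetD[OF K AB(1)] by (rule imageE)
    obtain v where v: "B = twin_class V E v" using subsetD[OF K AB(2)] by (rule imageE)
    show "disjnt A B"
    proof (rule ccontr)
      assume "\<not> disjnt A B"
      then obtain w where "w \<in> A" "w \<in> B" by (auto simp: disjnt_def)
      then have "twins E u w" "twins E v w" by (simp_all add: u v twin_class_def)
      then have "A = B"
        unfolding u v using twin_class_eq[of E u w V] twin_class_eq[of E v w V] by simp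
      then show False using AB(3) by simp
    qed
  qed
  moreover have "finite Q" if Q: "Q \<in> ?K" for Q
  proof -
    obtain u where "Q = twin_class V E u" using subsetD[OF K Q] by (rule imageE)
    then show ?thesis using fin by (simp add: twin_class_def)
  qed
  ultimately have "card (\<Union>?K) = sum card ?K" by (intro card_Union_disjoint)
  moreover have "twin_class V E c \<notin> J" using s by (simp add: J)
  then have "sum card ?K = s + sum card J" using finJ s by simp
  moreover have "card J * (s + 1) \<le> sum card J"
    using sum_bounded_below[of J "s + 1" card] by (auto simp: J)
  moreover have "\<Union>?K \<subseteq> V"
  proof (rule Union_least)
    fix Q assume "Q \<in> ?K"
    then obtain u where "Q = twin_class V E u" using K by (metis imageE subsetD)
    then show "Q \<subseteq> V" by (auto simp: twin_class_def)
  qed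
  then have "card (\<Union>?K) \<le> card V" by (rule card_mono[OF fin])
  ultimately show ?thesis by simp
qed

section \<open>Reconstructing the other hypergraph from its classes\<close>

context base_position
begin

lemma eqv_base_class: "a \<in> V - X \<Longrightarrow> eqv V E k X (k - 1) `` {a} = base_class a"
  using base by (auto simp: eqv_def base_class_def)

lemma cls_base_class: "cls V E k X (k - 1) = base_class ` (V - X)"
proof (rule set_eqI, rule iffI)
  fix Q assume "Q \<in> cls V E k X (k - 1)"
  then obtain a where "a \<in> V - X" "Q = eqv V E k X (k - 1) `` {a}" by (rule quotientE)
  then show "Q \<in> base_class ` (V - X)" using eqv_base_class by simp
next
  fix Q assume "Q \<in> base_class ` (V - X)"
  then obtain a where a: "Q = base_class a" "a \<in> V - X" by (rule imageE)
  then have "Q = eqv V E k X (k - 1) `` {a}" using eqv_base_class by simp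
  then show "Q \<in> cls V E k X (k - 1)" using quotientI[OF a(2)] by simp
qed

lemma base_class_self: "a \<in> V - X \<Longrightarrow> a \<in> base_class a"
  by (simp add: base_class_def)

lemma base_class_eq: "b \<in> base_class a \<Longrightarrow> base_class b = base_class a"
proof -
  assume "b \<in> base_class a"
  then have "twins E a b" by (simp add: base_class_def)
  then have "twin_class (V - X) E a = twin_class (V - X) E b" by (rule twin_class_eq)
  then show ?thesis by (simp add: base_class_def twin_class_def)
qed

lemma image_class_eq: "b \<in> base_class a \<Longrightarrow> a \<in> V - X \<Longrightarrow> image_class b = image_class a"
proof -
  assume b: "b \<in> base_class a" and a: "a \<in> V - X"
  then have "b \<in> V - X" "twins E a b" by (simp_all add: base_class_def)
  moreover from this have "twins E b a" by (simp add: twins_sym[of E b])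
  ultimately show ?thesis using twin_resp_twins a by (auto simp: image_class_def)
qed

lemma image_class_disjoint: "z \<in> image_class a \<Longrightarrow> z \<in> image_class b \<Longrightarrow> b \<in> base_class a"
proof -
  assume "z \<in> image_class a" "z \<in> image_class b"
  then have r: "twin_resp a z" "twin_resp b z" by (simp_all add: image_class_def)
  then have "twins E a b" by (rule twin_resp_unique)
  then show ?thesis using r(2) by (simp add: base_class_def twin_resp_def)
qed

lemma card_Union_base_class: "card (V - X) = sum card (base_class ` (V - X))"
proof -
  have "pairwise disjnt (base_class ` (V - X))"
  proof (rule pairwiseI)
    fix A B assume AB: "A \<in> base_class ` (V - X)" "B \<in> base_class ` (V - X)" "A \<noteq> B"
    obtain a where a: "A = base_class a" using AB(1) by (rule imageE)
    obtain b where b: "B = base_class b" using AB(2) by (rule imageE)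
    show "disjnt A B"
    proof (rule ccontr)
      assume "\<not> disjnt A B"
      then obtain w where "w \<in> base_class a" "w \<in> base_class b" by (auto simp: disjnt_def a b)
      then have "A = B" using base_class_eq a b by metis
      then show False using AB(3) by simp
    qed
  qed
  moreover have "\<Union> (base_class ` (V - X)) = V - X" using base_class_self by (auto simp: base_class_def)
  moreover have "finite Q" if "Q \<in> base_class ` (V - X)" for Q using that finite_base_class by auto
  ultimately show ?thesis using card_Union_disjoint[of "base_class ` (V - X)"] by simp
qed

lemma card_classes_le:
  assumes "S \<subseteq> base_class ` (V - X)"
  shows "card S \<le> sum card S"
proof -
  have "1 \<le> card Q" if Q: "Q \<in> S" for Q
  proof -
    obtain a where "Q = base_class a" "a \<in> V - X" using subsetD[OF assms Q] by (rule imageE)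
    then show ?thesis using base_class_self[of a] finite_base_class(1)[of a] card_gt_0_iff[of Q] by force
  qed
  then show ?thesis using sum_bounded_below[of S 1 card] by simp
qed

lemma class_count:
  assumes "a \<in> V - X" "b \<in> V - X" "base_class a \<noteq> base_class b"
  shows "card (base_class a) + card (base_class b) + card (cls V E k X (k - 1)) \<le> card (V - X) + 2"
proof -
  define S where "S = base_class ` (V - X) - {base_class a, base_class b}"
  have S: "base_class ` (V - X) = insert (base_class a) (insert (base_class b) S)" using assms by (auto simp: S_def)
  have fS: "finite S" using fin by (simp add: S_def)
  have nS: "base_class a \<notin> insert (base_class b) S" "base_class b \<notin> S" using assms(3) by (auto simp: S_def)
  have "card S \<le> sum card S" by (rule card_classes_le) (auto simp: S_def)
  moreover have "card (base_class ` (V - X)) = card S + 2" unfolding S using fS nS by simp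
  moreover have "sum card (base_class ` (V - X)) = card (base_class a) + card (base_class b) + sum card S"
    unfolding S using fS nS by simp
  ultimately show ?thesis unfolding cls_base_class card_Union_base_class by simp
qed

text \<open>Fix a largest class \<open>C\<close>. Any other class is small enough for
  \<open>class_size_arith\<close> to leave the rounds that count it exactly, so \<open>f\<close> on
  the base and one bijection per class combine to \<open>F\<close>. Only the size of
  \<open>C\<close> remains uncertain.\<close>

lemma exists_resized:
  assumes k2: "k \<ge> 2" and bud: "card X + (k - 1) \<le> (k - 1) * card (cls V E k X (k - 1))"
    and R: "R = card X + r" "(k - 1) * card V + k * (2 * k - 1) < k * (R + 1)"
  shows "\<exists>C C' F. resized V E C V' E' C' F \<and> (\<forall>u\<in>C. \<forall>v\<in>C. twins E u v) \<and> C \<noteq> {} \<and>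
    (card C = card C' \<or> k \<le> card C \<and> k \<le> card C')"
proof -
  have cVX: "card V = card X + card (V - X)"
    using XV fin(1) by (simp add: card_Diff_subset finite_subset card_mono)
  have "card (cls V E k X (k - 1)) \<noteq> 0"
  proof
    assume "card (cls V E k X (k - 1)) = 0"
    then show False using bud k2 by simp
  qed
  then have "cls V E k X (k - 1) \<noteq> {}" by (metis card.empty)
  then have VX: "V - X \<noteq> {}" by (auto simp: quotient_def)
  have "Max ((\<lambda>a. card (base_class a)) ` (V - X)) \<in> (\<lambda>a. card (base_class a)) ` (V - X)"
    using fin VX by (intro Max_in) auto
  then obtain a0 where a0: "Max ((\<lambda>a. card (base_class a)) ` (V - X)) = card (base_class a0)" "a0 \<in> V - X"
    by (rule imageE)
  have max: "card (base_class a) \<le> card (base_class a0)" if "a \<in> V - X" for a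
    using that fin unfolding a0(1)[symmetric] by (intro Max_ge) auto
  define C where "C = base_class a0"
  define C' where "C' = image_class a0"
  have other: "card (image_class a) = card (base_class a)" if a: "a \<in> V - X" "base_class a \<noteq> C" for a
  proof -
    have "card X + 2 * card (base_class a) + card (cls V E k X (k - 1)) \<le> card V + 2"
      using class_count[OF a(1) a0(2)] a max[OF a(1)] cVX by (simp add: C_def)
    from class_size_arith[OF k2 bud this R(2)] have le: "card (base_class a) + k \<le> r" by (simp add: R(1))
    have "card (image_class a) \<le> card (base_class a)" by (rule base_class_upper[OF a(1) le])
    moreover have "card (base_class a) \<le> card (image_class a)" by (rule base_class_lower[OF order_refl a(1)]) (use le in simp)
    ultimately show ?thesis by simp
  qed
  have CV: "C \<subseteq> V - X" by (auto simp: C_def base_class_def)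
  have CV': "C' \<subseteq> V' - f ` X" by (auto simp: C'_def image_class_def twin_resp_def)
  have notC: "base_class v \<noteq> C" if "v \<in> V - X" "v \<notin> C" for v using base_class_self that by blast
  \<comment> \<open>With \<open>2 * k - 1\<close> rounds a class of fewer than \<open>k\<close>
    vertices is still counted exactly, and a larger one is seen to have at least \<open>k\<close>
    counterparts.\<close>
  have size: "card C = card C' \<or> k \<le> card C \<and> k \<le> card C'"
  proof (cases "card C < k")
    case True
    have "card C' \<le> card C" unfolding C_def C'_def
      by (rule base_class_upper[OF a0(2)]) (use True r in \<open>simp add: C_def\<close>)
    moreover have "card C \<le> card C'" unfolding C_def C'_def
      by (rule base_class_lower[OF order_refl a0(2)]) (use True r in \<open>simp add: C_def\<close>)
    ultimately show ?thesis by simp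
  next
    case False
    then obtain A where A: "A \<subseteq> C" "card A = k" using obtain_subset_with_card_n[of k C] by auto
    have "card A \<le> card C'" unfolding C'_def
      by (rule base_class_lower[OF A(1)[unfolded C_def] a0(2)]) (use A r in simp)
    then show ?thesis using A False by simp
  qed
  \<comment> \<open>The choice depends on the class alone, so all its vertices use the same
    bijection and \<open>F\<close> is injective on the class.\<close>
  define h where "h Q = (SOME g. \<forall>a\<in>V - X. base_class a = Q \<longrightarrow> bij_betw g Q (image_class a))" for Q
  have h: "bij_betw (h (base_class a)) (base_class a) (image_class a)" if a: "a \<in> V - X" "base_class a \<noteq> C" for a
  proof -
    obtain g where g: "bij_betw g (base_class a) (image_class a)"
      using finite_same_card_bij[OF finite_base_class other[OF a, symmetric]] by blast
    have "\<forall>b\<in>V - X. base_class b = base_class a \<longrightarrow> bij_betw g (base_class a) (image_class b)"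
    proof (intro ballI impI)
      fix b assume b: "b \<in> V - X" "base_class b = base_class a"
      then have "b \<in> base_class a" using base_class_self by blast
      then show "bij_betw g (base_class a) (image_class b)" using image_class_eq a(1) g by simp
    qed
    then have "\<exists>g. \<forall>b\<in>V - X. base_class b = base_class a \<longrightarrow> bij_betw g (base_class a) (image_class b)" by (rule exI[where x = g])
    from someI_ex[OF this] show ?thesis using a(1) unfolding h_def by simp
  qed
  define F where "F v = (if v \<in> X then f v else h (base_class v) v)" for v
  have FX: "F v = f v" if "v \<in> X" for v using that by (simp add: F_def)
  have Fr: "F v \<in> image_class v" if v: "v \<in> V - X" "v \<notin> C" for v
    using bij_betwE[OF h[OF v(1) notC[OF v]]] base_class_self[OF v(1)] v(1) by (simp add: F_def)
  then have Frl: "twin_resp v (F v)" if "v \<in> V - X" "v \<notin> C" for v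
    using that by (simp add: image_class_def)
  have FV: "F v \<in> V' - f ` X" if "v \<in> V - X" "v \<notin> C" for v
    using Frl[OF that] by (simp add: twin_resp_def)
  have inj: "inj_on F (V - C)"
  proof (rule inj_onI)
    fix v w assume vw: "v \<in> V - C" "w \<in> V - C" "F v = F w"
    have FXiff: "F y \<in> f ` X \<longleftrightarrow> y \<in> X" if "y \<in> V - C" for y
    proof (cases "y \<in> X")
      case True
      then show ?thesis using FX by simp
    next
      case False
      then show ?thesis using FV[of y] that by simp
    qed
    have iff: "v \<in> X \<longleftrightarrow> w \<in> X" using FXiff[OF vw(1)] FXiff[OF vw(2)] vw(3) by simp
    show "v = w"
    proof (cases "v \<in> X")
      case True
      then have "f v = f w" using iff vw(3) FX by simp
      then show ?thesis using inj_f True iff by (simp add: inj_on_def)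
    next
      case False
      then have v: "v \<in> V - X" "v \<notin> C" and w: "w \<in> V - X" "w \<notin> C" using vw iff by auto
      have wv: "w \<in> base_class v" using image_class_disjoint[OF Fr[OF v]] Fr[OF w] vw(3) by simp
      then have "base_class w = base_class v" by (rule base_class_eq)
      then have "h (base_class v) v = h (base_class v) w" using vw(3) v w by (simp add: F_def)
      then show ?thesis
        using bij_betw_imp_inj_on[OF h[OF v(1) notC[OF v]]] base_class_self[OF v(1)] wv by (simp add: inj_on_def)
    qed
  qed
  have img: "F ` (V - C) = V' - C'"
  proof (rule set_eqI, rule iffI)
    fix z assume "z \<in> F ` (V - C)"
    then obtain v where v: "z = F v" "v \<in> V - C" by (rule imageE)
    show "z \<in> V' - C'"
    proof (cases "v \<in> X")
      case True
      then have "z \<in> f ` X" using v FX by simp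
      then show ?thesis using fX CV' by blast
    next
      case False
      then have vX: "v \<in> V - X" "v \<notin> C" using v by auto
      have "z \<notin> C'"
      proof
        assume "z \<in> C'"
        then have "v \<in> base_class a0" using image_class_disjoint[of z a0 v] Fr[OF vX] v(1) by (simp add: C'_def)
        then show False using vX(2) by (simp add: C_def)
      qed
      then show ?thesis using FV[OF vX] v(1) by simp
    qed
  next
    fix z assume z: "z \<in> V' - C'"
    show "z \<in> F ` (V - C)"
    proof (cases "z \<in> f ` X")
      case True
      then obtain x where x: "z = f x" "x \<in> X" by (rule imageE)
      then have "x \<in> V - C" using XV CV by blast
      then show ?thesis using x FX by (intro image_eqI[of _ _ x]) simp_all
    next
      case False
      then obtain a where a: "twin_resp a z" using twin_resp_ex z by blast
      then have aV: "a \<in> V - X" by (simp add: twin_resp_def)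
      have za: "z \<in> image_class a" using a by (simp add: image_class_def)
      have "base_class a \<noteq> C"
      proof
        assume "base_class a = C"
        then have "a \<in> base_class a0" using base_class_self[OF aV] by (simp add: C_def)
        then have "z \<in> C'" using image_class_eq[OF _ a0(2)] za by (simp add: C'_def)
        then show False using z by simp
      qed
      then have hb: "bij_betw (h (base_class a)) (base_class a) (image_class a)" by (rule h[OF aV])
      then have "z \<in> h (base_class a) ` base_class a" using za by (simp add: bij_betw_def)
      then obtain v where v: "z = h (base_class a) v" "v \<in> base_class a" by (rule imageE)
      have "v \<in> V - X" using v(2) by (simp add: base_class_def)
      moreover have "base_class v = base_class a" using base_class_eq[OF v(2)] .
      moreover have "v \<notin> C"
      proof
        assume "v \<in> C"
        then have "base_class v = C" unfolding C_def by (rule base_class_eq)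
        then show False using \<open>base_class v = base_class a\<close> \<open>base_class a \<noteq> C\<close> by simp
      qed
      ultimately show ?thesis using v(1) by (intro image_eqI[of _ _ v]) (simp_all add: F_def)
    qed
  qed
  have edge: "A \<union> B \<in> E \<longleftrightarrow> F ` A \<union> B' \<in> E'"
    if h: "A \<subseteq> V - C" "B \<subseteq> C" "B' \<subseteq> C'" "card B = card B'" for A B B'
  proof -
    have "finite B" "finite B'"
      using h(2,3) finite_base_class(1)[of a0] finite_base_class(2)[of a0] unfolding C_def C'_def
      by (auto intro: finite_subset)
    then obtain b where b: "bij_betw b B B'" using finite_same_card_bij h(4) by blast
    define g where "g y = (if y \<in> B then b y else F y)" for y
    have gB: "g y \<in> C'" if "y \<in> B" for y using bij_betwE[OF b] that h(3) by (auto simp: g_def)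
    have AB: "y \<notin> B" if "y \<in> A" for y using that h by blast
    have XB: "y \<notin> B" if "y \<in> X" for y using that h(2) CV by blast
    have "A \<union> B \<in> E \<longleftrightarrow> g ` (A \<union> B) \<in> E'"
    proof (rule twin_resp_edge)
      show "A \<union> B \<subseteq> V" using h CV by blast
      show "g y = f y" if "y \<in> (A \<union> B) \<inter> X" for y using that XB FX by (simp add: g_def)
      show "twin_resp y (g y)" if y: "y \<in> (A \<union> B) - X" for y
      proof (cases "y \<in> B")
        case True
        then have "twin_resp a0 (g y)" using gB by (simp add: C'_def image_class_def)
        moreover have "twins E a0 y" "y \<in> V - X" using True h(2) by (auto simp: C_def base_class_def)
        ultimately show ?thesis by (rule twin_resp_twins)
      next
        case False
        then have "y \<in> V - X" "y \<notin> C" using y h(1) by auto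
        then show ?thesis using Frl False by (simp add: g_def)
      qed
      show "inj_on g ((A \<union> B) - X)"
      proof (rule inj_onI)
        fix y w assume yw: "y \<in> (A \<union> B) - X" "w \<in> (A \<union> B) - X" "g y = g w"
        have iff: "g e \<in> C' \<longleftrightarrow> e \<in> B" if "e \<in> A \<union> B" for e
        proof (cases "e \<in> B")
          case False
          then have "e \<in> V - C" using that h(1) by blast
          then have "F e \<in> V' - C'" using img by blast
          then show ?thesis using False by (simp add: g_def)
        qed (use gB in simp)
        have "y \<in> B \<longleftrightarrow> w \<in> B" using iff[of y] iff[of w] yw by simp
        then show "y = w"
          using yw inj_on_subset[OF inj h(1)] bij_betw_imp_inj_on[OF b] by (cases "y \<in> B") (auto simp: g_def inj_on_def)
      qed
    qed
    moreover have "g ` A = F ` A" by (intro image_cong) (auto simp: g_def AB)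
    moreover have "g ` B = B'" using b by (auto simp: g_def bij_betw_def)
    ultimately show ?thesis by (simp add: image_Un)
  qed
  have "resized V E C V' E' C' F"
    unfolding resized_def bij_betw_def using CV CV' inj img edge by blast
  moreover have "twins E u v" if "u \<in> C" "v \<in> C" for u v
  proof -
    have "twins E a0 u" "twins E a0 v" using that by (simp_all add: C_def base_class_def)
    then show ?thesis using twins_trans[of E u a0 v] twins_sym[of E u a0] by simp
  qed
  moreover have "C \<noteq> {}" using base_class_self[OF a0(2)] by (auto simp: C_def)
  ultimately show ?thesis using size by blast
qed

end

section \<open>Winning the game in both directions forces isomorphism\<close>

lemma resized_iso:
  assumes g: "kgraph k V E" "kgraph k V' E'" and r: "resized V E C V' E' C' F" and c: "card C = card C'"
  shows "struct_iso k (kgraph_struct k V E) (kgraph_struct k V' E')"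
proof -
  have CV: "C \<subseteq> V" "C' \<subseteq> V'" and bF: "bij_betw F (V - C) (V' - C')"
    using r by (simp_all add: resized_def)
  have "finite C" "finite C'"
    using g CV by (auto simp: kgraph_def intro: finite_subset)
  then obtain h where h: "bij_betw h C C'" using finite_same_card_bij c by blast
  define H where "H v = (if v \<in> C then h v else F v)" for v
  have "bij_betw H (V - C) (V' - C')"
    by (rule bij_betw_cong[THEN iffD1, OF _ bF]) (simp add: H_def)
  moreover have "bij_betw H C C'"
    by (rule bij_betw_cong[THEN iffD1, OF _ h]) (simp add: H_def)
  ultimately have "bij_betw H ((V - C) \<union> C) ((V' - C') \<union> C')"
    by (rule bij_betw_combine) blast
  moreover have "(V - C) \<union> C = V" "(V' - C') \<union> C' = V'" using CV by auto
  ultimately have bH: "bij_betw H V V'" by simp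
  have "xs \<in> rel (kgraph_struct k V E) \<longleftrightarrow> map H xs \<in> rel (kgraph_struct k V' E')"
    if xs: "set xs \<subseteq> V" for xs
  proof -
    let ?e = "set xs"
    have "inj_on H ?e" using inj_on_subset[OF bij_betw_imp_inj_on[OF bH] xs] .
    then have "distinct (map H xs) \<longleftrightarrow> distinct xs" by (simp add: distinct_map)
    moreover have "inj_on h (?e \<inter> C)" using inj_on_subset[OF bij_betw_imp_inj_on[OF h]] by simp
    then have "card (?e \<inter> C) = card (h ` (?e \<inter> C))" by (simp add: card_image)
    then have "(?e - C) \<union> (?e \<inter> C) \<in> E \<longleftrightarrow> F ` (?e - C) \<union> h ` (?e \<inter> C) \<in> E'"
      using xs bij_betw_imp_surj_on[OF h] by (intro resizedD[OF r]) auto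
    moreover have "(?e - C) \<union> (?e \<inter> C) = ?e" by auto
    moreover have "F ` (?e - C) \<union> h ` (?e \<inter> C) = H ` ?e" by (auto simp: H_def)
    ultimately show ?thesis by (simp add: rel_kgraph_struct)
  qed
  then show ?thesis unfolding struct_iso_def using bH by auto
qed

text \<open>If no class exceeds \<open>s\<close>, only the bound \<open>s + k \<le> R\<close> helps,
  and this is where \<sigma> enters. Otherwise a larger class exists and the order of the hypergraph
  pays for everything.\<close>

lemma resized_count:
  assumes k: "k \<ge> 2" "k \<le> s" and fin: "finite V" and c: "c \<in> V" and s: "s = card (twin_class V E c)"
    and J: "J = {Q \<in> twin_class V E ` V. s < card Q}"
    and R: "(k - 1) * n + k * (2 * k - 1) < k * (R + 1)" "card V \<le> n" "s + k \<le> R"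
  shows "card J + s + k \<le> R"
proof (cases "card J = 0")
  case False
  have "card J * (s + 1) + s \<le> n" using count_classes[OF fin c s J] R(2) by simp
  from count_arith[OF k _ this R(1)] False show ?thesis by simp
qed (use R(3) in simp)

text \<open>Spoiler opens where the last class is larger, so both games are assumed. If the
  competitor has the smaller class, its order and the relevant class size are bounded by those of
  \<open>V\<close>, so the same \<open>R\<close> suffices.\<close>

lemma game_iso:
  fixes V :: "'a set" and V' :: "'b set"
  assumes k2: "k \<ge> 2" and g: "kgraph k V E" and g': "kgraph k V' E'" and ne: "V \<noteq> {}" "V' \<noteq> {}"
    and R: "(k - 1) * card V + k * (2 * k - 1) < k * (R + 1)"
    and S: "\<And>u. u \<in> V \<Longrightarrow> card (twin_class V E u) + k \<le> R"
    and sim: "simE k (kgraph_struct k V E) (kgraph_struct k V' E') R [] []"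
    and sim': "simE k (kgraph_struct k V' E') (kgraph_struct k V E) R [] []"
  shows "struct_iso k (kgraph_struct k V E) (kgraph_struct k V' E')"
proof -
  note sim0 = sim
  have k1: "k \<ge> 1" using k2 by simp
  have fin: "finite V" "finite V'" using g g' by (simp_all add: kgraph_def)
  obtain X where X: "X \<subseteq> V" "card X + (k - 1) \<le> (k - 1) * card (cls V E k X (k - 1))"
    "\<And>u v. u \<in> V - X \<Longrightarrow> v \<in> V - X \<Longrightarrow> sep V E k X (k - 1) u v \<longleftrightarrow> \<not> twins E u v"
    by (rule exists_base[OF g ne(1) k1]) (rule that, assumption+)
  have finX: "finite X" by (rule finite_subset[OF X(1) fin(1)])
  have "cls V E k X (k - 1) = (\<lambda>u. eqv V E k X (k - 1) `` {u}) ` (V - X)"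
    by (auto simp: quotient_def)
  then have "card (cls V E k X (k - 1)) \<le> card (V - X)"
    using card_image_le[of "V - X"] fin(1) by simp
  then have "card X + card (cls V E k X (k - 1)) \<le> card V"
    using card_Diff_subset[OF finX X(1)] card_mono[OF fin(1) X(1)] by simp
  from base_size_arith[OF k2 X(2) this R] have xR: "card X + (2 * k - 1) \<le> R" .
  obtain xs where xs: "set xs = X" "distinct xs" using finX finite_distinct_list by blast
  have lx: "length xs = card X" using distinct_card[OF xs(2)] xs(1) by simp
  define r where "r = R - card X"
  have rR: "R = card X + r" using xR by (simp add: r_def)
  have sx: "simE k (kgraph_struct k V E) (kgraph_struct k V' E') (length xs + r) [] []"
    using sim rR lx by simp
  have xV: "set xs \<subseteq> univ (kgraph_struct k V E)" using xs(1) X(1) by simp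
  obtain bs where bs: "length bs = length xs" "set bs \<subseteq> univ (kgraph_struct k V' E')"
    "simE k (kgraph_struct k V E) (kgraph_struct k V' E') r ([] @ xs) ([] @ bs)"
    by (rule simE_moves[OF sx xV])
  obtain f where f: "bs = map f xs" using ex_map_list[OF xs(2) bs(1)] by blast
  interpret base_position k V E V' E' X xs f r
  proof (unfold_locales; (fact k1 g g' ne(2) xs X(1) X(3))?)
    show "f ` X \<subseteq> V'" using bs(2) f xs(1) by auto
    show "2 * k - 1 \<le> r" using xR rR by simp
    show "simE k (kgraph_struct k V E) (kgraph_struct k V' E') r xs (map f xs)"
      using bs(3) f by simp
  qed
  obtain C C' F where C: "resized V E C V' E' C' F" "\<forall>u\<in>C. \<forall>v\<in>C. twins E u v" "C \<noteq> {}"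
    "card C = card C' \<or> k \<le> card C \<and> k \<le> card C'"
    using exists_resized[OF k2 X(2) rR R] by blast
  have CV: "C \<subseteq> V" "C' \<subseteq> V'" and bF: "bij_betw F (V - C) (V' - C')"
    using C(1) by (simp_all add: resized_def)
  have finC: "finite C" "finite C'" using finite_subset CV fin by auto
  obtain c where c: "c \<in> C" using C(3) by blast
  have cV: "c \<in> V" using c CV by blast
  have Csub: "C \<subseteq> twin_class V E c" using C(2) c CV by (auto simp: twin_class_def)
  show ?thesis
  proof (rule resized_iso[OF g g' C(1)], rule ccontr)
    assume neq: "card C \<noteq> card C'"
    then have big: "k \<le> card C" "k \<le> card C'" using C(4) by auto
    have tw: "twins E u v" if "u \<in> C" "v \<in> C" for u v using C(2) that by blast
    show False
    proof (cases "card C < card C'")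
      case True
      define s where "s = card (twin_class V E c)"
      define J where "J = {Q \<in> twin_class V E ` V. s < card Q}"
      have "k \<le> s" unfolding s_def
        using big(1) card_mono[OF _ Csub] fin(1) by (simp add: twin_class_def)
      then have jR: "card J + s + k \<le> R"
        by (rule resized_count[OF k2 _ fin(1) cV s_def J_def R order_refl]) (use S[OF cV] in \<open>simp add: s_def\<close>)
      show False
        by (rule resize_false[OF k1 g g' C(1) big(1) True tw c sim' s_def J_def jR])
    next
      case False
      then have less: "card C' < card C" using neq by simp
      note rs = resized_sym[OF C(1)]
      have tw': "twins E' u v" if "u \<in> C'" "v \<in> C'" for u v
        by (rule resized_class_twins[OF k1 g g' C(1) big(1) that])
      obtain c' where c': "c' \<in> C'" using big(2) k1 by fastforce
      have cV': "c' \<in> V'" using c' CV by blast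
      define s where "s = card (twin_class V' E' c')"
      define J where "J = {Q \<in> twin_class V' E' ` V'. s < card Q}"
      have "C' \<subseteq> twin_class V' E' c'" using tw' c' CV by (auto simp: twin_class_def)
      then have ks: "k \<le> s" unfolding s_def
        using big(2) card_mono[of "twin_class V' E' c'" C'] fin(2) by (simp add: twin_class_def)
      have "card V' = card (V' - C') + card C'"
        using card_Diff_subset[OF finC(2) CV(2)] card_mono[OF fin(2) CV(2)] by simp
      moreover have "card V = card (V - C) + card C"
        using card_Diff_subset[OF finC(1) CV(1)] card_mono[OF fin(1) CV(1)] by simp
      ultimately have V'V: "card V' \<le> card V" using bij_betw_same_card[OF bF] less by simp
      \<comment> \<open>Twins of \<open>c'\<close> outside \<open>C'\<close> come from twins of
        \<open>c\<close> outside \<open>C\<close>, so shrinking \<open>C\<close> to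
        \<open>C'\<close> cannot enlarge the similarity class.\<close>
      have "twin_class V' E' c' \<subseteq> C' \<union> F ` (twin_class V E c - C)"
      proof
        fix z assume z: "z \<in> twin_class V' E' c'"
        then have zV: "z \<in> V'" "twins E' c' z" by (simp_all add: twin_class_def)
        show "z \<in> C' \<union> F ` (twin_class V E c - C)"
        proof (cases "z \<in> C'")
          case False
          then have zC: "z \<in> V' - C'" using zV by simp
          then obtain u where u: "u \<in> V - C" "z = F u" using bij_betw_imp_surj_on[OF bF] by blast
          have "twins E' z v" if "v \<in> C'" for v
            using twins_trans[of E' z c' v] zV(2) tw'[OF c' that] twins_sym[of E' z c'] by simp
          from resized_twins_class[OF k1 g' g rs big(2) zC this c]
          have "twins E u c" using bij_betw_inv_into_left[OF bF u(1)] u(2) by simp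
          then have "u \<in> twin_class V E c - C"
            using u(1) by (simp add: twin_class_def twins_sym[of E c u])
          then show ?thesis using u(2) by simp
        qed simp
      qed
      then have "s \<le> card (C' \<union> F ` (twin_class V E c - C))"
        unfolding s_def using fin(1) finC by (intro card_mono) (auto simp: twin_class_def)
      also have "\<dots> \<le> card C' + card (F ` (twin_class V E c - C))" by (rule card_Un_le)
      also have "\<dots> \<le> card C' + card (twin_class V E c - C)"
        using fin(1) by (intro add_left_mono card_image_le) (simp add: twin_class_def)
      also have "card (twin_class V E c - C) = card (twin_class V E c) - card C"
        by (rule card_Diff_subset[OF finC(1) Csub])
      finally have "s \<le> card (twin_class V E c)"
        using less card_mono[OF _ Csub] fin(1) by (simp add: twin_class_def)
      then have "s + k \<le> R" using S[OF cV] by simp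
      then have jR: "card J + s + k \<le> R"
        by (rule resized_count[OF k2 ks fin(2) cV' s_def J_def R V'V])
      show False
        by (rule resize_false[OF k1 g' g rs big(2) less tw' c' sim0 s_def J_def jR])
    qed
  qed
qed

section \<open>The lower bound\<close>

lemma quantifier_rank_Neg: "quantifier_rank (Neg p) = quantifier_rank p"
  by (simp add: quantifier_rank_def image_image)

lemma quantifier_rank_Un:
  "Max (length ` (Nest p \<union> Nest q)) = max (quantifier_rank p) (quantifier_rank q)"
  unfolding quantifier_rank_def image_Un
  by (rule Max_Un) (use finite_Nest Nest_nonempty in auto)

lemma quantifier_rank_Conj:
  "quantifier_rank (Conj p q) = max (quantifier_rank p) (quantifier_rank q)"
  "quantifier_rank (Disj p q) = max (quantifier_rank p) (quantifier_rank q)"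
  using quantifier_rank_Un[of p q] by (simp_all add: quantifier_rank_def)

lemma Max_length_Cons: "Max (length ` (Cons a ` Nest p)) = Suc (quantifier_rank p)"
proof -
  have "length ` (Cons a ` Nest p) = Suc ` length ` Nest p" by (simp add: image_image)
  moreover have "Suc (Max (length ` Nest p)) = Max (Suc ` length ` Nest p)"
    by (rule mono_Max_commute) (use finite_Nest Nest_nonempty in \<open>auto simp: mono_def\<close>)
  ultimately show ?thesis by (simp add: quantifier_rank_def)
qed

lemma quantifier_rank_Exists:
  "quantifier_rank (Exists x p) = Suc (quantifier_rank p)"
  "quantifier_rank (Forall x p) = Suc (quantifier_rank p)"
  unfolding quantifier_rank_def[of "Exists x p"] quantifier_rank_def[of "Forall x p"] Nest.simps
  by (rule Max_length_Cons)+

text \<open>A partial matching of the values of the variables in \<open>A\<close>: prescribed by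
  \<open>F\<close> outside \<open>C\<close>, and an arbitrary bijection between the values in use
  inside.\<close>

definition corr :: "'a set \<Rightarrow> 'a set \<Rightarrow> 'b set \<Rightarrow> 'b set \<Rightarrow> ('a \<Rightarrow> 'b) \<Rightarrow>
    nat set \<Rightarrow> (nat \<Rightarrow> 'a) \<Rightarrow> (nat \<Rightarrow> 'b) \<Rightarrow> bool" where
  "corr V C V' C' F A s t \<longleftrightarrow> s ` A \<subseteq> V \<and> t ` A \<subseteq> V' \<and>
     (\<forall>x\<in>A. (s x \<in> C \<longleftrightarrow> t x \<in> C') \<and> (s x \<notin> C \<longrightarrow> t x = F (s x))) \<and>
     (\<forall>x\<in>A. \<forall>y\<in>A. s x = s y \<longleftrightarrow> t x = t y)"

lemma card_same_kernel:
  assumes "\<And>x y. x \<in> A \<Longrightarrow> y \<in> A \<Longrightarrow> s x = s y \<longleftrightarrow> t x = t y"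
  shows "card (s ` A) = card (t ` A)"
proof -
  define h where "h u = t (inv_into A s u)" for u
  have h: "h (s x) = t x" if "x \<in> A" for x
  proof -
    have "inv_into A s (s x) \<in> A" "s (inv_into A s (s x)) = s x"
      using that by (simp_all add: inv_into_into f_inv_into_f)
    then show ?thesis using assms that by (simp add: h_def)
  qed
  have "inj_on h (s ` A)"
  proof (rule inj_onI)
    fix u v assume uv: "u \<in> s ` A" "v \<in> s ` A" "h u = h v"
    obtain x where x: "u = s x" "x \<in> A" using uv(1) by (rule imageE)
    obtain y where y: "v = s y" "y \<in> A" using uv(2) by (rule imageE)
    show "u = v" using uv(3) x y h assms by simp
  qed
  then have "card (h ` s ` A) = card (s ` A)" by (rule card_image)
  moreover have "h ` s ` A = t ` A" using h by (simp add: image_image)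
  ultimately show ?thesis by simp
qed

lemma corr_card:
  assumes "corr V C V' C' F A s t"
  shows "card (s ` A \<inter> C) = card (t ` A \<inter> C')"
proof -
  define B where "B = {x \<in> A. s x \<in> C}"
  have "s ` A \<inter> C = s ` B" by (auto simp: B_def)
  moreover have "t ` A \<inter> C' = t ` B" using assms by (auto simp: B_def corr_def)
  moreover have "card (s ` B) = card (t ` B)"
    using assms by (intro card_same_kernel) (simp add: corr_def B_def)
  ultimately show ?thesis by simp
qed

lemma corr_extend:
  assumes c: "corr V C V' C' F A s t" and bij: "bij_betw F (V - C) (V' - C')" and CV': "C' \<subseteq> V'"
    and a: "a \<in> V" and fresh: "card (s ` A \<inter> C) < card C'"
  shows "\<exists>b\<in>V'. corr V C V' C' F (insert x A) (s(x := a)) (t(x := b))"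
proof -
  have c1: "s ` A \<subseteq> V" "t ` A \<subseteq> V'"
    and c2: "\<And>y. y \<in> A \<Longrightarrow> (s y \<in> C \<longleftrightarrow> t y \<in> C') \<and> (s y \<notin> C \<longrightarrow> t y = F (s y))"
    and c3: "\<And>y z. y \<in> A \<Longrightarrow> z \<in> A \<Longrightarrow> s y = s z \<longleftrightarrow> t y = t z"
    using c unfolding corr_def by blast+
  have ext: "corr V C V' C' F (insert x A) (s(x := a)) (t(x := b))"
    if b: "b \<in> V'" "a \<in> C \<longleftrightarrow> b \<in> C'" "a \<notin> C \<Longrightarrow> b = F a"
      "\<And>y. y \<in> A \<Longrightarrow> s y = a \<longleftrightarrow> t y = b" for b
    unfolding corr_def
  proof (intro conjI ballI)
    show "(s(x := a)) ` insert x A \<subseteq> V" "(t(x := b)) ` insert x A \<subseteq> V'"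
      using c1 a b(1) by auto
    fix y assume y: "y \<in> insert x A"
    show "((s(x := a)) y \<in> C) = ((t(x := b)) y \<in> C')"
      "(s(x := a)) y \<notin> C \<longrightarrow> (t(x := b)) y = F ((s(x := a)) y)"
      using c2 b(2,3) y by auto
    fix z assume z: "z \<in> insert x A"
    show "((s(x := a)) y = (s(x := a)) z) = ((t(x := b)) y = (t(x := b)) z)"
      using c3[of y z] b(4)[of y] b(4)[of z] y z by (cases "y = x"; cases "z = x") auto
  qed
  show ?thesis
  proof (cases "\<exists>y\<in>A. s y = a")
    case True
    then obtain y where y: "y \<in> A" "s y = a" by blast
    have "corr V C V' C' F (insert x A) (s(x := a)) (t(x := t y))"
    proof (rule ext)
      show "t y \<in> V'" using y c1 by auto
      show "a \<in> C \<longleftrightarrow> t y \<in> C'" "a \<notin> C \<Longrightarrow> t y = F a" using c2[OF y(1)] y(2) by auto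
      show "s z = a \<longleftrightarrow> t z = t y" if "z \<in> A" for z using c3[OF that y(1)] y(2) by simp
    qed
    then show ?thesis using y c1 by blast
  next
    case False
    show ?thesis
    proof (cases "a \<in> C")
      case False
      have aC: "a \<in> V - C" using a False by simp
      have Fa: "F a \<in> V' - C'" by (rule bij_betwE[OF bij, rule_format, OF aC])
      have "corr V C V' C' F (insert x A) (s(x := a)) (t(x := F a))"
      proof (rule ext)
        show "F a \<in> V'" "a \<in> C \<longleftrightarrow> F a \<in> C'" "F a = F a" using Fa False by simp_all
        fix y assume y: "y \<in> A"
        have "s y \<noteq> a" using \<open>\<not> (\<exists>y\<in>A. s y = a)\<close> y by blast
        moreover have "t y \<noteq> F a"
        proof
          assume t: "t y = F a"
          then have "s y \<notin> C" using c2[OF y] Fa by simp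
          then have "F (s y) = F a" "s y \<in> V - C" using c2[OF y] t c1 y by auto
          then have "s y = a" using bij_betw_imp_inj_on[OF bij] aC by (simp add: inj_on_def)
          then show False using \<open>s y \<noteq> a\<close> by simp
        qed
        ultimately show "s y = a \<longleftrightarrow> t y = F a" by simp
      qed
      then show ?thesis using Fa by blast
    next
      case True
      have "card (t ` A \<inter> C') < card C'" using fresh corr_card[OF c] by simp
      then have "t ` A \<inter> C' \<noteq> C'" by auto
      then obtain b where b: "b \<in> C'" "b \<notin> t ` A" by blast
      have "corr V C V' C' F (insert x A) (s(x := a)) (t(x := b))"
        by (rule ext) (use b CV' True \<open>\<not> (\<exists>y\<in>A. s y = a)\<close> in auto)
      then show ?thesis using b CV' by blast
    qed
  qed
qed

lemma corr_sym:
  assumes "corr V C V' C' F A s t" and bij: "bij_betw F (V - C) (V' - C')"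
  shows "corr V' C' V C (inv_into (V - C) F) A t s"
proof -
  have "inv_into (V - C) F (t y) = s y" if "y \<in> A" "t y \<notin> C'" for y
  proof -
    have "s y \<in> V - C" "t y = F (s y)" using assms(1) that by (auto simp: corr_def)
    then show ?thesis using bij_betw_inv_into_left[OF bij] by simp
  qed
  then show ?thesis using assms(1) unfolding corr_def by auto
qed

lemma corr_unsym:
  assumes "corr V' C' V C (inv_into (V - C) F) A t s" and bij: "bij_betw F (V - C) (V' - C')"
  shows "corr V C V' C' F A s t"
proof -
  have "F (s y) = t y" if "y \<in> A" "s y \<notin> C" for y
  proof -
    have "t y \<in> V' - C'" "s y = inv_into (V - C) F (t y)" using assms(1) that by (auto simp: corr_def)
    then show ?thesis using bij_betw_inv_into_right[OF bij] by simp
  qed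
  then show ?thesis using assms(1) unfolding corr_def by auto
qed

lemma corr_subset: "corr V C V' C' F A s t \<Longrightarrow> B \<subseteq> A \<Longrightarrow> corr V C V' C' F B s t"
  unfolding corr_def by blast

text \<open>\<open>P\<close> and \<open>Q\<close> stand for the truth of a subformula on the two
  sides, so that one statement serves both quantifiers. A quantifier uses at most one new vertex of
  \<open>C\<close>, which is paid for by the drop in rank.\<close>

lemma corr_back_forth:
  assumes r: "resized V E C V' E' C' F" and fin: "finite C" and le: "card C \<le> card C'"
    and c: "corr V C V' C' F A s t" and q: "card (s ` A \<inter> C) + Suc q \<le> card C"
    and PQ: "\<And>s' t'. corr V C V' C' F (insert x A) s' t' \<Longrightarrow>
      card (s' ` insert x A \<inter> C) + q \<le> card C \<Longrightarrow> P s' \<longleftrightarrow> Q t'"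
  shows "(\<forall>a\<in>V. \<exists>b\<in>V'. P (s(x := a)) \<longleftrightarrow> Q (t(x := b))) \<and>
    (\<forall>b\<in>V'. \<exists>a\<in>V. P (s(x := a)) \<longleftrightarrow> Q (t(x := b)))"
proof -
  have bij: "bij_betw F (V - C) (V' - C')" and CV: "C \<subseteq> V" "C' \<subseteq> V'"
    using r by (simp_all add: resized_def)
  have step: "P (s(x := a)) \<longleftrightarrow> Q (t(x := b))"
    if "corr V C V' C' F (insert x A) (s(x := a)) (t(x := b))" for a b
  proof (rule PQ[OF that])
    have "(s(x := a)) ` insert x A \<inter> C \<subseteq> insert a (s ` A \<inter> C)" by auto
    then have "card ((s(x := a)) ` insert x A \<inter> C) \<le> card (insert a (s ` A \<inter> C))"
      using fin by (intro card_mono) auto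
    also have "\<dots> \<le> Suc (card (s ` A \<inter> C))" using fin by (simp add: card_insert_if)
    finally show "card ((s(x := a)) ` insert x A \<inter> C) + q \<le> card C" using q by simp
  qed
  show ?thesis
  proof (intro conjI ballI)
    fix a assume a: "a \<in> V"
    have "card (s ` A \<inter> C) < card C'" using q le by simp
    from corr_extend[OF c bij CV(2) a this, of x]
    show "\<exists>b\<in>V'. P (s(x := a)) \<longleftrightarrow> Q (t(x := b))" using step by blast
  next
    fix b assume b: "b \<in> V'"
    have "card (t ` A \<inter> C') < card C" using q corr_card[OF c] by simp
    from corr_extend[OF corr_sym[OF c bij] bij_betw_inv_into[OF bij] CV(1) b this, of x]
    show "\<exists>a\<in>V. P (s(x := a)) \<longleftrightarrow> Q (t(x := b))"
      using step corr_unsym[OF _ bij] by blast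
  qed
qed

lemma resized_sat:
  assumes r: "resized V E C V' E' C' F" and fin: "finite C" and le: "card C \<le> card C'"
    and "free_vars p \<subseteq> A" "finite A" "corr V C V' C' F A s t"
    "card (s ` A \<inter> C) + quantifier_rank p \<le> card C"
  shows "sat (kgraph_struct k V E) s p \<longleftrightarrow> sat (kgraph_struct k V' E') t p"
  using assms(4-)
proof (induction p arbitrary: A s t)
  case (Eq x y)
  then show ?case by (simp add: corr_def)
next
  case (Rel xs)
  let ?Y = "set xs"
  have c: "corr V C V' C' F ?Y s t" by (rule corr_subset[OF Rel.prems(3)]) (use Rel.prems(1) in simp)
  have "inj_on s ?Y \<longleftrightarrow> inj_on t ?Y" using c unfolding corr_def inj_on_def by blast
  then have "distinct (map s xs) \<longleftrightarrow> distinct (map t xs)" by (simp add: distinct_map)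
  moreover have "(s ` ?Y - C) \<union> (s ` ?Y \<inter> C) \<in> E \<longleftrightarrow> F ` (s ` ?Y - C) \<union> (t ` ?Y \<inter> C') \<in> E'"
    by (rule resizedD[OF r _ _ _ corr_card[OF c]]) (use c in \<open>auto simp: corr_def\<close>)
  moreover have "(s ` ?Y - C) \<union> (s ` ?Y \<inter> C) = s ` ?Y" by auto
  moreover have "F ` (s ` ?Y - C) \<union> (t ` ?Y \<inter> C') = t ` ?Y"
  proof (intro equalityI subsetI)
    fix z assume "z \<in> F ` (s ` ?Y - C) \<union> (t ` ?Y \<inter> C')"
    then consider y where "y \<in> ?Y" "s y \<notin> C" "z = F (s y)" | "z \<in> t ` ?Y" by blast
    then show "z \<in> t ` ?Y"
    proof cases
      case 1
      then have "z = t y" using c by (simp add: corr_def)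
      then show ?thesis using 1(1) by simp
    qed
  next
    fix z assume "z \<in> t ` ?Y"
    then obtain y where y: "z = t y" "y \<in> ?Y" by (rule imageE)
    show "z \<in> F ` (s ` ?Y - C) \<union> (t ` ?Y \<inter> C')"
    proof (cases "s y \<in> C")
      case True
      then show ?thesis using c y by (simp add: corr_def)
    next
      case False
      then have "z = F (s y)" using c y by (simp add: corr_def)
      then show ?thesis using y False by simp
    qed
  qed
  ultimately show ?case by (simp add: rel_kgraph_struct)
next
  case (Neg p)
  then show ?case by (simp add: quantifier_rank_Neg)
next
  case (Conj p q)
  have "sat (kgraph_struct k V E) s p \<longleftrightarrow> sat (kgraph_struct k V' E') t p"
    by (rule Conj.IH(1)[of A]) (use Conj.prems in \<open>auto simp: quantifier_rank_Conj\<close>)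
  moreover have "sat (kgraph_struct k V E) s q \<longleftrightarrow> sat (kgraph_struct k V' E') t q"
    by (rule Conj.IH(2)[of A]) (use Conj.prems in \<open>auto simp: quantifier_rank_Conj\<close>)
  ultimately show ?case by simp
next
  case (Disj p q)
  have "sat (kgraph_struct k V E) s p \<longleftrightarrow> sat (kgraph_struct k V' E') t p"
    by (rule Disj.IH(1)[of A]) (use Disj.prems in \<open>auto simp: quantifier_rank_Conj\<close>)
  moreover have "sat (kgraph_struct k V E) s q \<longleftrightarrow> sat (kgraph_struct k V' E') t q"
    by (rule Disj.IH(2)[of A]) (use Disj.prems in \<open>auto simp: quantifier_rank_Conj\<close>)
  ultimately show ?case by simp
next
  case (Exists x p)
  have "sat (kgraph_struct k V E) s' p \<longleftrightarrow> sat (kgraph_struct k V' E') t' p"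
    if "corr V C V' C' F (insert x A) s' t'"
      "card (s' ` insert x A \<inter> C) + quantifier_rank p \<le> card C" for s' t'
    by (rule Exists.IH[OF _ _ that]) (use Exists.prems(1,2) in auto)
  from corr_back_forth[OF r fin le Exists.prems(3) _ this] show ?case
    using Exists.prems(4) by (fastforce simp: quantifier_rank_Exists)
next
  case (Forall x p)
  have "sat (kgraph_struct k V E) s' p \<longleftrightarrow> sat (kgraph_struct k V' E') t' p"
    if "corr V C V' C' F (insert x A) s' t'"
      "card (s' ` insert x A \<inter> C) + quantifier_rank p \<le> card C" for s' t'
    by (rule Forall.IH[OF _ _ that]) (use Forall.prems(1,2) in auto)
  from corr_back_forth[OF r fin le Forall.prems(3) _ this] show ?case
    using Forall.prems(4) by (fastforce simp: quantifier_rank_Exists)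
qed

lemma resized_clone:
  assumes g: "kgraph k V E" and C: "C \<subseteq> V" "k \<le> card C" and k: "k \<ge> 1"
    and tw: "\<And>u v. u \<in> C \<Longrightarrow> v \<in> C \<Longrightarrow> twins E u v"
  obtains E' :: "'a option set set" where "kgraph k (insert None (Some ` V)) E'"
    "resized V E C (insert None (Some ` V)) E' (insert None (Some ` C)) Some"
proof -
  define E' :: "'a option set set" where
    "E' = (\<lambda>e. Some ` e) ` E \<union> {insert None (Some ` T) | T c. c \<in> C \<and> c \<notin> T \<and> insert c T \<in> E}"
  have finC: "finite C" by (rule finite_subset[OF C(1)]) (use g in \<open>simp add: kgraph_def\<close>)
  have someE: "Some ` e \<in> E' \<longleftrightarrow> e \<in> E" for e
    by (auto simp: E'_def inj_image_eq_iff)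
  have noneE: "insert None (Some ` T) \<in> E' \<longleftrightarrow> (\<exists>c\<in>C. c \<notin> T \<and> insert c T \<in> E)" for T
  proof -
    have "insert None (Some ` T) = insert None (Some ` T') \<longleftrightarrow> T = T'" for T' :: "'a set"
      by (metis image_iff inj_Some inj_image_eq_iff insert_ident option.simps(3))
    moreover have "insert None (Some ` T) \<notin> (\<lambda>e. Some ` e) ` E" by auto
    ultimately show ?thesis by (auto simp: E'_def)
  qed
  have "kgraph k (insert None (Some ` V)) E'"
    unfolding kgraph_def
  proof (intro conjI ballI)
    show "finite (insert None (Some ` V))" using g by (simp add: kgraph_def)
    fix e assume "e \<in> E'"
    then consider e0 where "e0 \<in> E" "e = Some ` e0" |
      T c where "e = insert None (Some ` T)" "c \<in> C" "c \<notin> T" "insert c T \<in> E"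
      by (auto simp: E'_def)
    then have "e \<subseteq> insert None (Some ` V) \<and> card e = k"
    proof cases
      case 1
      then show ?thesis using kgraph_edge[OF g 1(1)] by (auto simp: card_image)
    next
      case 2
      then show ?thesis using kgraph_edge[OF g 2(4)] by (auto simp: card_image)
    qed
    then show "e \<subseteq> insert None (Some ` V)" "card e = k" by simp_all
  qed
  moreover have "A \<union> B \<in> E \<longleftrightarrow> Some ` A \<union> B' \<in> E'"
    if h: "A \<subseteq> V - C" "B \<subseteq> C" "B' \<subseteq> insert None (Some ` C)" "card B = card B'" for A B B'
  proof (cases "None \<in> B'")
    case False
    define B0 where "B0 = {b \<in> C. Some b \<in> B'}"
    have B0: "B' = Some ` B0" using h(3) False by (auto simp: B0_def)
    have "card B = card B0" using h(4) by (simp add: B0 card_image)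
    then have "A \<union> B \<in> E \<longleftrightarrow> A \<union> B0 \<in> E"
      using h by (intro twins_exchange[OF tw finC]) (auto simp: B0_def)
    then show ?thesis using someE[of "A \<union> B0"] by (simp add: B0 image_Un)
  next
    case True
    define B1 where "B1 = {b \<in> C. Some b \<in> B'}"
    have B1: "B' = insert None (Some ` B1)" using h(3) True by (auto simp: B1_def)
    have B1C: "B1 \<subseteq> C" by (auto simp: B1_def)
    have finB1: "finite B1" using finite_subset[OF B1C finC] .
    have cB: "card B = Suc (card B1)" using h(4) finB1 by (simp add: B1 card_image)
    have ex: "A \<union> B \<in> E \<longleftrightarrow> insert c (A \<union> B1) \<in> E" if c: "c \<in> C" "c \<notin> B1" for c
    proof -
      have "A \<union> B \<in> E \<longleftrightarrow> A \<union> insert c B1 \<in> E"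
        using h c B1C cB finB1 by (intro twins_exchange[OF tw finC]) auto
      then show ?thesis by simp
    qed
    have "Some ` A \<union> B' = insert None (Some ` (A \<union> B1))" by (auto simp: B1)
    then have "Some ` A \<union> B' \<in> E' \<longleftrightarrow> (\<exists>c\<in>C. c \<notin> A \<union> B1 \<and> insert c (A \<union> B1) \<in> E)"
      using noneE by simp
    also have "\<dots> \<longleftrightarrow> A \<union> B \<in> E"
    proof
      assume "\<exists>c\<in>C. c \<notin> A \<union> B1 \<and> insert c (A \<union> B1) \<in> E"
      then obtain c where "c \<in> C" "c \<notin> A \<union> B1" "insert c (A \<union> B1) \<in> E" by blast
      then show "A \<union> B \<in> E" using ex[of c] by simp
    next
      assume e: "A \<union> B \<in> E"
      \<comment> \<open>An edge has at most \<open>k\<close> vertices in \<open>C\<close>, so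
        \<open>B1\<close>, one smaller than \<open>B\<close>, leaves a vertex of \<open>C\<close> to
        replace \<open>None\<close>. This is where \<open>k \<le> card C\<close> is used.\<close>
      have "card B \<le> k" using kgraph_edge[OF g e] card_mono[of "A \<union> B" B] by simp
      then have "card B1 < card C" using cB C(2) by simp
      then have "B1 \<noteq> C" by auto
      then obtain c where c: "c \<in> C" "c \<notin> B1" using B1C by blast
      have "c \<notin> A" using c(1) h(1) by blast
      then show "\<exists>c\<in>C. c \<notin> A \<union> B1 \<and> insert c (A \<union> B1) \<in> E" using ex[OF c] e c by blast
    qed
    finally show ?thesis by simp
  qed
  moreover have "bij_betw Some (V - C) (insert None (Some ` V) - insert None (Some ` C))"
    by (auto simp: bij_betw_def)
  ultimately show thesis using that[of E'] C(1) unfolding resized_def by blast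
qed

text \<open>The clone has one vertex more, hence is not isomorphic. The inequality is strict because
  \<open>resized_sat\<close> tolerates a rank equal to the class size.\<close>

lemma rank_lower_bound:
  fixes V :: "'a set"
  assumes g: "kgraph k V E" and k: "k \<ge> 1" and c: "c \<in> V"
    and big: "k \<le> card (twin_class V E c)" and p: "defines_kgraph k V E p"
  shows "card (twin_class V E c) < quantifier_rank p"
proof (rule ccontr)
  assume "\<not> ?thesis"
  then have rank: "quantifier_rank p \<le> card (twin_class V E c)" by simp
  define C where "C = twin_class V E c"
  have CV: "C \<subseteq> V" by (auto simp: C_def twin_class_def)
  have fin: "finite V" using g by (simp add: kgraph_def)
  have finC: "finite C" by (rule finite_subset[OF CV fin])
  have tw: "twins E u v" if "u \<in> C" "v \<in> C" for u v
  proof -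
    have "twins E c u" "twins E c v" using that by (simp_all add: C_def twin_class_def)
    then show ?thesis using twins_trans[of E u c v] twins_sym[of E u c] by simp
  qed
  obtain E' :: "'a option set set" where E': "kgraph k (insert None (Some ` V)) E'"
    "resized V E C (insert None (Some ` V)) E' (insert None (Some ` C)) Some"
    using resized_clone[OF g CV big[folded C_def] k tw] by blast
  let ?V' = "insert None (Some ` V)"
  let ?N = "kgraph_struct k ?V' E'"
  have le: "card C \<le> card (insert None (Some ` C))"
    using finC by (simp add: card_image)
  have closed: "free_vars p = {}" using p by (simp add: defines_kgraph_def)
  have "sat (kgraph_struct k V E) (\<lambda>_. c) p \<longleftrightarrow> sat ?N (\<lambda>_. None) p"
    by (rule resized_sat[OF E'(2) finC le, where A = "{}"])
      (use closed rank in \<open>simp_all add: corr_def C_def\<close>)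
  moreover have "sat (kgraph_struct k V E) (\<lambda>_. c) p"
    using p c by (auto simp: defines_kgraph_def true_on_def)
  ultimately have "sat ?N (\<lambda>_. None) p" by simp
  then have "true_on ?N p"
    using true_on_iff_sat[OF closed, of "\<lambda>_. None" ?N] by auto
  moreover have "finite_struct k ?N"
    using E'(1) unfolding finite_struct_def kgraph_def by (auto simp: rel_kgraph_struct)
  moreover have "\<not> struct_iso k (kgraph_struct k V E) ?N"
  proof
    assume "struct_iso k (kgraph_struct k V E) ?N"
    then obtain f where "bij_betw f V ?V'" by (auto simp: struct_iso_def)
    then have "card V = card ?V'" by (rule bij_betw_same_card)
    then show False using fin by (simp add: card_image)
  qed
  ultimately show False using defines_kgraph_false_on[OF p] by blast
qed

section \<open>The upper bound\<close>

lemma exists_defining: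
  fixes V :: "'a set"
  assumes k: "k \<ge> 2" and g: "kgraph k V E" and ne: "V \<noteq> {}"
    and R: "(k - 1) * card V + k * (2 * k - 1) < k * (R + 1)"
    and S: "\<And>u. u \<in> V \<Longrightarrow> card (twin_class V E u) + k \<le> R"
  shows "\<exists>p. defines_kgraph k V E p \<and> alternation_number p \<le> 1 \<and> quantifier_rank p = R"
proof -
  let ?G = "kgraph_struct k V E"
  have fin: "finite V" using g by (simp add: kgraph_def)
  obtain u where "u \<in> V" using ne by blast
  then have kR: "k \<le> R" using S by fastforce
  then have R0: "R > 0" using k by simp
  have G: "finite (univ ?G)" "univ ?G \<noteq> {}" using fin ne by simp_all
  obtain p where p: "wf_fm k p" "free_vars p = {}" "alternation_number p \<le> 1" "quantifier_rank p = R"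
    "true_on ?G p"
    and game: "\<And>N :: nat rel_struct. univ N \<noteq> {} \<Longrightarrow> true_on N p \<Longrightarrow>
      simE k ?G N R [] [] \<and> simE k N ?G R [] []"
    by (rule game_formula[OF G R0]) (rule that, assumption+)
  have "struct_iso k ?G N" if N: "finite_struct k N" and t: "true_on N p" for N :: "nat rel_struct"
  proof -
    have nN: "univ N \<noteq> {}" using N by (simp add: finite_struct_def)
    have s: "simE k ?G N R [] []" "simE k N ?G R [] []" using game[OF nN t] by simp_all
    have "simU k ?G N k [] []" by (rule simU_mono[OF simE_simU[OF s(1)] nN kR])
    then obtain E' where E': "kgraph k (univ N) E'" "N = kgraph_struct k (univ N) E'"
      by (rule kgraph_of_simU[OF N g])
    have "struct_iso k ?G (kgraph_struct k (univ N) E')"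
      by (rule game_iso[OF k g E'(1) ne nN R S]) (use s E'(2) in simp_all)
    then show ?thesis using E'(2) by simp
  qed
  then show ?thesis using p unfolding defines_kgraph_def by blast
qed

theorem theorem9p8:
  fixes V :: "'a set" and E :: "'a set set" and k n :: nat
  assumes "k \<ge> 2"
    and "kgraph k V E"
    and "V \<noteq> {}"
    and "n = card V"
  shows "(real (sigma V E) \<le> (1 - 1 / real k) * real n + real k - 1 \<longrightarrow>
            real (D\<^sub>1 k V E) \<le> (1 - 1 / real k) * real n + 2 * real k - 1) \<and>
         (\<not> real (sigma V E) \<le> (1 - 1 / real k) * real n + real k - 1 \<longrightarrow>
            D\<^sub>1 k V E \<le> sigma V E + k \<and>
            \<bar>real (sigma V E + k) - real (D k V E)\<bar> \<le> real k - 1)"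
proof -
  note k = assms(1) and g = assms(2) and ne = assms(3)
  have k1: "k \<ge> 1" using k by simp
  have fin: "finite V" using g by (simp add: kgraph_def)
  define \<sigma> where "\<sigma> = sigma V E"
  have cl: "sim_class V E u = twin_class V E u" if "u \<in> V" for u
    using similar_iff_twins[OF g that] by (auto simp: sim_class_def twin_class_def similar_def)
  have le: "card (twin_class V E u) \<le> \<sigma>" if "u \<in> V" for u
    using that fin cl[OF that] by (auto simp: \<sigma>_def sigma_def intro!: Max_ge image_eqI[of _ _ u])
  have "\<sigma> \<in> (\<lambda>u. card (sim_class V E u)) ` V"
    unfolding \<sigma>_def sigma_def using fin ne by (intro Max_in) auto
  then obtain c where c: "\<sigma> = card (sim_class V E c)" "c \<in> V" by (rule imageE)
  then have c\<sigma>: "\<sigma> = card (twin_class V E c)" using cl by simp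
  let ?b = "(1 - 1 / real k) * real n + 2 * real k - 1"
  \<comment> \<open>The second condition says that \<open>R\<close> is at least the integer part of
    \<open>?b\<close>; multiplied by \<open>k\<close> it becomes the inequality between natural
    numbers required by \<open>exists_defining\<close>.\<close>
  have bound: "\<exists>p. defines_kgraph k V E p \<and> alternation_number p \<le> 1 \<and> quantifier_rank p = R"
    if R: "\<sigma> + k \<le> R" "?b < real R + 1" for R
  proof (rule exists_defining[OF k g ne])
    have "real k * ?b < real k * (real R + 1)" using R(2) k by (intro mult_strict_left_mono) auto
    moreover have "real k * ?b = real ((k - 1) * n + k * (2 * k - 1))"
      using k by (simp add: of_nat_diff field_simps)
    moreover have "real k * (real R + 1) = real (k * (R + 1))"
      by (simp add: algebra_simps)
    ultimately have "real ((k - 1) * n + k * (2 * k - 1)) < real (k * (R + 1))" by (simp only:)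
    then show "(k - 1) * card V + k * (2 * k - 1) < k * (R + 1)"
      unfolding of_nat_less_iff assms(4) .
    show "card (twin_class V E u) + k \<le> R" if "u \<in> V" for u using le[OF that] R(1) by simp
  qed
  have D1: "D\<^sub>1 k V E \<le> R" if "\<sigma> + k \<le> R" "?b < real R + 1" for R
    unfolding D\<^sub>1_def using bound[OF that] by (intro Least_le)
  show ?thesis
  proof (intro conjI impI)
    assume s: "real (sigma V E) \<le> (1 - 1 / real k) * real n + real k - 1"
    define R where "R = nat \<lfloor>?b\<rfloor>"
    have sb: "real (\<sigma> + k) \<le> ?b" using s by (simp add: \<sigma>_def)
    then have b0: "0 \<le> ?b" by linarith
    have Rb: "real R \<le> ?b" "?b < real R + 1" unfolding R_def using b0 by linarith+
    have "real (\<sigma> + k) < real R + 1" using sb Rb(2) by linarith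
    then have "\<sigma> + k \<le> R" by linarith
    then show "real (D\<^sub>1 k V E) \<le> ?b" using D1[OF _ Rb(2)] Rb(1) by fastforce
  next
    assume s: "\<not> real (sigma V E) \<le> (1 - 1 / real k) * real n + real k - 1"
    have R: "\<sigma> + k \<le> \<sigma> + k" "?b < real (\<sigma> + k) + 1" using s by (simp_all add: \<sigma>_def)
    show "D\<^sub>1 k V E \<le> sigma V E + k" using D1[OF R] by (simp add: \<sigma>_def)
  next
    assume s: "\<not> real (sigma V E) \<le> (1 - 1 / real k) * real n + real k - 1"
    have R: "\<sigma> + k \<le> \<sigma> + k" "?b < real (\<sigma> + k) + 1" using s by (simp_all add: \<sigma>_def)
    obtain p where p: "defines_kgraph k V E p" "quantifier_rank p = \<sigma> + k"
      using bound[OF R] by blast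
    have up: "D k V E \<le> \<sigma> + k" unfolding D_def using p by (intro Least_le) blast
    have "\<exists>d p. defines_kgraph k V E p \<and> quantifier_rank p = d" using p by blast
    from LeastI_ex[OF this] obtain q where q: "defines_kgraph k V E q" "quantifier_rank q = D k V E"
      unfolding D_def by blast
    \<comment> \<open>In this case \<sigma> exceeds k - 1, so the largest class is big enough to be
      cloned. Then \<sigma> + 1 \<le> \<open>D k V E\<close> \<le> \<sigma> + k, and the gap to the
      upper end is at most k - 1.\<close>
    have "0 \<le> (1 - 1 / real k) * real n" using k by (intro mult_nonneg_nonneg) auto
    then have "real k - 1 < real \<sigma>" using s by (simp add: \<sigma>_def)
    then have "k \<le> \<sigma>" by linarith
    then have "\<sigma> < D k V E"
      using rank_lower_bound[OF g k1 c(2) _ q(1)] q(2) c\<sigma> by simp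
    then show "\<bar>real (sigma V E + k) - real (D k V E)\<bar> \<le> real k - 1"
      using up k by (simp add: \<sigma>_def)
  qed
qed

end
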